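(* Let $(\phi_1,\dots,\phi_n)$, $n\ge2$, be a Chebyshev asymptotic scale on $[T,x_0[$ with $\phi_i\in AC^{n-1}[T,x_0[$ and $W(\phi_1,\dots,\phi_i)>0$ on $[T,x_0[$ for $1\le i\le n$, and let $f\in AC^{n-1}[T,x_0[$ satisfy $L[f](x)\ge0$ for a.e. $x\in[T,x_0[$. The following are equivalent: (i) there are $a_1,\dots,a_{n-1}\in\mathbb R$ with $f(x)=\sum_{j=1}^{n-1}a_j\phi_j(x)+O(\phi_n(x))$ as $x\to x_0^-$; (ii) there are $a_1,\dots,a_n\in\mathbb R$ with $f(x)=\sum_{j=1}^{n}a_j\phi_j(x)+o(\phi_n(x))$ as $x\to x_0^-$; (iii) there are $a_1,\dots,a_n\in\mathbb R$ with $L_k[f(x)]=\sum_{j=1}^{n-k}a_jL_k[\phi_j(x)]+o(1)$ as $x\to x_0^-$ for $1\le k\le n-1$, together with $f(x)=\sum_{j=1}^na_j\phi_j(x)+o(\phi_n(x))$; (iv) there are $a_1,\dots,a_n\in\mathbb R$ with $f(x)=\sum_{j=1}^na_j\phi_j(x)+o(\phi_n(x))$ and $M_k[f(x)]=\sum_{j=k+1}^na_jM_k[\phi_j(x)]+o(M_k[\phi_n(x)])$ for $1\le k\le n-1$, as $x\to x_0^-$; (v) $\int_T^{x_0}\frac{dt_1}{p_1(t_1)}\int_{t_1}^{x_0}\frac{dt_2}{p_2(t_2)}\cdots\int_{t_{n-2}}^{x_0}\frac{dt_{n-1}}{p_{n-1}(t_{n-1})}\int_{t_{n-1}}^{x_0}\frac{L[f](t)}{p_n(t)}dt<+\infty$;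 (vi) $\int_T^{x_0}\frac{L[f](t)}{q_n(t)}dt<+\infty$. If these hold, the remainder $R_0:=f-\sum_{j=1}^na_j\phi_j$ satisfies, for $x\in[T,x_0[$, $$R_0(x)=\frac{(-1)^n}{p_0(x)}\int_x^{x_0}\frac{dt_1}{p_1(t_1)}\cdots\int_{t_{n-2}}^{x_0}\frac{dt_{n-1}}{p_{n-1}(t_{n-1})}\int_{t_{n-1}}^{x_0}\frac{L[f](t)}{p_n(t)}dt=\frac{(-1)^n}{q_0(x)}\int_x^{x_0}\frac{dt_1}{q_1(t_1)}\cdots\int_{t_{n-2}}^{x_0}\frac{dt_{n-1}}{q_{n-1}(t_{n-1})}\int_{t_{n-1}}^{x_0}\frac{L[f](t)}{q_n(t)}dt;$$ hence $(-1)^nR_0(x)\ge0$ on $[T,x_0[$, and the functions $(-1)^nR_0\,p_0=(-1)^nR_0/|\phi_n|$ and $(-1)^nR_0\,q_0=(-1)^nR_0/|\phi_1|$ are decreasing on $[T,x_0[$.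
   Context: $T\in\mathbb R$, $x_0\in\mathbb R\cup\{+\infty\}$, $T<x_0$. $AC^k(I)$: functions whose $k$-th derivative is absolutely continuous on every compact subinterval of $I$. $W(\cdot)$ is the Wronskian; $g\gg h$ as $x\to x_0^-$ means $h/g\to0$. A Chebyshev asymptotic scale on $[T,x_0[$: real $\phi_i\in C^{n-1}[T,x_0[$, each nonzero on a left deleted neighbourhood of $x_0$, $\phi_1\gg\dots\gg\phi_n$ as $x\to x_0^-$, $W(\phi_1,\dots,\phi_i)\neq0$ on $[T,x_0[$. $Lu:=W(\phi_1,\dots,\phi_n,u)/W(\phi_1,\dots,\phi_n)$ (defined a.e.). With $W_i:=W(\phi_1,\dots,\phi_i)$, $W_0:=1$: $q_0:=1/|\phi_1|$, $q_i:=W_i^2/|W_{i-1}W_{i+1}|$ ($1\le i\le n-1$), $q_n:=|W_n/W_{n-1}|$; $M_0u:=q_0u$, $M_ku:=q_k(M_{k-1}u)'$. With $\widetilde W_i:=W(\phi_n,\dots,\phi_{n-i+1})$, $\widetilde W_0:=1$ (nonvanishing): $p_0:=1/|\phi_n|$, $p_i:=\widetilde W_i^2/|\widetilde W_{i-1}\widetilde W_{i+1}|$ ($1\le i\le n-1$), $p_n:=|\widetilde W_n/\widetilde W_{n-1}|$; $L_0u:=p_0u$, $L_ku:=p_k(L_{k-1}u)'$. Integrals $\int^{x_0}$ are improper; the integrands in (v),(vi) are nonnegative. *)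

theory Defs
  imports "HOL-Analysis.Analysis" "HOL-Library.Landau_Symbols"
begin

definition Ico_e :: "real \<Rightarrow> ereal \<Rightarrow> real set" where
  "Ico_e s x0 = {t. s \<le> t \<and> ereal t < x0}"

definition left_at :: "ereal \<Rightarrow> real filter" where
  "left_at x0 = (if x0 = \<infinity> then at_top else at_left (real_of_ereal x0))"

definition hderiv :: "real set \<Rightarrow> nat \<Rightarrow> (real \<Rightarrow> real) \<Rightarrow> real \<Rightarrow> real" where
  "hderiv S k f = ((\<lambda>g x. vector_derivative g (at x within S)) ^^ k) f"

definition Ck_on :: "real set \<Rightarrow> nat \<Rightarrow> (real \<Rightarrow> real) \<Rightarrow> bool" where
  "Ck_on S k f \<longleftrightarrow>
     (\<forall>j<k. \<forall>x\<in>S. (hderiv S j f has_vector_derivative hderiv S (Suc j) f x) (at x within S))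
     \<and> continuous_on S (hderiv S k f)"

definition abs_cont_on :: "real \<Rightarrow> real \<Rightarrow> (real \<Rightarrow> real) \<Rightarrow> bool" where
  "abs_cont_on a b g \<longleftrightarrow>
     (\<forall>\<epsilon>>0. \<exists>\<delta>>0. \<forall>(m::nat) (u::nat \<Rightarrow> real) v.
        (\<forall>i<m. a \<le> u i \<and> u i \<le> v i \<and> v i \<le> b)
        \<and> (\<forall>i<m. \<forall>j<m. i \<noteq> j \<longrightarrow> v i \<le> u j \<or> v j \<le> u i)
        \<and> (\<Sum>i<m. v i - u i) < \<delta>
        \<longrightarrow> (\<Sum>i<m. \<bar>g (v i) - g (u i)\<bar>) < \<epsilon>)"

definition ACk_on :: "real set \<Rightarrow> nat \<Rightarrow> (real \<Rightarrow> real) \<Rightarrow> bool" where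
  "ACk_on S k f \<longleftrightarrow>
     (\<forall>j<k. \<forall>x\<in>S. (hderiv S j f has_vector_derivative hderiv S (Suc j) f x) (at x within S))
     \<and> (\<forall>a b. a \<le> b \<and> {a..b} \<subseteq> S \<longrightarrow> abs_cont_on a b (hderiv S k f))"

definition ndet :: "nat \<Rightarrow> (nat \<Rightarrow> nat \<Rightarrow> real) \<Rightarrow> real" where
  "ndet m A = (\<Sum>p | p permutes {..<m}. of_int (sign p) * (\<Prod>i<m. A i (p i)))"

definition wronskian :: "real set \<Rightarrow> (nat \<Rightarrow> real \<Rightarrow> real) \<Rightarrow> nat \<Rightarrow> real \<Rightarrow> real" where
  "wronskian S fs m x = (if m = 0 then 1 else ndet m (\<lambda>r c. hderiv S r (fs c) x))"

definition Wf :: "real set \<Rightarrow> (nat \<Rightarrow> real \<Rightarrow> real) \<Rightarrow> nat \<Rightarrow> real \<Rightarrow> real" where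
  "Wf S \<phi> i = wronskian S (\<lambda>c. \<phi> (Suc c)) i"

definition Wr :: "real set \<Rightarrow> (nat \<Rightarrow> real \<Rightarrow> real) \<Rightarrow> nat \<Rightarrow> nat \<Rightarrow> real \<Rightarrow> real" where
  "Wr S \<phi> n i = wronskian S (\<lambda>c. \<phi> (n - c)) i"

definition Lop :: "real set \<Rightarrow> (nat \<Rightarrow> real \<Rightarrow> real) \<Rightarrow> nat \<Rightarrow> (real \<Rightarrow> real) \<Rightarrow> real \<Rightarrow> real" where
  "Lop S \<phi> n u x =
     wronskian S (\<lambda>c. if c < n then \<phi> (Suc c) else u) (Suc n) x / Wf S \<phi> n x"

definition qw :: "real set \<Rightarrow> (nat \<Rightarrow> real \<Rightarrow> real) \<Rightarrow> nat \<Rightarrow> nat \<Rightarrow> real \<Rightarrow> real" where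
  "qw S \<phi> n i x =
     (if i = 0 then 1 / \<bar>\<phi> 1 x\<bar>
      else if i < n then (Wf S \<phi> i x)\<^sup>2 / \<bar>Wf S \<phi> (i - 1) x * Wf S \<phi> (Suc i) x\<bar>
      else \<bar>Wf S \<phi> n x / Wf S \<phi> (n - 1) x\<bar>)"

definition pw :: "real set \<Rightarrow> (nat \<Rightarrow> real \<Rightarrow> real) \<Rightarrow> nat \<Rightarrow> nat \<Rightarrow> real \<Rightarrow> real" where
  "pw S \<phi> n i x =
     (if i = 0 then 1 / \<bar>\<phi> n x\<bar>
      else if i < n then (Wr S \<phi> n i x)\<^sup>2 / \<bar>Wr S \<phi> n (i - 1) x * Wr S \<phi> n (Suc i) x\<bar>
      else \<bar>Wr S \<phi> n n x / Wr S \<phi> n (n - 1) x\<bar>)"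

fun Dop :: "real set \<Rightarrow> (nat \<Rightarrow> real \<Rightarrow> real) \<Rightarrow> nat \<Rightarrow> (real \<Rightarrow> real) \<Rightarrow> real \<Rightarrow> real" where
  "Dop S w 0 u = (\<lambda>x. w 0 x * u x)"
| "Dop S w (Suc k) u = (\<lambda>x. w (Suc k) x * vector_derivative (Dop S w k u) (at x within S))"

definition Mop :: "real set \<Rightarrow> (nat \<Rightarrow> real \<Rightarrow> real) \<Rightarrow> nat \<Rightarrow> nat \<Rightarrow> (real \<Rightarrow> real) \<Rightarrow> real \<Rightarrow> real" where
  "Mop S \<phi> n k = Dop S (qw S \<phi> n) k"

definition Lkop :: "real set \<Rightarrow> (nat \<Rightarrow> real \<Rightarrow> real) \<Rightarrow> nat \<Rightarrow> nat \<Rightarrow> (real \<Rightarrow> real) \<Rightarrow> real \<Rightarrow> real" where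
  "Lkop S \<phi> n k = Dop S (pw S \<phi> n) k"

text \<open>nint x0 w g n m s, for m < n, is
  int_s^x0 dt_(n-m)/w_(n-m)(t_(n-m)) ... int_(t_(n-2))^x0 dt_(n-1)/w_(n-1)(t_(n-1)) int_(t_(n-1))^x0 g(t)/w_n(t) dt
  (an integral of a nonnegative function, valued in [0, +infinity]).
  In particular nint x0 w g n (n-1) s is the full n-fold nested integral starting at s.\<close>
fun nint :: "ereal \<Rightarrow> (nat \<Rightarrow> real \<Rightarrow> real) \<Rightarrow> (real \<Rightarrow> real) \<Rightarrow> nat \<Rightarrow> nat \<Rightarrow> real \<Rightarrow> ennreal" where
  "nint x0 w g n 0 s =
     (\<integral>\<^sup>+ t. indicator (Ico_e s x0) t * ennreal (g t / w n t) \<partial>lborel)"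
| "nint x0 w g n (Suc m) s =
     (\<integral>\<^sup>+ t. indicator (Ico_e s x0) t * ennreal (1 / w (n - Suc m) t) * nint x0 w g n m t \<partial>lborel)"

definition cheb_asymp_scale :: "real \<Rightarrow> ereal \<Rightarrow> nat \<Rightarrow> (nat \<Rightarrow> real \<Rightarrow> real) \<Rightarrow> bool" where
  "cheb_asymp_scale T x0 n \<phi> \<longleftrightarrow>
     (\<forall>i\<in>{1..n}. Ck_on (Ico_e T x0) (n - 1) (\<phi> i))
     \<and> (\<forall>i\<in>{1..n}. eventually (\<lambda>x. \<phi> i x \<noteq> 0) (left_at x0))
     \<and> (\<forall>i\<in>{1..<n}. ((\<lambda>x. \<phi> (Suc i) x / \<phi> i x) \<longlongrightarrow> 0) (left_at x0))
     \<and> (\<forall>i\<in>{1..n}. \<forall>x\<in>Ico_e T x0. Wf (Ico_e T x0) \<phi> i x \<noteq> 0)"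

end

theory Submission
  imports Defs "Jordan_Normal_Form.Determinant"
begin

text \<open>
  The scale, read forwards and backwards, gives two factorizations of \<open>L\<close> into first-order operators.
  By the Desnanot--Jacobi identity, \<open>M\<^sub>k u = W(\<phi>\<^sub>1,\<dots>,\<phi>\<^sub>k,u) / W(\<phi>\<^sub>1,\<dots>,\<phi>\<^sub>k\<^sub>+\<^sub>1)\<close> up to sign (and similarly
  for \<open>L\<^sub>k\<close>), so that \<open>M\<^sub>k\<close> annihilates \<open>\<phi>\<^sub>1,\<dots>,\<phi>\<^sub>k\<close> and maps \<open>\<phi>\<^sub>k\<^sub>+\<^sub>1\<close> to a constant \<open>\<plusminus>1\<close>.
  Since \<open>L f \<ge> 0\<close>, the last function \<open>M\<^sub>n\<^sub>-\<^sub>1 f\<close> is increasing, and therefore every \<open>M\<^sub>k f\<close> is eventually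
  monotone. Comparing \<open>M\<^sub>k u\<close> with \<open>M\<^sub>k \<phi>\<^sub>k\<^sub>+\<^sub>1\<close> and integrating back down to \<open>u\<close> and \<open>\<phi>\<^sub>k\<^sub>+\<^sub>1\<close> (in place of l'Hospital's
  rule) turns asymptotic relations for \<open>u\<close> into limits of the \<open>M\<^sub>k u\<close>; here \<open>M\<^sub>k \<phi>\<^sub>j\<close> tends to 0 and
  \<open>L\<^sub>k \<phi>\<^sub>j\<close> to infinity for the remaining indices. Hence all conditions are equivalent to the vanishing of all
  \<open>M\<^sub>k R\<^sub>0\<close>, equivalently of all \<open>L\<^sub>k R\<^sub>0\<close>, at the right end point, and integrating back from there yields the nested integrals.
\<close>

section \<open>Absolutely continuous functions\<close>

text \<open>\<open>L f\<close> involves a derivative of order n that exists only almost everywhere,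
  while \<open>abs_cont_on\<close> is the bare epsilon-delta condition. Integrating the last
  operator therefore rests on almost everywhere differentiability of absolutely continuous functions
  and on the fundamental theorem for them, obtained from Vitali coverings and from a gauge argument.

  Both factorizations are instances of one construction. For the reversed scale
  \<open>\<psi> j = \<phi> (n + 1 - j)\<close> the weights \<open>qw\<close> turn into
  \<open>pw\<close>, so one locale carries the algebra, the monotonicity and the nested integrals.
  The two orders differ in whether the images of later scale functions vanish or diverge.

  What makes the comparisons work is a dichotomy: an eventually monotone image \<open>D k u\<close>
  that does not tend to 0 stays away from 0. It then dominates the constant
  \<open>D k (\<psi> (Suc k))\<close>, and integrating this inequality down to level 0 contradicts a
  little-o relation between \<open>u\<close> and \<open>\<psi> (Suc k)\<close>.\<close>

definition small_variation :: "real \<Rightarrow> real \<Rightarrow> (real \<Rightarrow> real) \<Rightarrow> real \<Rightarrow> real \<Rightarrow> bool" where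
  "small_variation a b g \<delta> \<epsilon> \<longleftrightarrow>
     (\<forall>(m::nat) u v. (\<forall>i<m. a \<le> u i \<and> u i \<le> v i \<and> v i \<le> b)
        \<and> (\<forall>i<m. \<forall>j<m. i \<noteq> j \<longrightarrow> v i \<le> u j \<or> v j \<le> u i)
        \<and> (\<Sum>i<m. v i - u i) < \<delta>
        \<longrightarrow> (\<Sum>i<m. \<bar>g (v i) - g (u i)\<bar>) < \<epsilon>)"

lemma abs_cont_on_iff: "abs_cont_on a b g \<longleftrightarrow> (\<forall>\<epsilon>>0. \<exists>\<delta>>0. small_variation a b g \<delta> \<epsilon>)"
  by (simp add: abs_cont_on_def small_variation_def)

lemma abs_cont_onE:
  assumes "abs_cont_on a b g" "\<epsilon> > 0"
  obtains \<delta> where "\<delta> > 0" "small_variation a b g \<delta> \<epsilon>"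
  using assms unfolding abs_cont_on_iff by blast

text \<open>Divisions and Vitali covers arrive as sets of intervals, whereas
  \<open>abs_cont_on\<close> speaks of indexed end points; this is the set form of its side
  condition.\<close>

definition nonoverlapping :: "real \<Rightarrow> real \<Rightarrow> real set set \<Rightarrow> bool" where
  "nonoverlapping a b D \<longleftrightarrow> finite D \<and> (\<forall>K\<in>D. \<exists>u v. K = {u..v} \<and> a \<le> u \<and> u \<le> v \<and> v \<le> b) \<and>
     (\<forall>K\<in>D. \<forall>L\<in>D. K \<noteq> L \<longrightarrow> interior K \<inter> interior L = {})"

lemma nonoverlappingI:
  assumes "finite D" "\<And>K. K \<in> D \<Longrightarrow> \<exists>u v. K = {u..v} \<and> a \<le> u \<and> u \<le> v \<and> v \<le> b"
    "\<And>K L. K \<in> D \<Longrightarrow> L \<in> D \<Longrightarrow> K \<noteq> L \<Longrightarrow> interior K \<inter> interior L = {}"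
  shows "nonoverlapping a b D"
  using assms by (simp add: nonoverlapping_def)

lemma small_variation_intervals:
  assumes sv: "small_variation a b g \<delta> \<epsilon>" and D: "nonoverlapping a b D"
    and small: "(\<Sum>K\<in>D. measure lborel K) < \<delta>"
  shows "(\<Sum>K\<in>D. \<bar>g (Sup K) - g (Inf K)\<bar>) < \<epsilon>"
proof -
  have fin: "finite D" and int: "\<And>K. K \<in> D \<Longrightarrow> \<exists>u v. K = {u..v} \<and> a \<le> u \<and> u \<le> v \<and> v \<le> b"
    and disj: "\<And>K L. K \<in> D \<Longrightarrow> L \<in> D \<Longrightarrow> K \<noteq> L \<Longrightarrow> interior K \<inter> interior L = {}"
    using D by (simp_all add: nonoverlapping_def)
  \<comment> \<open>A degenerate interval has empty interior and may lie inside another member of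
    \<open>D\<close>, which would violate the ordering of end points in
    \<open>small_variation\<close>. It contributes 0 to both sums and is dropped.\<close>
  define D' where "D' = {K\<in>D. Inf K < Sup K}"
  have fin': "finite D'" using fin by (simp add: D'_def)
  have int': "a \<le> Inf K \<and> Inf K < Sup K \<and> Sup K \<le> b \<and> interior K = {Inf K<..<Sup K} \<and>
      measure lborel K = Sup K - Inf K" if K: "K \<in> D'" for K
  proof -
    obtain u v where "K = {u..v}" "a \<le> u" "u \<le> v" "v \<le> b" using K int[of K] by (auto simp: D'_def)
    with K show ?thesis by (simp add: D'_def interior_atLeastAtMost_real)
  qed
  have D0: "measure lborel K = 0 \<and> g (Sup K) - g (Inf K) = 0" if KD: "K \<in> D - D'" for K
  proof -
    obtain u v where "K = {u..v}" "a \<le> u" "u \<le> v" "v \<le> b" using KD int[of K] by auto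
    with KD show ?thesis by (auto simp: D'_def)
  qed
  obtain h where h: "bij_betw h {..<card D'} D'"
    using ex_bij_betw_nat_finite[OF fin'] by (auto simp: atLeast0LessThan)
  have hD: "h i \<in> D'" if "i < card D'" for i
    using h that by (auto simp: bij_betw_def)
  have "(\<Sum>i<card D'. \<bar>g (Sup (h i)) - g (Inf (h i))\<bar>) < \<epsilon>"
  proof (rule sv[unfolded small_variation_def, rule_format], intro conjI)
    show "\<forall>i<card D'. a \<le> Inf (h i) \<and> Inf (h i) \<le> Sup (h i) \<and> Sup (h i) \<le> b"
      using int' hD by (meson less_imp_le)
    show "\<forall>i<card D'. \<forall>j<card D'. i \<noteq> j \<longrightarrow> Sup (h i) \<le> Inf (h j) \<or> Sup (h j) \<le> Inf (h i)"
    proof (intro allI impI, rule ccontr)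
      fix i j assume ij: "i < card D'" "j < card D'" "i \<noteq> j"
        and n: "\<not> (Sup (h i) \<le> Inf (h j) \<or> Sup (h j) \<le> Inf (h i))"
      have ne: "h i \<noteq> h j" using h ij by (auto simp: bij_betw_def inj_on_def)
      have "interior (h i) \<inter> interior (h j) = {}"
        using hD[OF ij(1)] hD[OF ij(2)] ne disj by (auto simp: D'_def)
      moreover have "interior (h i) = {Inf (h i)<..<Sup (h i)}" "interior (h j) = {Inf (h j)<..<Sup (h j)}"
        using int'[OF hD[OF ij(1)]] int'[OF hD[OF ij(2)]] by simp_all
      \<comment> \<open>The midpoint of the overlap lies in both interiors.\<close>
      moreover have "(max (Inf (h i)) (Inf (h j)) + min (Sup (h i)) (Sup (h j))) / 2
          \<in> {Inf (h i)<..<Sup (h i)} \<inter> {Inf (h j)<..<Sup (h j)}"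
        using n int'[OF hD[OF ij(1)]] int'[OF hD[OF ij(2)]] by (auto simp: max_def min_def field_simps)
      ultimately show False by auto
    qed
    have "(\<Sum>i<card D'. Sup (h i) - Inf (h i)) = (\<Sum>K\<in>D'. Sup K - Inf K)"
      by (rule sum.reindex_bij_betw[OF h])
    also have "\<dots> = (\<Sum>K\<in>D'. measure lborel K)"
      using int' by (intro sum.cong refl) simp
    also have "\<dots> = (\<Sum>K\<in>D. measure lborel K)"
      using D0 fin by (intro sum.mono_neutral_left) (auto simp: D'_def)
    finally show "(\<Sum>i<card D'. Sup (h i) - Inf (h i)) < \<delta>" using small by simp
  qed
  also have "(\<Sum>i<card D'. \<bar>g (Sup (h i)) - g (Inf (h i))\<bar>) = (\<Sum>K\<in>D'. \<bar>g (Sup K) - g (Inf K)\<bar>)"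
    by (rule sum.reindex_bij_betw[OF h])
  also have "\<dots> = (\<Sum>K\<in>D. \<bar>g (Sup K) - g (Inf K)\<bar>)"
    using D0 fin by (intro sum.mono_neutral_left) (auto simp: D'_def)
  finally show ?thesis .
qed

lemma measure_Union_intervals:
  fixes D :: "real set set"
  assumes "finite D" "\<And>K. K \<in> D \<Longrightarrow> \<exists>u v. K = {u..v}"
    and disj: "\<And>K L. K \<in> D \<Longrightarrow> L \<in> D \<Longrightarrow> K \<noteq> L \<Longrightarrow> interior K \<inter> interior L = {}"
  shows "measure lebesgue (\<Union>D) = (\<Sum>K\<in>D. measure lborel K)"
proof -
  have "measure lebesgue (\<Union>D) = (\<Sum>K\<in>D. measure lebesgue K)"
  proof (rule measure_negligible_finite_Union)
    show "pairwise (\<lambda>S T. negligible (S \<inter> T)) D"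
    proof (rule pairwiseI)
      fix K L assume KL: "K \<in> D" "L \<in> D" "K \<noteq> L"
      then obtain u v p q where e: "K = {u..v}" "L = {p..q}" using assms(2) by metis
      have "K \<inter> L \<subseteq> {u,v,p,q}" using disj[OF KL] unfolding e interior_atLeastAtMost_real by force
      then show "negligible (K \<inter> L)" by (rule negligible_subset[rotated]) (auto intro: negligible_finite)
    qed
  qed (use assms in auto)
  also have "\<dots> = (\<Sum>K\<in>D. measure lborel K)"
    using assms(2) by (intro sum.cong refl) (metis measure_lborel_Icc measure_completion sets_lborel atLeastAtMost_borel)
  finally show ?thesis .
qed

lemma lmeasurable_Union_intervals:
  fixes D :: "real set set"
  assumes "finite D" "\<And>K. K \<in> D \<Longrightarrow> \<exists>u v. K = {u..v}"
  shows "\<Union>D \<in> lmeasurable"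
proof (rule fmeasurable.finite_Union[OF assms(1)], rule subsetI)
  show "K \<in> lmeasurable" if "K \<in> D" for K using assms(2)[OF that] by (auto simp flip: box_real)
qed

lemma measure_le_Diff_plus:
  assumes "A \<in> lmeasurable" "B \<in> lmeasurable"
  shows "measure lebesgue A \<le> measure lebesgue (A - B) + measure lebesgue B"
proof -
  have "measure lebesgue A \<le> measure lebesgue ((A - B) \<union> B)"
    using assms by (intro measure_mono_fmeasurable) (auto intro!: fmeasurable.Un fmeasurable_Diff)
  also have "\<dots> \<le> measure lebesgue (A - B) + measure lebesgue B"
    using assms by (intro measure_Un_le) auto
  finally show ?thesis .
qed

text \<open>Off \<open>N\<close>, differentiability gives a gauge with error at most c times the
  length. Tags in \<open>N\<close> are forced into an open set of measure below delta, where
  absolute continuity bounds the total increment by e/2; there the integrand is replaced by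
  0.\<close>

lemma abs_cont_on_FTC:
  fixes g h :: "real \<Rightarrow> real"
  assumes ab: "a \<le> b" and ac: "abs_cont_on a b g" and N: "negligible N"
    and der: "\<And>x. x \<in> {a..b} - N \<Longrightarrow> (g has_real_derivative h x) (at x within {a..b})"
  shows "(h has_integral g b - g a) {a..b}"
proof -
  define h' where "h' x = (if x \<in> N then 0 else h x)" for x
  have "(h' has_integral g b - g a) {a..b}"
    unfolding has_integral_real
  proof (intro allI impI)
    fix e :: real assume e: "e > 0"
    \<comment> \<open>The summand 2 keeps the denominator positive when a = b and makes the error
      strictly smaller than e/2.\<close>
    define c where "c = e / (2 * (b - a) + 2)"
    have c: "c > 0" using e ab by (simp add: c_def)
    have c2: "c * (b - a) < e / 2"
      using e ab by (simp add: c_def field_simps)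
    obtain \<delta> where "\<delta> > 0" and \<delta>: "small_variation a b g \<delta> (e / 2)"
      using abs_cont_onE[OF ac half_gt_zero[OF e]] .
    obtain U where U: "open U" "N \<subseteq> U" "U - N \<in> lmeasurable" "emeasure lebesgue (U - N) < ennreal \<delta>"
      using sets_lebesgue_outer_open[OF _ \<open>\<delta> > 0\<close>, of N] N negligible_iff_null_sets by blast
    have UN: "U = (U - N) \<union> N" using U by auto
    have Um: "U \<in> lmeasurable"
      using fmeasurable.Un[OF U(3) negligible_imp_measurable[OF N]] UN by simp
    have "measure lebesgue U = measure lebesgue (U - N)"
      using measure_Diff_null_set[of U lebesgue N] N Um by (simp add: negligible_iff_null_sets fmeasurableD)
    then have mU: "measure lebesgue U < \<delta>"
      using U(3,4) \<open>\<delta> > 0\<close> by (simp add: emeasure_eq_measure2 ennreal_less_iff)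
    have "\<exists>d>0. x \<in> {a..b} - N \<longrightarrow> (\<forall>y\<in>{a..b}. \<bar>y - x\<bar> < d \<longrightarrow> \<bar>g y - g x - h x * (y - x)\<bar> \<le> c * \<bar>y - x\<bar>)" for x
    proof (cases "x \<in> {a..b} - N")
      case True
      from der[OF this, unfolded has_field_derivative_def has_derivative_within_alt]
      show ?thesis using c by auto
    qed (auto intro: exI[of _ 1])
    then obtain d where d: "\<And>x. d x > 0"
      "\<And>x y. x \<in> {a..b} - N \<Longrightarrow> y\<in>{a..b} \<Longrightarrow> \<bar>y - x\<bar> < d x \<Longrightarrow> \<bar>g y - g x - h x * (y - x)\<bar> \<le> c * \<bar>y - x\<bar>"
      by metis
    define \<gamma> where "\<gamma> x = (if x \<in> N then U else ball x (d x))" for x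
    show "\<exists>\<gamma>. gauge \<gamma> \<and> (\<forall>\<D>. \<D> tagged_division_of {a..b} \<and> \<gamma> fine \<D> \<longrightarrow>
        norm ((\<Sum>(x, k)\<in>\<D>. measure lborel k *\<^sub>R h' x) - (g b - g a)) < e)"
    proof (intro exI[of _ \<gamma>] conjI allI impI)
      show "gauge \<gamma>" using U d(1) by (auto simp: gauge_def \<gamma>_def)
      fix p assume "p tagged_division_of {a..b} \<and> \<gamma> fine p"
      then have p: "p tagged_division_of {a..b}" and fine: "\<gamma> fine p" by auto
      have finp: "finite p" using p by auto
      \<comment> \<open>A function that vanishes on intervals with empty interior may be summed over
        the intervals instead of over the tagged pairs. The first branch secures this for the empty
        set, whose \<open>Sup\<close> and \<open>Inf\<close> carry no information.\<close>
      define dg where "dg K = (if K = {} then 0 else \<bar>g (Sup K) - g (Inf K)\<bar>)" for K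
      have K: "\<exists>u v. K = {u..v} \<and> a \<le> u \<and> u \<le> x \<and> x \<le> v \<and> v \<le> b" if xK: "(x, K) \<in> p" for x K
      proof -
        obtain u v where "K = cbox u v" using tagged_division_ofD(4)[OF p xK] by blast
        with tagged_division_ofD(2,3)[OF p xK] show ?thesis by - (rule exI[of _ u], rule exI[of _ v], auto)
      qed
      have piece: "\<bar>measure lborel K *\<^sub>R h' x - (g (Sup K) - g (Inf K))\<bar>
          \<le> c * measure lborel K + (if x \<in> N then dg K else 0)" if xK: "(x, K) \<in> p" for x K
      proof -
        obtain u v where uv: "K = {u..v}" "a \<le> u" "u \<le> x" "x \<le> v" "v \<le> b" using K[OF xK] by auto
        show ?thesis
        proof (cases "x \<in> N")
          case True
          moreover have "0 \<le> c * (v - u)" using uv c by simp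
          ultimately show ?thesis using uv by (simp add: h'_def dg_def abs_minus_commute)
        next
          case False
          have "K \<subseteq> ball x (d x)" using fineD[OF fine xK] False by (simp add: \<gamma>_def)
          moreover have "u \<in> K" "v \<in> K" using uv by auto
          ultimately have "u \<in> ball x (d x)" "v \<in> ball x (d x)" by blast+
          then have "\<bar>u - x\<bar> < d x" "\<bar>v - x\<bar> < d x"
            by (simp_all add: dist_real_def abs_minus_commute)
          then have "\<bar>g u - g x - h x * (u - x)\<bar> \<le> c * \<bar>u - x\<bar>" "\<bar>g v - g x - h x * (v - x)\<bar> \<le> c * \<bar>v - x\<bar>"
            using d(2)[of x u] d(2)[of x v] uv False by auto
          then have "\<bar>(v - u) * h x - (g v - g u)\<bar> \<le> c * (v - u)"
            using uv by (simp add: abs_if algebra_simps split: if_splits)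
          then show ?thesis using uv False by (simp add: h'_def)
        qed
      qed
      define p' where "p' = {(x, K) \<in> p. x \<in> N}"
      have p': "p' tagged_partial_division_of {a..b}"
        using tagged_division_of_def p tagged_partial_division_subset[of p "{a..b}" p'] by (auto simp: p'_def)
      have "(\<Sum>(x, K)\<in>p'. dg K) = (\<Sum>K\<in>snd ` p'. dg K)"
      proof (rule sum.over_tagged_division_lemma[OF tagged_partial_division_of_Union_self[OF p']])
        show "dg (cbox u v) = 0" if "box u v = {}" for u v
          using that by (cases "u = v") (auto simp: dg_def)
      qed
      also have "\<dots> = (\<Sum>K\<in>snd ` p'. \<bar>g (Sup K) - g (Inf K)\<bar>)"
      proof (intro sum.cong refl)
        fix L assume "L \<in> snd ` p'"
        then obtain x where "(x, L) \<in> p" by (auto simp: p'_def)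
        from K[OF this] show "dg L = \<bar>g (Sup L) - g (Inf L)\<bar>" by (auto simp: dg_def)
      qed
      also have "\<dots> < e / 2"
      proof (rule small_variation_intervals[OF \<delta> nonoverlappingI])
        have fin': "finite (snd ` p')" using finp by (auto simp: p'_def intro: finite_subset)
        then show "finite (snd ` p')" .
        show *: "\<exists>u v. K = {u..v} \<and> a \<le> u \<and> u \<le> v \<and> v \<le> b" if "K \<in> snd ` p'" for K
          using that K by (force simp: p'_def)
        show dj: "interior K \<inter> interior L = {}" if KL: "K \<in> snd ` p'" "L \<in> snd ` p'" "K \<noteq> L" for K L
        proof -
          obtain x where x: "(x, K) \<in> p" using KL(1) by (auto simp: p'_def)
          obtain y where y: "(y, L) \<in> p" using KL(2) by (auto simp: p'_def)
          show ?thesis by (rule tagged_division_ofD(5)[OF p x y]) (use KL(3) in simp)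
        qed
        have "(\<Sum>K\<in>snd ` p'. measure lborel K) = measure lebesgue (\<Union>(snd ` p'))"
          by (rule sym, rule measure_Union_intervals[OF fin' _ dj]) (use * in blast)
        also have "\<dots> \<le> measure lebesgue U"
        proof (rule measure_mono_fmeasurable[OF _ _ Um])
          show "\<Union>(snd ` p') \<subseteq> U" using fine by (fastforce simp: p'_def fine_def \<gamma>_def)
          show "\<Union>(snd ` p') \<in> sets lebesgue"
            by (rule fmeasurableD[OF lmeasurable_Union_intervals[OF fin']]) (use * in blast)
        qed
        finally show "(\<Sum>K\<in>snd ` p'. measure lborel K) < \<delta>" using mU by simp
      qed
      finally have N_part: "(\<Sum>(x, K)\<in>p'. dg K) < e / 2" .
      have "\<bar>(\<Sum>(x, k)\<in>p. measure lborel k *\<^sub>R h' x) - (g b - g a)\<bar>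
          = \<bar>\<Sum>(x, K)\<in>p. measure lborel K *\<^sub>R h' x - (g (Sup K) - g (Inf K))\<bar>"
      proof -
        have "(\<Sum>(x, K)\<in>p. measure lborel K *\<^sub>R h' x - (g (Sup K) - g (Inf K)))
            = (\<Sum>(x, K)\<in>p. measure lborel K *\<^sub>R h' x) - (\<Sum>(x, K)\<in>p. g (Sup K) - g (Inf K))"
          unfolding split_def by (rule sum_subtractf)
        then show ?thesis unfolding additive_tagged_division_1[OF ab p, of g] by simp
      qed
      also have "\<dots> \<le> (\<Sum>(x, K)\<in>p. \<bar>measure lborel K *\<^sub>R h' x - (g (Sup K) - g (Inf K))\<bar>)"
        unfolding split_def by (rule sum_abs)
      also have "\<dots> \<le> (\<Sum>(x, K)\<in>p. c * measure lborel K + (if x \<in> N then dg K else 0))"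
        by (rule sum_mono) (use piece in \<open>simp only: split_paired_all split_conv\<close>)
      also have "\<dots> = c * (\<Sum>(x, K)\<in>p. measure lborel K) + (\<Sum>(x, K)\<in>p. if x \<in> N then dg K else 0)"
        by (simp add: sum.distrib split_def sum_distrib_left)
      also have "(\<Sum>(x, K)\<in>p. measure lborel K) = b - a"
        using additive_content_tagged_division[of p a b] p ab by (simp only: box_real) simp
      also have "(\<Sum>(x, K)\<in>p. if x \<in> N then dg K else 0) = (\<Sum>(x, K)\<in>p'. dg K)"
      proof -
        have "p' = {z \<in> p. fst z \<in> N}" by (auto simp: p'_def)
        then show ?thesis using finp by (simp add: split_def sum.inter_filter)
      qed
      finally show "norm ((\<Sum>(x, k)\<in>p. measure lborel k *\<^sub>R h' x) - (g b - g a)) < e"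
        using N_part c2 by simp
    qed
  qed
  then show ?thesis
    by (rule has_integral_spike[OF N, rotated]) (auto simp: h'_def)
qed

section \<open>Vitali coverings and the exceptional sets of difference quotients\<close>

lemma sum_increments_division:
  fixes g :: "real \<Rightarrow> real"
  assumes "a \<le> b" "p division_of {a..b}"
  shows "(\<Sum>K\<in>p. g (Sup K) - g (Inf K)) = g b - g a"
proof -
  let ?f = "(\<lambda>K::real set. if K = {} then 0 else g (interval_upperbound K) - g (interval_lowerbound K))"
  interpret operative_real plus 0 ?f
    rewrites "comm_monoid_set.F (+) 0 = sum"
    by standard[1] (auto simp add: sum_def)
  have p: "p division_of {a..b}" using assms(2) by simp
  have "?f {a..b} = (\<Sum>K\<in>p. ?f K)" by (rule division[OF p, symmetric])
  also have "\<dots> = (\<Sum>K\<in>p. g (Sup K) - g (Inf K))"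
    using division_ofD(3)[OF p] by (intro sum.cong) auto
  finally show ?thesis using assms(1) by simp
qed

text \<open>The intervals with property \<open>Q\<close> form a Vitali cover of this set. The strict
  inequalities around \<open>x\<close> make it a countable intersection of open sets, hence Borel,
  whatever \<open>Q\<close> is.\<close>

definition Vitali_pts :: "(real \<Rightarrow> real \<Rightarrow> bool) \<Rightarrow> real set" where
  "Vitali_pts Q = {x. \<forall>d>0. \<exists>u v. u < x \<and> x < v \<and> v - u < d \<and> Q u v}"

lemma Vitali_ptsD:
  "x \<in> Vitali_pts Q \<Longrightarrow> d > 0 \<Longrightarrow> \<exists>u v. u < x \<and> x < v \<and> v - u < d \<and> Q u v"
  by (simp add: Vitali_pts_def)

lemma Vitali_pts_mono:
  "x \<in> Vitali_pts P \<Longrightarrow> (\<And>u v. P u v \<Longrightarrow> Q u v) \<Longrightarrow> x \<in> Vitali_pts Q"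
  unfolding Vitali_pts_def by blast

lemma Vitali_pts_restrict_open:
  assumes x: "x \<in> Vitali_pts Q" and U: "open U" "x \<in> U"
  shows "x \<in> Vitali_pts (\<lambda>u v. Q u v \<and> {u..v} \<subseteq> U)"
  unfolding Vitali_pts_def
proof (intro CollectI allI impI)
  fix d :: real assume d: "d > 0"
  obtain h where h: "h > 0" "ball x h \<subseteq> U" using U by (meson openE)
  from Vitali_ptsD[OF x, of "min d h"] d h(1)
  obtain u v where uv: "u < x" "x < v" "v - u < min d h" "Q u v" by auto
  have "{u..v} \<subseteq> ball x h" using uv by (auto simp: dist_real_def)
  then show "\<exists>u v. u < x \<and> x < v \<and> v - u < d \<and> Q u v \<and> {u..v} \<subseteq> U"
    using uv h(2) by - (rule exI[of _ u], rule exI[of _ v], auto)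
qed

lemma borel_Vitali_pts: "Vitali_pts Q \<in> sets borel"
proof -
  have "Vitali_pts Q = (\<Inter>n. \<Union>(u,v)\<in>{(u,v). v - u < 1 / real (Suc n) \<and> Q u v}. {u<..<v})" (is "_ = ?R")
  proof (intro Set.set_eqI iffI)
    fix x assume "x \<in> Vitali_pts Q"
    have "\<exists>u v. v - u < 1 / real (Suc n) \<and> Q u v \<and> u < x \<and> x < v" for n
      using \<open>x \<in> Vitali_pts Q\<close>[unfolded Vitali_pts_def, simplified, rule_format, of "1 / real (Suc n)"]
      by auto
    then show "x \<in> ?R" by (auto simp del: of_nat_Suc)
  next
    fix x assume x: "x \<in> ?R"
    show "x \<in> Vitali_pts Q"
      unfolding Vitali_pts_def
    proof (intro CollectI allI impI)
      fix d :: real assume "d > 0"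
      then obtain n where n: "1 / real (Suc n) < d"
        by (metis inverse_eq_divide reals_Archimedean)
      from x have "x \<in> (\<Union>(u,v)\<in>{(u,v). v - u < 1 / real (Suc n) \<and> Q u v}. {u<..<v})" by blast
      then obtain u v where "v - u < 1 / real (Suc n)" "Q u v" "u < x" "x < v" by (simp del: of_nat_Suc) blast
      with n show "\<exists>u v. u < x \<and> x < v \<and> v - u < d \<and> Q u v"
        by - (rule exI[of _ u], rule exI[of _ v], linarith)
    qed
  qed
  also have "\<dots> \<in> sets borel"
    by (intro sets.countable_INT) (auto intro!: borel_open)
  finally show ?thesis .
qed

text \<open>The Vitali theorem gives a countable disjoint subfamily covering \<open>E\<close> up to
  a null set; continuity of the measure from above along its finite parts leaves less than eta
  uncovered.\<close>

lemma Vitali_finite_cover: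
  assumes E: "E \<in> lmeasurable" "E \<subseteq> Vitali_pts Q" and \<eta>: "\<eta> > 0"
  obtains D where "finite D" "\<And>K. K \<in> D \<Longrightarrow> \<exists>u v. u < v \<and> K = {u..v} \<and> Q u v"
    "\<And>K L. K \<in> D \<Longrightarrow> L \<in> D \<Longrightarrow> K \<noteq> L \<Longrightarrow> K \<inter> L = {}"
    "measure lebesgue (E - \<Union>D) < \<eta>"
proof -
  define I where "I = {(u,v). u < v \<and> Q u v}"
  define a where "a = (\<lambda>(u,v). (u + v) / (2::real))"
  define r where "r = (\<lambda>(u,v). (v - u) / (2::real))"
  have cb: "cball (a i) (r i) = {fst i..snd i}" if "i \<in> I" for i
    by (auto simp: a_def r_def cball_eq_atLeastAtMost split_def field_simps)
  have *: "\<exists>i. i \<in> I \<and> x \<in> cball (a i) (r i) \<and> r i < d" if x: "x \<in> E" and d: "d > 0" for x d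
  proof -
    have "x \<in> Vitali_pts Q" using x E(2) by blast
    then obtain u v where "u < x" "x < v" "v - u < d" "Q u v"
      using d unfolding Vitali_pts_def by blast
    then show ?thesis using cb[of "(u,v)"] by (intro exI[of _ "(u,v)"]) (auto simp: I_def r_def)
  qed
  have r: "0 < r i" if "i \<in> I" for i using that by (auto simp: I_def r_def)
  obtain C where C: "countable C" "C \<subseteq> I"
     "pairwise (\<lambda>i j. disjnt (cball (a i) (r i)) (cball (a j) (r j))) C"
     "negligible (E - (\<Union>i\<in>C. cball (a i) (r i)))"
    using Vitali_covering_theorem_cballs[OF r *] by blast
  show ?thesis
  proof (cases "C = {}")
    case True
    then have "measure lebesgue (E - \<Union>{}) = 0" using C(4) by (simp add: negligible_imp_measure0)
    then show ?thesis using \<eta> by (intro that[of "{}"]) auto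
  next
    case False
    define J where "J i = {fst i..snd i::real}" for i
    define A where "A n = E - (\<Union>k<n. J (from_nat_into C k))" for n :: nat
    have UC: "(\<Union>i\<in>C. cball (a i) (r i)) = (\<Union>k. J (from_nat_into C k))"
    proof -
      have "(\<Union>i\<in>C. cball (a i) (r i)) = (\<Union>i\<in>C. J i)"
        using cb C(2) by (intro SUP_cong) (auto simp: J_def)
      also have "\<dots> = (\<Union>i\<in>range (from_nat_into C). J i)" using range_from_nat_into[OF False C(1)] by simp
      finally show ?thesis by simp
    qed
    have Am: "A n \<in> lmeasurable" for n
      unfolding A_def J_def by (intro fmeasurable_Diff E sets.finite_UN) auto
    have "(\<lambda>n. measure lebesgue (A n)) \<longlonglongrightarrow> measure lebesgue (\<Inter>n. A n)"
    proof (rule Lim_measure_decseq)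
      show "range A \<subseteq> sets lebesgue" using Am by auto
      show "decseq A" by (auto simp: decseq_def A_def)
      show "emeasure lebesgue (A i) \<noteq> \<infinity>" for i using Am[of i] by (metis fmeasurableD2 infinity_ennreal_def)
    qed
    also have "(\<Inter>n. A n) = E - (\<Union>i\<in>C. cball (a i) (r i))"
      unfolding UC A_def by (auto intro: lessI)
    also have "measure lebesgue \<dots> = 0" using C(4) by (rule negligible_imp_measure0)
    finally have "eventually (\<lambda>n. measure lebesgue (A n) < \<eta>) sequentially"
      using \<eta> by (rule order_tendstoD)
    then obtain n where n: "measure lebesgue (A n) < \<eta>" by (auto simp: eventually_sequentially)
    define D where "D = J ` from_nat_into C ` {..<n}"
    show ?thesis
    proof (rule that[of D])
      show "finite D" by (simp add: D_def)
      have DC: "\<exists>i\<in>C. K = J i" if "K \<in> D" for K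
        using that from_nat_into[OF False] by (auto simp: D_def)
      show "\<exists>u v. u < v \<and> K = {u..v} \<and> Q u v" if "K \<in> D" for K
        using DC[OF that] C(2) by (auto simp: J_def I_def)
      show "K \<inter> L = {}" if KL: "K \<in> D" "L \<in> D" "K \<noteq> L" for K L
      proof -
        obtain i where i: "i \<in> C" "K = J i" using DC[OF KL(1)] by blast
        obtain j where j: "j \<in> C" "L = J j" using DC[OF KL(2)] by blast
        have "i \<noteq> j" using KL(3) i j by auto
        then have "disjnt (cball (a i) (r i)) (cball (a j) (r j))"
          using C(3) i j by (simp add: pairwise_def)
        moreover have "i \<in> I" "j \<in> I" using i j C(2) by auto
        then have "cball (a i) (r i) = K" "cball (a j) (r j) = L"
          using cb i j by (simp_all add: J_def)
        ultimately show ?thesis by (simp add: disjnt_def)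
      qed
      have "E - \<Union>D = A n" by (auto simp: A_def D_def)
      then show "measure lebesgue (E - \<Union>D) < \<eta>" using n by simp
    qed
  qed
qed

text \<open>On disjoint intervals of absolute slope above N and total length below delta, the
  increments sum to less than 1, so the total length is at most 1/N. Letting N grow leaves a null
  set.\<close>

lemma abs_cont_on_infinite_derivate_null:
  fixes g :: "real \<Rightarrow> real"
  assumes ac: "abs_cont_on a b g"
  shows "negligible (\<Inter>N::nat. Vitali_pts (\<lambda>u v. a < u \<and> v < b \<and> \<bar>g v - g u\<bar> > real N * (v - u)))" (is "negligible ?E")
proof -
  obtain \<delta> where "\<delta> > 0" and \<delta>: "small_variation a b g \<delta> 1"
    using abs_cont_onE[OF ac less_numeral_extra(1)] .
  \<comment> \<open>A ball of radius delta/3 has length 2 delta/3, so disjoint intervals inside it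
    meet the length bound; a locally null set is null.\<close>
  have loc: "negligible (?E \<inter> ball z (\<delta>/3))" for z
  proof -
    define B where "B = ?E \<inter> ball z (\<delta>/3)"
    have Bm: "B \<in> lmeasurable"
    proof -
      have "?E \<in> sets lebesgue" using borel_Vitali_pts by (intro sets_completionI_sets) auto
      then show ?thesis unfolding B_def by (subst Int_commute, intro fmeasurable_Int_fmeasurable) auto
    qed
    \<comment> \<open>One 1/N bounds the covered part, the other the part left uncovered.\<close>
    have main: "measure lebesgue B \<le> 2 / real N" if N: "N > 0" for N :: nat
    proof -
      define Q where "Q u v \<longleftrightarrow> (a < u \<and> v < b \<and> \<bar>g v - g u\<bar> > real N * (v - u)) \<and> {u..v} \<subseteq> ball z (\<delta>/3)" for u v
      have "x \<in> Vitali_pts Q" if "x \<in> B" for x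
        unfolding Q_def using that by (intro Vitali_pts_restrict_open) (auto simp: B_def)
      then have "B \<subseteq> Vitali_pts Q" ..
      then obtain D where D: "finite D" "\<And>K. K \<in> D \<Longrightarrow> \<exists>u v. u < v \<and> K = {u..v} \<and> Q u v"
        "\<And>K L. K \<in> D \<Longrightarrow> L \<in> D \<Longrightarrow> K \<noteq> L \<Longrightarrow> K \<inter> L = {}"
        "measure lebesgue (B - \<Union>D) < 1 / real N"
        using Vitali_finite_cover[OF Bm, of Q "1 / real N"] N by (metis of_nat_0_less_iff zero_less_divide_1_iff)
      have dj: "interior K \<inter> interior L = {}" if "K \<in> D" "L \<in> D" "K \<noteq> L" for K L
        using D(3)[OF that] interior_subset by blast
      have mD: "measure lebesgue (\<Union>D) = (\<Sum>K\<in>D. measure lborel K)"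
        by (rule measure_Union_intervals[OF D(1) _ dj]) (use D(2) in blast)
      have Dm: "\<Union>D \<in> lmeasurable"
        by (rule lmeasurable_Union_intervals[OF D(1)]) (use D(2) in blast)
      have "\<Union>D \<subseteq> ball z (\<delta>/3)" using D(2) unfolding Q_def by blast
      then have "measure lebesgue (\<Union>D) \<le> measure lebesgue (ball z (\<delta>/3))"
        using Dm by (intro measure_mono_fmeasurable) auto
      also have "\<dots> < \<delta>" using \<open>\<delta> > 0\<close> by (simp add: ball_eq_greaterThanLessThan)
      finally have sum1: "(\<Sum>K\<in>D. \<bar>g (Sup K) - g (Inf K)\<bar>) < 1"
        unfolding mD
      proof (intro small_variation_intervals[OF \<delta>] nonoverlappingI D(1) dj)
        show "\<exists>u v. K = {u..v} \<and> a \<le> u \<and> u \<le> v \<and> v \<le> b" if K: "K \<in> D" for K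
        proof -
          obtain u v where "u < v" "K = {u..v}" "Q u v" using D(2)[OF K] by blast
          then show ?thesis by - (rule exI[of _ u], rule exI[of _ v], (simp add: Q_def))
        qed
      qed
      have "real N * (\<Sum>K\<in>D. measure lborel K) = (\<Sum>K\<in>D. real N * measure lborel K)"
        by (simp add: sum_distrib_left)
      also have "\<dots> \<le> (\<Sum>K\<in>D. \<bar>g (Sup K) - g (Inf K)\<bar>)"
      proof (rule sum_mono)
        fix K assume "K \<in> D"
        then obtain u v where "u < v" "K = {u..v}" "Q u v" using D(2) by meson
        then show "real N * measure lborel K \<le> \<bar>g (Sup K) - g (Inf K)\<bar>" by (simp add: Q_def)
      qed
      finally have "measure lebesgue (\<Union>D) \<le> 1 / real N"
        using sum1 N unfolding mD by (simp add: field_simps)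
      then show ?thesis using D(4) measure_le_Diff_plus[OF Bm Dm] by simp
    qed
    have "measure lebesgue B \<le> 0"
    proof (rule field_le_epsilon)
      fix e :: real assume "e > 0"
      then obtain N where "2 / e < real N" using reals_Archimedean2 by blast
      moreover from this \<open>e > 0\<close> have "N > 0" by (metis divide_pos_pos gr0I less_asym of_nat_0 zero_less_numeral)
      ultimately have "2 / real N \<le> e" using \<open>e > 0\<close> by (simp add: field_simps)
      then show "measure lebesgue B \<le> 0 + e" using main[OF \<open>N > 0\<close>] by simp
    qed
    then show ?thesis using Bm by (simp add: negligible_iff_measure B_def[symmetric] measure_le_0_iff)
  qed
  show ?thesis
  proof (rule iffD2[OF locally_negligible_alt], rule ballI)
    fix x assume "x \<in> ?E"
    then show "\<exists>U. openin (top_of_set ?E) U \<and> x \<in> U \<and> negligible U"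
      using loc[of x] \<open>\<delta> > 0\<close> by (intro exI[of _ "?E \<inter> ball x (\<delta>/3)"]) (auto simp: openin_open_Int)
  qed
qed

text \<open>Two nested Vitali covers of the exceptional set, by intervals of slope below \<open>r\<close> and, inside them, of
  slope above \<open>s\<close>: the increments over both covers differ only by those over the gaps, which have small total length.\<close>

lemma abs_cont_on_derivate_gap_null:
  fixes g :: "real \<Rightarrow> real"
  assumes ac: "abs_cont_on a b g" and rs: "r < s"
  shows "negligible (Vitali_pts (\<lambda>u v. a < u \<and> v < b \<and> g v - g u < r * (v - u)) \<inter>
                     Vitali_pts (\<lambda>u v. a < u \<and> v < b \<and> g v - g u > s * (v - u)))"
    (is "negligible ?E")
proof -
  define E where "E = ?E"
  have Eab: "E \<subseteq> {a..b}"
  proof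
    fix x assume "x \<in> E"
    then have "\<exists>u v. u < x \<and> x < v \<and> v - u < 1 \<and> (a < u \<and> v < b \<and> g v - g u < r * (v - u))"
      unfolding E_def Vitali_pts_def using less_numeral_extra(1) by blast
    then show "x \<in> {a..b}" by auto
  qed
  have "E \<in> sets borel" unfolding E_def by (intro sets.Int borel_Vitali_pts)
  then have El: "E \<in> sets lebesgue" by (intro sets_completionI_sets) auto
  then have Em: "E \<in> lmeasurable"
    using Eab fmeasurable_Int_fmeasurable[of "{a..b}" lebesgue E] by (simp add: Int_absorb1)
  \<comment> \<open>Let X and Y be the total lengths of the outer and inner covers. Their increments
    are at most r X and at least s Y, and the gaps contribute less than e, so (s - r) X <= e + s (X
    - Y) <= (1 + |s|) e. The final 1 pays for the part of \<open>E\<close> missed by the outer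
    cover.\<close>
  define C where "C = (1 + \<bar>s\<bar>) / (s - r) + 1"
  have "C > 0" using rs by (simp add: C_def add_pos_pos)
  have main: "measure lebesgue E \<le> C * e" if e: "e > 0" for e
  proof -
    obtain \<delta>' where "\<delta>' > 0" and \<delta>': "small_variation a b g \<delta>' e"
      using abs_cont_onE[OF ac e] .
    define \<delta> where "\<delta> = min \<delta>' e"
    have \<delta>: "\<delta> > 0" "\<delta> \<le> e" "\<delta> \<le> \<delta>'" using \<open>\<delta>' > 0\<close> e by (auto simp: \<delta>_def)
    obtain U where U: "open U" "E \<subseteq> U" "U - E \<in> lmeasurable" "emeasure lebesgue (U - E) < ennreal (\<delta>/3)"
      using sets_lebesgue_outer_open[OF El, of "\<delta>/3"] \<delta>(1) by auto
    have mUE: "measure lebesgue (U - E) < \<delta>/3"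
      using U(3,4) \<delta>(1) by (simp add: emeasure_eq_measure2 ennreal_less_iff)
    define Q1 where "Q1 u v \<longleftrightarrow> (a < u \<and> v < b \<and> g v - g u < r * (v - u)) \<and> {u..v} \<subseteq> U" for u v
    have "x \<in> Vitali_pts Q1" if "x \<in> E" for x
      unfolding Q1_def using that U by (intro Vitali_pts_restrict_open) (auto simp: E_def)
    then have "E \<subseteq> Vitali_pts Q1" ..
    then obtain D1 where D1: "finite D1" "\<And>K. K \<in> D1 \<Longrightarrow> \<exists>u v. u < v \<and> K = {u..v} \<and> Q1 u v"
      "\<And>K L. K \<in> D1 \<Longrightarrow> L \<in> D1 \<Longrightarrow> K \<noteq> L \<Longrightarrow> K \<inter> L = {}"
      "measure lebesgue (E - \<Union>D1) < \<delta>/3"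
      by (rule Vitali_finite_cover[OF Em _, of Q1 "\<delta>/3"]) (use \<delta>(1) in auto)
    \<comment> \<open>Inner intervals must fit inside an outer one, which needs room on both sides
      of the point; the excluded end points form a finite set.\<close>
    define E2 where "E2 = E \<inter> (\<Union>K\<in>D1. interior K)"
    have E2m: "E2 \<in> lmeasurable"
    proof -
      have "open (\<Union>K\<in>D1. interior K)" by auto
      then have "(\<Union>K\<in>D1. interior K) \<in> sets lebesgue"
        by (intro sets_completionI_sets) auto
      then show ?thesis unfolding E2_def by (intro fmeasurable_Int_fmeasurable Em)
    qed
    define Q2 where "Q2 u v \<longleftrightarrow> (a < u \<and> v < b \<and> g v - g u > s * (v - u)) \<and> (\<exists>K\<in>D1. {u..v} \<subseteq> K)" for u v
    have "x \<in> Vitali_pts Q2" if x: "x \<in> E2" for x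
    proof -
      obtain K where K: "K \<in> D1" "x \<in> interior K" using x by (auto simp: E2_def)
      have "x \<in> Vitali_pts (\<lambda>u v. (a < u \<and> v < b \<and> g v - g u > s * (v - u)) \<and> {u..v} \<subseteq> interior K)"
        using x K by (intro Vitali_pts_restrict_open) (auto simp: E_def E2_def)
      then show ?thesis by (rule Vitali_pts_mono) (use K(1) interior_subset in \<open>unfold Q2_def, blast\<close>)
    qed
    then have "E2 \<subseteq> Vitali_pts Q2" ..
    then obtain D2 where D2: "finite D2" "\<And>K. K \<in> D2 \<Longrightarrow> \<exists>u v. u < v \<and> K = {u..v} \<and> Q2 u v"
      "\<And>K L. K \<in> D2 \<Longrightarrow> L \<in> D2 \<Longrightarrow> K \<noteq> L \<Longrightarrow> K \<inter> L = {}"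
      "measure lebesgue (E2 - \<Union>D2) < \<delta>/3"
      by (rule Vitali_finite_cover[OF E2m _, of Q2 "\<delta>/3"]) (use \<delta>(1) in auto)
    have dj1: "interior K \<inter> interior L = {}" if "K \<in> D1" "L \<in> D1" "K \<noteq> L" for K L
      using D1(3)[OF that] interior_subset by blast
    have dj2: "interior K \<inter> interior L = {}" if "K \<in> D2" "L \<in> D2" "K \<noteq> L" for K L
      using D2(3)[OF that] interior_subset by blast
    define X where "X = (\<Sum>K\<in>D1. measure lborel K)"
    define Y where "Y = (\<Sum>K\<in>D2. measure lborel K)"
    have mX: "measure lebesgue (\<Union>D1) = X" unfolding X_def
      by (rule measure_Union_intervals[OF D1(1) _ dj1]) (use D1(2) in blast)
    have mY: "measure lebesgue (\<Union>D2) = Y" unfolding Y_def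
      by (rule measure_Union_intervals[OF D2(1) _ dj2]) (use D2(2) in blast)
    have D1m: "\<Union>D1 \<in> lmeasurable"
      by (rule lmeasurable_Union_intervals[OF D1(1)]) (use D1(2) in blast)
    have D2m: "\<Union>D2 \<in> lmeasurable"
      by (rule lmeasurable_Union_intervals[OF D2(1)]) (use D2(2) in blast)
    have XY: "X - Y < \<delta>"
    proof -
      define V where "V = U - E"
      have V: "V \<in> lmeasurable" "measure lebesgue V < \<delta>/3" using U(3) mUE by (simp_all add: V_def)
      define N where "N = Inf ` D1 \<union> Sup ` D1"
      have N: "negligible N" using D1(1) by (auto simp: N_def intro: negligible_finite)
      have Nm: "N \<in> lmeasurable" "measure lebesgue N = 0"
        using N by (simp_all add: negligible_imp_measurable negligible_imp_measure0)
      \<comment> \<open>A point of an outer interval is an end point, or lies in \<open>U\<close>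
        outside \<open>E\<close>, or belongs to \<open>E2\<close>. If no inner interval contains it,
        each of these cases confines it to a set of measure below delta/3.\<close>
      have sub: "\<Union>D1 - \<Union>D2 \<subseteq> (V \<union> (E2 - \<Union>D2)) \<union> N" (is "_ \<subseteq> ?R")
      proof
        fix x assume x: "x \<in> \<Union>D1 - \<Union>D2"
        then obtain K where K: "K \<in> D1" "x \<in> K" by auto
        then obtain u v where uv: "u < v" "K = {u..v}" "Q1 u v" using D1(2) by blast
        then have "x \<in> U" using K by (auto simp: Q1_def)
        moreover have "x \<in> N \<or> x \<in> interior K"
        proof -
          have "u \<in> N" "v \<in> N" using uv K(1) by (force simp: N_def)+
          then show ?thesis using K(2) uv by (auto simp: interior_atLeastAtMost_real less_le)
        qed
        ultimately show "x \<in> ?R" using x K(1) by (auto simp: E2_def V_def)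
      qed
      have "measure lebesgue (\<Union>D1 - \<Union>D2) \<le> measure lebesgue ?R"
        using D1m D2m V(1) E2m Nm
        by (intro measure_mono_fmeasurable[OF sub] fmeasurable.Un fmeasurable_Diff) auto
      also have "\<dots> \<le> measure lebesgue (V \<union> (E2 - \<Union>D2)) + measure lebesgue N"
        using D2m V(1) E2m Nm(1)
        by (intro measure_Un_le fmeasurableD fmeasurable.Un fmeasurable_Diff) auto
      also have "\<dots> \<le> measure lebesgue V + measure lebesgue (E2 - \<Union>D2)"
        unfolding Nm(2) add_0_right using D2m V(1) E2m
        by (intro measure_Un_le fmeasurableD fmeasurable_Diff) auto
      finally show ?thesis
        using measure_le_Diff_plus[OF D1m D2m] V(2) D2(4) \<delta>(1) unfolding mX mY by linarith
    qed
    \<comment> \<open>The inner intervals \<open>P K\<close> inside \<open>K\<close> extend to a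
      division \<open>q K\<close> of \<open>K\<close>; the added pieces \<open>G K\<close> are the
      gaps, to which absolute continuity is applied.\<close>
    define P where "P K = {L \<in> D2. L \<subseteq> K}" for K
    have Pfin: "finite (P K)" for K using D2(1) by (simp add: P_def)
    have "\<exists>q. P K \<subseteq> q \<and> q division_of K" if K: "K \<in> D1" for K
    proof -
      obtain u v where uv: "K = {u..v}" using D1(2)[OF K] by blast
      have 1: "P K division_of \<Union>(P K)"
      proof (rule division_ofI[OF Pfin])
        show "L \<noteq> {}" if "L \<in> P K" for L using that D2(2)[of L] by (auto simp: P_def)
        show "\<exists>a b. L = cbox a b" if "L \<in> P K" for L using that D2(2)[of L] by (auto simp: P_def)
        show "interior L \<inter> interior M = {}" if "L \<in> P K" "M \<in> P K" "L \<noteq> M" for L M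
          using that dj2 by (auto simp: P_def)
      qed auto
      have 2: "\<Union>(P K) \<subseteq> cbox u v" by (auto simp: P_def uv)
      show ?thesis using partial_division_extend_interval[OF 1 2] unfolding uv by (metis box_real(2))
    qed
    then obtain q where q: "\<And>K. K \<in> D1 \<Longrightarrow> P K \<subseteq> q K" "\<And>K. K \<in> D1 \<Longrightarrow> q K division_of K" by metis
    define G where "G K = q K - P K" for K
    have Gfin: "finite (G K)" if "K \<in> D1" for K using q(2)[OF that] by (auto simp: G_def)
    have Gint: "\<exists>u v. L = {u..v} \<and> u \<le> v \<and> L \<subseteq> K" if "K \<in> D1" "L \<in> G K" for K L
      using division_ofD(2,3,4)[OF q(2)[OF that(1)], of L] that(2) by (force simp: G_def)
    have D2P: "D2 = (\<Union>K\<in>D1. P K)"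
      using D2(2) unfolding P_def Q2_def by blast
    have disj: "X \<inter> Y = {}" if "K \<in> D1" "M \<in> D1" "K \<noteq> M"
      "\<And>L. L \<in> X \<Longrightarrow> L \<noteq> {} \<and> L \<subseteq> K" "\<And>L. L \<in> Y \<Longrightarrow> L \<noteq> {} \<and> L \<subseteq> M" for K M X Y
      using D1(3)[OF that(1-3)] that(4,5) by blast
    \<comment> \<open>Used for increments of \<open>g\<close> and again for lengths, both of which
      are additive over divisions.\<close>
    have split: "(\<Sum>K\<in>D1. F K) = (\<Sum>L\<in>D2. F L) + (\<Sum>L\<in>(\<Union>K\<in>D1. G K). F L)"
      if F: "\<And>K p. K \<in> D1 \<Longrightarrow> p division_of K \<Longrightarrow> F K = (\<Sum>L\<in>p. F L)" for F :: "real set \<Rightarrow> real"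
    proof -
      have "(\<Sum>K\<in>D1. F K) = (\<Sum>K\<in>D1. (\<Sum>L\<in>P K. F L) + (\<Sum>L\<in>G K. F L))"
      proof (rule sum.cong[OF refl])
        fix K assume K: "K \<in> D1"
        have "F K = (\<Sum>L\<in>q K. F L)" by (rule F[OF K q(2)[OF K]])
        also have "\<dots> = (\<Sum>L\<in>P K. F L) + (\<Sum>L\<in>G K. F L)"
          unfolding G_def using q[OF K] by (subst sum.subset_diff[of "P K"]) auto
        finally show "F K = (\<Sum>L\<in>P K. F L) + (\<Sum>L\<in>G K. F L)" .
      qed
      also have "\<dots> = (\<Sum>K\<in>D1. \<Sum>L\<in>P K. F L) + (\<Sum>K\<in>D1. \<Sum>L\<in>G K. F L)" by (rule sum.distrib)
      also have "(\<Sum>K\<in>D1. \<Sum>L\<in>P K. F L) = (\<Sum>L\<in>D2. F L)"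
        unfolding D2P
      proof (rule sum.UNION_disjoint[symmetric, OF D1(1)], use Pfin in blast, intro ballI impI)
        fix K M assume KM: "K \<in> D1" "M \<in> D1" "K \<noteq> M"
        show "P K \<inter> P M = {}" by (rule disj[OF KM]) (use D2(2) in \<open>force simp: P_def\<close>)+
      qed
      also have "(\<Sum>K\<in>D1. \<Sum>L\<in>G K. F L) = (\<Sum>L\<in>(\<Union>K\<in>D1. G K). F L)"
      proof (rule sum.UNION_disjoint[symmetric, OF D1(1)], use Gfin in blast, intro ballI impI)
        fix K M assume KM: "K \<in> D1" "M \<in> D1" "K \<noteq> M"
        show "G K \<inter> G M = {}"
          by (rule disj[OF KM]) (use Gint[OF KM(1)] Gint[OF KM(2)] in fastforce)+
      qed
      finally show ?thesis .
    qed
    define R where "R = (\<Union>K\<in>D1. G K)"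
    define \<Delta> where "\<Delta> K = g (Sup K) - g (Inf K)" for K
    have sg: "(\<Sum>K\<in>D1. \<Delta> K) = (\<Sum>L\<in>D2. \<Delta> L) + (\<Sum>L\<in>R. \<Delta> L)"
      unfolding R_def
    proof (rule split)
      fix K p assume K: "K \<in> D1" "p division_of K"
      obtain u v where uv: "u < v" "K = {u..v}" using D1(2)[OF K(1)] by blast
      have "(\<Sum>L\<in>p. \<Delta> L) = g v - g u"
        unfolding \<Delta>_def by (rule sum_increments_division) (use uv K in auto)
      then show "\<Delta> K = (\<Sum>L\<in>p. \<Delta> L)" using uv by (simp add: \<Delta>_def)
    qed
    have sc: "X = Y + (\<Sum>L\<in>R. measure lborel L)"
      unfolding R_def X_def Y_def
    proof (rule split)
      fix K p assume K: "K \<in> D1" "p division_of K"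
      obtain u v where uv: "u < v" "K = {u..v}" using D1(2)[OF K(1)] by blast
      show "measure lborel K = (\<Sum>L\<in>p. measure lborel L)"
        using additive_content_division[of p u v] K(2) uv by (simp only: box_real)
    qed
    have "(\<Sum>L\<in>R. \<bar>g (Sup L) - g (Inf L)\<bar>) < e"
    proof (rule small_variation_intervals[OF \<delta>' nonoverlappingI])
      show "finite R" unfolding R_def using D1(1) Gfin by auto
      show "\<exists>u v. L = {u..v} \<and> a \<le> u \<and> u \<le> v \<and> v \<le> b" if L: "L \<in> R" for L
      proof -
        obtain K where K: "K \<in> D1" "L \<in> G K" using L by (auto simp: R_def)
        obtain u v where uv: "L = {u..v}" "u \<le> v" "L \<subseteq> K" using Gint[OF K] by blast
        obtain u' v' where uv': "K = {u'..v'}" "Q1 u' v'" using D1(2)[OF K(1)] by blast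
        show ?thesis using uv uv' unfolding Q1_def by - (rule exI[of _ u], rule exI[of _ v], auto)
      qed
      show "interior L \<inter> interior M = {}" if LM: "L \<in> R" "M \<in> R" "L \<noteq> M" for L M
      proof -
        obtain K where K: "K \<in> D1" "L \<in> G K" using LM by (auto simp: R_def)
        obtain K' where K': "K' \<in> D1" "M \<in> G K'" using LM by (auto simp: R_def)
        show ?thesis
        proof (cases "K = K'")
          case True
          then show ?thesis using division_ofD(5)[OF q(2)[OF K(1)]] K K' LM(3) by (auto simp: G_def)
        next
          case False
          then have "K \<inter> K' = {}" using D1(3) K K' by blast
          moreover have "L \<subseteq> K" "M \<subseteq> K'" using Gint[OF K] Gint[OF K'] by auto
          ultimately show ?thesis using interior_subset by blast
        qed
      qed
      show "(\<Sum>L\<in>R. measure lborel L) < \<delta>'" using sc XY \<delta>(3) by linarith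
    qed
    moreover have "\<bar>\<Sum>L\<in>R. \<Delta> L\<bar> \<le> (\<Sum>L\<in>R. \<bar>g (Sup L) - g (Inf L)\<bar>)"
      unfolding \<Delta>_def by (rule sum_abs)
    ultimately have gap: "\<bar>\<Sum>L\<in>R. \<Delta> L\<bar> < e" by linarith
    have "(\<Sum>K\<in>D1. \<Delta> K) \<le> (\<Sum>K\<in>D1. r * measure lborel K)"
    proof (rule sum_mono)
      fix K assume "K \<in> D1"
      from D1(2)[OF this] show "\<Delta> K \<le> r * measure lborel K" by (auto simp: \<Delta>_def Q1_def)
    qed
    then have up: "(\<Sum>K\<in>D1. \<Delta> K) \<le> r * X" by (simp add: X_def sum_distrib_left)
    have "(\<Sum>K\<in>D2. \<Delta> K) \<ge> (\<Sum>K\<in>D2. s * measure lborel K)"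
    proof (rule sum_mono)
      fix K assume "K \<in> D2"
      from D2(2)[OF this] show "\<Delta> K \<ge> s * measure lborel K" by (auto simp: \<Delta>_def Q2_def)
    qed
    then have lo: "(\<Sum>K\<in>D2. \<Delta> K) \<ge> s * Y" by (simp add: Y_def sum_distrib_left)
    have "X - Y \<ge> 0" unfolding sc by (simp add: sum_nonneg)
    have "s * (X - Y) \<le> \<bar>s\<bar> * (X - Y)" using \<open>X - Y \<ge> 0\<close> by (intro mult_right_mono) auto
    also have "\<dots> \<le> \<bar>s\<bar> * e" using XY \<delta>(2) by (intro mult_left_mono) auto
    finally have "s * X - s * Y \<le> \<bar>s\<bar> * e" by (simp add: algebra_simps)
    then have "(s - r) * X \<le> (1 + \<bar>s\<bar>) * e"
      using up lo gap sg by (simp add: algebra_simps)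
    then have "X \<le> (1 + \<bar>s\<bar>) / (s - r) * e" using rs by (simp add: field_simps)
    then show ?thesis using measure_le_Diff_plus[OF Em D1m] D1(4) mX \<delta> e by (simp add: C_def algebra_simps)
  qed
  have "measure lebesgue E \<le> 0"
  proof (rule field_le_epsilon)
    fix e :: real assume "e > 0"
    then show "measure lebesgue E \<le> 0 + e" using main[of "e / C"] \<open>C > 0\<close> by simp
  qed
  then show ?thesis using Em by (simp add: negligible_iff_measure E_def[symmetric] measure_le_0_iff)
qed

section \<open>Almost everywhere differentiability of absolutely continuous functions\<close>

lemma abs_cont_on_imp_continuous_on:
  assumes "abs_cont_on a b g"
  shows "continuous_on {a..b} g"
  unfolding continuous_on_iff
proof (intro ballI allI impI)
  fix x e :: real assume x: "x \<in> {a..b}" and e: "e > 0"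
  obtain \<delta> where "\<delta> > 0" and \<delta>: "small_variation a b g \<delta> e"
    using abs_cont_onE[OF assms e] .
  show "\<exists>d>0. \<forall>y\<in>{a..b}. dist y x < d \<longrightarrow> dist (g y) (g x) < e"
  proof (intro exI[of _ \<delta>] conjI ballI impI \<open>\<delta> > 0\<close>)
    fix y assume "y \<in> {a..b}" "dist y x < \<delta>"
    then show "dist (g y) (g x) < e"
      using x \<delta>[unfolded small_variation_def, rule_format, of 1 "\<lambda>_. min x y" "\<lambda>_. max x y"]
      by (cases "x \<le> y") (auto simp: dist_real_def abs_minus_commute)
  qed
qed

text \<open>Outside the null sets the slopes of short intervals straddling x are bounded and no
  rationals r < s separate their lower and upper limits, so they converge. Continuity at x then lets
  one end point move to x, which turns straddling slopes into difference quotients.\<close>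

lemma abs_cont_on_differentiable_ae:
  fixes g :: "real \<Rightarrow> real"
  assumes ac: "abs_cont_on a b g"
  shows "negligible {x \<in> {a<..<b}. \<not> (\<exists>l. (g has_real_derivative l) (at x))}"
proof -
  define Lo where "Lo r = Vitali_pts (\<lambda>u v. a < u \<and> v < b \<and> g v - g u < r * (v - u))" for r
  define Hi where "Hi s = Vitali_pts (\<lambda>u v. a < u \<and> v < b \<and> g v - g u > s * (v - u))" for s
  define I where "I = (\<Inter>N::nat. Vitali_pts (\<lambda>u v. a < u \<and> v < b \<and> \<bar>g v - g u\<bar> > real N * (v - u)))"
  define Bad where "Bad = I \<union> (\<Union>(r,s)\<in>{(r,s). r \<in> \<rat> \<and> s \<in> \<rat> \<and> r < s}. Lo r \<inter> Hi s)"
  have "countable {(r,s::real). r \<in> \<rat> \<and> s \<in> \<rat> \<and> r < s}"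
    by (rule countable_subset[of _ "\<rat> \<times> \<rat>"]) (auto simp: countable_rat)
  then have "negligible (\<Union>(r,s)\<in>{(r,s). r \<in> \<rat> \<and> s \<in> \<rat> \<and> r < s}. Lo r \<inter> Hi s)"
    using abs_cont_on_derivate_gap_null[OF ac]
    by (intro negligible_countable_Union countable_image) (auto simp: Lo_def Hi_def)
  then have "negligible Bad"
    unfolding Bad_def I_def by (intro negligible_Un abs_cont_on_infinite_derivate_null[OF ac])
  moreover have "{x \<in> {a<..<b}. \<not> (\<exists>l. (g has_real_derivative l) (at x))} \<subseteq> Bad"
  proof (rule ccontr)
    assume "\<not> ?thesis"
    then obtain x where x: "a < x" "x < b" "\<not> (\<exists>l. (g has_real_derivative l) (at x))" "x \<notin> Bad" by auto
    define nb where "nb d u v \<longleftrightarrow> u < x \<and> x < v \<and> v - u < d \<and> a < u \<and> v < b" for d u v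
    have notLo: "\<exists>d>0. \<forall>u v. nb d u v \<longrightarrow> r * (v - u) \<le> g v - g u" if nl: "x \<notin> Lo r" for r
    proof -
      obtain d where "d > 0" "\<nexists>u v. u < x \<and> x < v \<and> v - u < d \<and> a < u \<and> v < b \<and> g v - g u < r * (v - u)"
        using nl unfolding Lo_def Vitali_pts_def by auto
      then show ?thesis unfolding nb_def by (intro exI[of _ d]) (meson not_less)
    qed
    have notHi: "\<exists>d>0. \<forall>u v. nb d u v \<longrightarrow> g v - g u \<le> s * (v - u)" if nl: "x \<notin> Hi s" for s
    proof -
      obtain d where "d > 0" "\<nexists>u v. u < x \<and> x < v \<and> v - u < d \<and> a < u \<and> v < b \<and> g v - g u > s * (v - u)"
        using nl unfolding Hi_def Vitali_pts_def by auto
      then show ?thesis unfolding nb_def by (intro exI[of _ d]) (meson not_less)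
    qed
    have "x \<notin> I" using x(4) by (simp add: Bad_def)
    then obtain N where "x \<notin> Vitali_pts (\<lambda>u v. a < u \<and> v < b \<and> \<bar>g v - g u\<bar> > real N * (v - u))"
      unfolding I_def by blast
    then obtain d0 where d00: "d0 > 0"
      "\<nexists>u v. u < x \<and> x < v \<and> v - u < d0 \<and> a < u \<and> v < b \<and> \<bar>g v - g u\<bar> > real N * (v - u)"
      unfolding Vitali_pts_def by auto
    then have d0: "d0 > 0" "\<And>u v. nb d0 u v \<Longrightarrow> \<bar>g v - g u\<bar> \<le> real N * (v - u)"
      unfolding nb_def by (simp, meson not_less)
    \<comment> \<open>The rationals that bound the slopes of all sufficiently short straddling
      intervals from below; their supremum will be the derivative.\<close>
    define R where "R = {r \<in> \<rat>. \<exists>d>0. \<forall>u v. nb d u v \<longrightarrow> r * (v - u) \<le> g v - g u}"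
    have ex: "\<exists>u v. nb d u v" if "d > 0" for d
      unfolding nb_def using x(1,2) that
      by - (rule exI[of _ "x - min (d/3) ((x-a)/2)"], rule exI[of _ "x + min (d/3) ((b-x)/2)"], (auto simp: min_def field_simps))
    have ub: "r \<le> real N" if r: "r \<in> R" for r
    proof -
      obtain d where d: "d > 0" "\<And>u v. nb d u v \<Longrightarrow> r * (v - u) \<le> g v - g u" using r unfolding R_def by blast
      obtain u v where uv: "nb (min d d0) u v" using ex[of "min d d0"] d(1) d0(1) by auto
      have "r * (v - u) \<le> g v - g u" "\<bar>g v - g u\<bar> \<le> real N * (v - u)"
        using uv by (auto intro!: d(2) d0(2) simp: nb_def)
      then have "r * (v - u) \<le> real N * (v - u)" by linarith
      then show ?thesis using uv by (simp add: nb_def)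
    qed
    have bdd: "bdd_above R" using ub by (auto simp: bdd_above_def)
    have "- real N \<in> R"
    proof -
      have "- real N * (v - u) \<le> g v - g u" if "nb d0 u v" for u v using d0(2)[OF that] by linarith
      then show ?thesis unfolding R_def using d0(1) by auto
    qed
    define l where "l = Sup R"
    have est: "\<exists>d>0. \<forall>u v. nb d u v \<longrightarrow> \<bar>g v - g u - l * (v - u)\<bar> \<le> \<epsilon> * (v - u)" if \<epsilon>: "\<epsilon> > 0" for \<epsilon>
    proof -
      obtain r0 where r0: "r0 \<in> R" "l - \<epsilon> < r0"
        using less_cSup_iff[of R "l - \<epsilon>"] \<open>- real N \<in> R\<close> bdd \<epsilon> by (auto simp: l_def)
      then obtain d1 where d1: "d1 > 0" "\<And>u v. nb d1 u v \<Longrightarrow> r0 * (v - u) \<le> g v - g u" unfolding R_def by blast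
      obtain r where r: "r \<in> \<rat>" "l < r" "r < l + \<epsilon>/2" using Rats_dense_in_real[of l "l + \<epsilon>/2"] \<epsilon> by auto
      obtain s where s: "s \<in> \<rat>" "r < s" "s < l + \<epsilon>" using Rats_dense_in_real[of r "l + \<epsilon>"] \<epsilon> r by auto
      \<comment> \<open>Since \<open>r\<close> is no such lower bound, x lies in
        \<open>Lo r\<close>; as x avoids \<open>Bad\<close>, it is then outside \<open>Hi s\<close>,
        and \<open>s\<close> becomes an upper bound for the slopes.\<close>
      have "r \<notin> R" using cSup_upper[OF _ bdd, of r] r(2) by (auto simp: l_def)
      then have "x \<in> Lo r" using notLo[of r] r(1) unfolding R_def by blast
      then have "x \<notin> Hi s" using x(4) r(1) s(1,2) by (auto simp: Bad_def)
      from notHi[OF this] obtain d2 where d2: "d2 > 0" "\<And>u v. nb d2 u v \<Longrightarrow> g v - g u \<le> s * (v - u)" by blast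
      show ?thesis
      proof (intro exI[of _ "min d1 d2"] conjI allI impI)
        fix u v assume "nb (min d1 d2) u v"
        then have n: "nb d1 u v" "nb d2 u v" "v - u > 0" by (auto simp: nb_def)
        have "(l - \<epsilon>) * (v - u) \<le> r0 * (v - u)" using r0(2) n(3) by (intro mult_right_mono) auto
        moreover have "s * (v - u) \<le> (l + \<epsilon>) * (v - u)" using s(3) n(3) by (intro mult_right_mono) auto
        ultimately show "\<bar>g v - g u - l * (v - u)\<bar> \<le> \<epsilon> * (v - u)"
          using d1(2)[OF n(1)] d2(2)[OF n(2)] by (simp add: abs_le_iff algebra_simps)
      qed (use d1 d2 in auto)
    qed
    have cont: "isCont g x"
      using abs_cont_on_imp_continuous_on[OF ac] x(1,2)
      by (simp add: continuous_on_interior interior_atLeastAtMost_real)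
    have "(g has_real_derivative l) (at x)"
      unfolding has_field_derivative_def has_derivative_at_alt
    proof (intro conjI allI impI bounded_linear_mult_right)
      fix \<epsilon> :: real assume "\<epsilon> > 0"
      from est[OF this] obtain d where d: "d > 0"
        "\<And>u v. nb d u v \<Longrightarrow> \<bar>g v - g u - l * (v - u)\<bar> \<le> \<epsilon> * (v - u)" by blast
      define d' where "d' = min d (min (x - a) (b - x))"
      show "\<exists>d>0. \<forall>y. norm (y - x) < d \<longrightarrow> norm (g y - g x - l * (y - x)) \<le> \<epsilon> * norm (y - x)"
      proof (intro exI[of _ d'] conjI allI impI)
        show "d' > 0" using d(1) x by (simp add: d'_def)
        fix y assume y: "norm (y - x) < d'"
        show "norm (g y - g x - l * (y - x)) \<le> \<epsilon> * norm (y - x)"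
        proof (cases y x rule: linorder_cases)
          case equal then show ?thesis by simp
        next
          case greater
          \<comment> \<open>The estimate concerns intervals with x strictly inside, so it is applied
            to u < x < y and u tends to x.\<close>
          have ev: "eventually (\<lambda>u. \<bar>g y - g u - l * (y - u)\<bar> \<le> \<epsilon> * (y - u)) (at_left x)"
            unfolding eventually_at_left_field
          proof (intro exI[of _ "max a (y - d)"] conjI allI impI)
            show "max a (y - d) < x" using x y by (auto simp: d'_def)
            fix u assume "max a (y - d) < u" "u < x"
            then show "\<bar>g y - g u - l * (y - u)\<bar> \<le> \<epsilon> * (y - u)"
              using greater y by (intro d(2)) (auto simp: nb_def d'_def)
          qed
          have "(g \<longlongrightarrow> g x) (at_left x)" using cont by (meson continuous_within filterlim_at_split isCont_def)
          then have "\<bar>g y - g x - l * (y - x)\<bar> \<le> \<epsilon> * (y - x)"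
            by (intro tendsto_le[OF _ _ _ ev]) (auto intro!: tendsto_intros)
          then show ?thesis using greater by simp
        next
          case less
          have ev: "eventually (\<lambda>v. \<bar>g v - g y - l * (v - y)\<bar> \<le> \<epsilon> * (v - y)) (at_right x)"
            unfolding eventually_at_right_field
          proof (intro exI[of _ "min b (y + d)"] conjI allI impI)
            show "x < min b (y + d)" using x y by (auto simp: d'_def)
            fix v assume "x < v" "v < min b (y + d)"
            then show "\<bar>g v - g y - l * (v - y)\<bar> \<le> \<epsilon> * (v - y)"
              using less y by (intro d(2)) (auto simp: nb_def d'_def)
          qed
          have "(g \<longlongrightarrow> g x) (at_right x)" using cont by (meson continuous_within filterlim_at_split isCont_def)
          then have "\<bar>g x - g y - l * (x - y)\<bar> \<le> \<epsilon> * (x - y)"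
            by (intro tendsto_le[OF _ _ _ ev]) (auto intro!: tendsto_intros)
          then show ?thesis using less by (simp add: abs_if algebra_simps split: if_splits)
        qed
      qed
    qed
    then show False using x(3) by blast
  qed
  ultimately show ?thesis by (rule negligible_subset)
qed

text \<open>The common source of the closure properties: increments of sums, products, inverses and
  Lipschitz functions are bounded by increments of functions already known to be absolutely
  continuous.\<close>

lemma abs_cont_on_dominated:
  assumes f: "abs_cont_on a b f" and g: "abs_cont_on a b g" and C: "C \<ge> 0"
    and h: "\<And>u v. a \<le> u \<Longrightarrow> u \<le> v \<Longrightarrow> v \<le> b \<Longrightarrow> \<bar>h v - h u\<bar> \<le> C * (\<bar>f v - f u\<bar> + \<bar>g v - g u\<bar>)"
  shows "abs_cont_on a b h"
  unfolding abs_cont_on_iff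
proof (intro allI impI)
  fix \<epsilon> :: real assume "\<epsilon> > 0"
  \<comment> \<open>Using C + 1 instead of C covers C = 0 and makes the final inequality
    strict.\<close>
  define \<eta> where "\<eta> = \<epsilon> / (2 * (C + 1))"
  have \<eta>: "\<eta> > 0" using \<open>\<epsilon> > 0\<close> C by (simp add: \<eta>_def)
  obtain d1 where d1: "d1 > 0" "small_variation a b f d1 \<eta>" using abs_cont_onE[OF f \<eta>] .
  obtain d2 where d2: "d2 > 0" "small_variation a b g d2 \<eta>" using abs_cont_onE[OF g \<eta>] .
  show "\<exists>\<delta>>0. small_variation a b h \<delta> \<epsilon>"
    unfolding small_variation_def
  proof (intro exI[of _ "min d1 d2"] conjI allI impI)
    fix m :: nat and u v :: "nat \<Rightarrow> real"
    assume *: "(\<forall>i<m. a \<le> u i \<and> u i \<le> v i \<and> v i \<le> b) \<and>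
      (\<forall>i<m. \<forall>j<m. i \<noteq> j \<longrightarrow> v i \<le> u j \<or> v j \<le> u i) \<and> (\<Sum>i<m. v i - u i) < min d1 d2"
    have "(\<Sum>i<m. \<bar>f (v i) - f (u i)\<bar>) < \<eta>" using d1(2)[unfolded small_variation_def, rule_format, of m u v] * by simp
    moreover have "(\<Sum>i<m. \<bar>g (v i) - g (u i)\<bar>) < \<eta>" using d2(2)[unfolded small_variation_def, rule_format, of m u v] * by simp
    moreover have "(\<Sum>i<m. \<bar>h (v i) - h (u i)\<bar>) \<le> (\<Sum>i<m. C * (\<bar>f (v i) - f (u i)\<bar> + \<bar>g (v i) - g (u i)\<bar>))"
      using * by (intro sum_mono h) auto
    moreover have "\<dots> = C * ((\<Sum>i<m. \<bar>f (v i) - f (u i)\<bar>) + (\<Sum>i<m. \<bar>g (v i) - g (u i)\<bar>))"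
      by (simp only: sum.distrib flip: sum_distrib_left)
    ultimately have "(\<Sum>i<m. \<bar>h (v i) - h (u i)\<bar>) \<le> C * (\<eta> + \<eta>)"
      using C by (smt (verit) mult_left_mono)
    also have "C * (\<eta> + \<eta>) < (C + 1) * (\<eta> + \<eta>)" using \<eta> by simp
    also have "(C + 1) * (\<eta> + \<eta>) = \<epsilon>"
    proof -
      have "2 * (C + 1) \<noteq> 0" using C by simp
      then have "\<eta> * (2 * (C + 1)) = \<epsilon>" unfolding \<eta>_def by simp
      then show ?thesis by (simp add: algebra_simps)
    qed
    finally show "(\<Sum>i<m. \<bar>h (v i) - h (u i)\<bar>) < \<epsilon>" .
  qed (use d1 d2 in auto)
qed

section \<open>Closure of absolute continuity under the operations that build Wronskians\<close>

lemma abs_cont_on_ident: "abs_cont_on a b (\<lambda>x. x)"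
  unfolding abs_cont_on_iff
proof (intro allI impI)
  fix \<epsilon> :: real assume "\<epsilon> > 0"
  have "(\<Sum>i<m. \<bar>v i - u i\<bar>) < \<epsilon>"
    if "\<forall>i<m. a \<le> u i \<and> u i \<le> v i \<and> v i \<le> b" "(\<Sum>i<m. v i - u i) < \<epsilon>" for m :: nat and u v :: "nat \<Rightarrow> real"
  proof -
    have "(\<Sum>i<m. \<bar>v i - u i\<bar>) = (\<Sum>i<m. v i - u i)" using that(1) by (intro sum.cong) auto
    then show ?thesis using that(2) by simp
  qed
  then show "\<exists>\<delta>>0. small_variation a b (\<lambda>x. x) \<delta> \<epsilon>"
    unfolding small_variation_def
    using \<open>\<epsilon> > 0\<close> by (intro exI[of _ \<epsilon>]) auto
qed

lemma abs_cont_on_lipschitz: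
  assumes "C \<ge> 0" "\<And>u v. a \<le> u \<Longrightarrow> u \<le> v \<Longrightarrow> v \<le> b \<Longrightarrow> \<bar>h v - h u\<bar> \<le> C * \<bar>v - u\<bar>"
  shows "abs_cont_on a b h"
proof (rule abs_cont_on_dominated[OF abs_cont_on_ident abs_cont_on_ident assms(1)])
  fix u v assume "a \<le> u" "u \<le> v" "v \<le> b"
  from assms(2)[OF this] assms(1) show "\<bar>h v - h u\<bar> \<le> C * (\<bar>v - u\<bar> + \<bar>v - u\<bar>)"
    by (smt (verit) mult_left_mono)
qed

lemma abs_cont_on_const [simp]: "abs_cont_on a b (\<lambda>_. c)"
  by (rule abs_cont_on_lipschitz[of 0]) auto

lemma abs_cont_on_add:
  assumes "abs_cont_on a b f" "abs_cont_on a b g"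
  shows "abs_cont_on a b (\<lambda>x. f x + g x)"
  by (rule abs_cont_on_dominated[OF assms, of 1]) auto

lemma continuous_on_Icc_bounded:
  fixes f :: "real \<Rightarrow> real"
  assumes "continuous_on {a..b} f"
  obtains B where "B \<ge> 0" "\<And>x. a \<le> x \<Longrightarrow> x \<le> b \<Longrightarrow> \<bar>f x\<bar> \<le> B"
proof -
  have "bounded (f ` {a..b})" by (intro compact_imp_bounded compact_continuous_image assms) auto
  then obtain B where "\<forall>y\<in>f ` {a..b}. norm y \<le> B" by (auto simp: bounded_iff)
  then show ?thesis by (intro that[of "\<bar>B\<bar>"]) (auto intro: order_trans[OF _ abs_ge_self])
qed

lemma abs_cont_on_mult:
  assumes "abs_cont_on a b f" "abs_cont_on a b g"
  shows "abs_cont_on a b (\<lambda>x. f x * g x)"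
proof -
  obtain B1 where B1: "B1 \<ge> 0" "\<And>x. a \<le> x \<Longrightarrow> x \<le> b \<Longrightarrow> \<bar>f x\<bar> \<le> B1" by (rule continuous_on_Icc_bounded[OF abs_cont_on_imp_continuous_on[OF assms(1)]]) blast
  obtain B2 where B2: "B2 \<ge> 0" "\<And>x. a \<le> x \<Longrightarrow> x \<le> b \<Longrightarrow> \<bar>g x\<bar> \<le> B2" by (rule continuous_on_Icc_bounded[OF abs_cont_on_imp_continuous_on[OF assms(2)]]) blast
  show ?thesis
  proof (rule abs_cont_on_dominated[OF assms, of "B1 + B2"])
    fix u v assume uv: "a \<le> u" "u \<le> v" "v \<le> b"
    have "\<bar>f v * g v - f u * g u\<bar> = \<bar>f v * (g v - g u) + g u * (f v - f u)\<bar>" by (simp add: algebra_simps)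
    also have "\<dots> \<le> \<bar>f v\<bar> * \<bar>g v - g u\<bar> + \<bar>g u\<bar> * \<bar>f v - f u\<bar>"
      by (rule order_trans[OF abs_triangle_ineq]) (simp add: abs_mult)
    also have "\<dots> \<le> (B1 + B2) * \<bar>g v - g u\<bar> + (B1 + B2) * \<bar>f v - f u\<bar>"
      using uv B1(1) B2(1) B2(2)[of u] B1(2)[of v] by (intro add_mono mult_right_mono) auto
    finally show "\<bar>f v * g v - f u * g u\<bar> \<le> (B1 + B2) * (\<bar>f v - f u\<bar> + \<bar>g v - g u\<bar>)"
      by (simp add: algebra_simps)
  qed (use B1 B2 in auto)
qed

lemma abs_cont_on_inverse:
  assumes f: "abs_cont_on a b f" and nz: "\<And>x. a \<le> x \<Longrightarrow> x \<le> b \<Longrightarrow> f x \<noteq> 0"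
  shows "abs_cont_on a b (\<lambda>x. inverse (f x))"
proof -
  have "continuous_on {a..b} (\<lambda>x. inverse (f x))"
    using nz by (intro continuous_on_inverse abs_cont_on_imp_continuous_on f) auto
  then obtain B where "B \<ge> 0" and B: "\<And>x. a \<le> x \<Longrightarrow> x \<le> b \<Longrightarrow> \<bar>inverse (f x)\<bar> \<le> B"
    by (rule continuous_on_Icc_bounded) blast
  show ?thesis
  proof (rule abs_cont_on_dominated[OF f f, of "B * B"])
    fix u v assume uv: "a \<le> u" "u \<le> v" "v \<le> b"
    have "inverse (f v) - inverse (f u) = - (inverse (f v) * inverse (f u) * (f v - f u))"
      using nz[of u] nz[of v] uv by (simp add: field_simps)
    then have "\<bar>inverse (f v) - inverse (f u)\<bar> = \<bar>inverse (f v)\<bar> * \<bar>inverse (f u)\<bar> * \<bar>f v - f u\<bar>"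
      by (simp add: abs_mult)
    also have "\<dots> \<le> B * B * (\<bar>f v - f u\<bar> + \<bar>f v - f u\<bar>)"
      using uv B[of u] B[of v] \<open>B \<ge> 0\<close> by (intro mult_mono) auto
    finally show "\<bar>inverse (f v) - inverse (f u)\<bar> \<le> B * B * (\<bar>f v - f u\<bar> + \<bar>f v - f u\<bar>)" .
  qed (use \<open>B \<ge> 0\<close> in auto)
qed

lemma abs_cont_on_sum:
  assumes "\<And>i. i \<in> I \<Longrightarrow> abs_cont_on a b (f i)"
  shows "abs_cont_on a b (\<lambda>x. \<Sum>i\<in>I. f i x)"
  using assms by (induction I rule: infinite_finite_induct) (auto intro!: abs_cont_on_add)

lemma abs_cont_on_prod:
  assumes "\<And>i. i \<in> I \<Longrightarrow> abs_cont_on a b (f i)"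
  shows "abs_cont_on a b (\<lambda>x. \<Prod>i\<in>I. f i x)"
  using assms by (induction I rule: infinite_finite_induct) (auto intro!: abs_cont_on_mult)

lemma abs_cont_on_cong:
  assumes "abs_cont_on a b f" "\<And>x. a \<le> x \<Longrightarrow> x \<le> b \<Longrightarrow> f x = g x"
  shows "abs_cont_on a b g"
  by (rule abs_cont_on_dominated[OF assms(1) assms(1), of 1]) (use assms(2) in auto)

section \<open>Determinants\<close>

lemma ndet_det: "ndet m A = Determinant.det (mat m m (\<lambda>(i,j). A i j))"
  unfolding ndet_def Determinant.det_def 
  by (auto simp: atLeast0LessThan permutes_in_image intro!: sum.cong prod.cong)

lemma ndet_cong:
  assumes "\<And>i j. i < m \<Longrightarrow> j < m \<Longrightarrow> A i j = B i j"
  shows "ndet m A = ndet m B"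
  unfolding ndet_det using assms by (intro arg_cong[where f=Determinant.det] eq_matI) auto

lemma ndet_0 [simp]: "ndet 0 A = 1"
  by (simp add: ndet_def)

lemma ndet_1: "ndet 1 A = A 0 0"
  by (simp add: ndet_def lessThan_Suc)

lemma ndet_2: "ndet 2 A = A 0 0 * A 1 1 - A 0 1 * A 1 0"
proof -
  define M where "M = mat 2 2 (\<lambda>(i,j). A i j)"
  have M: "M \<in> carrier_mat 2 2" by (simp add: M_def)
  have c0: "Determinant.det (mat_delete M 0 0) = A 1 1"
    by (subst det_single) (simp_all add: M_def mat_delete_def)
  have c1: "Determinant.det (mat_delete M 0 1) = A 1 0"
    by (subst det_single) (simp_all add: M_def mat_delete_def)
  have "Determinant.det M = (\<Sum>j<2. M $$ (0,j) * cofactor M 0 j)"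
    by (rule laplace_expansion_row[OF M]) simp
  also have "\<dots> = M $$ (0,0) * cofactor M 0 0 + M $$ (0,1) * cofactor M 0 1"
    by (simp add: numeral_2_eq_2)
  finally show ?thesis
    unfolding ndet_det M_def[symmetric] cofactor_def c0 c1 by (simp add: M_def)
qed

text \<open>The Schur complement with respect to the leading n by n block. Its entry
  \<open>s r c\<close> depends only on the attached row r and column c, so a single \<open>s\<close>
  serves all bordered determinants; \<open>\<rho>\<close> and \<open>\<kappa>\<close> choose which
  rows and columns are attached.\<close>

lemma ndet_schur:
  assumes nz: "ndet n A \<noteq> 0"
  obtains s :: "nat \<Rightarrow> nat \<Rightarrow> real" where
    "\<And>q \<rho> \<kappa>. (\<And>i. i < n \<Longrightarrow> \<rho> i = i) \<Longrightarrow> (\<And>i. i < n \<Longrightarrow> \<kappa> i = i) \<Longrightarrow>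
       ndet (n + q) (\<lambda>i j. A (\<rho> i) (\<kappa> j)) = ndet n A * ndet q (\<lambda>i j. s (\<rho> (n + i)) (\<kappa> (n + j)))"
proof -
  define M where "M = mat n n (\<lambda>(i,j). A i j)"
  have M: "M \<in> carrier_mat n n" by (simp add: M_def)
  have "Determinant.det M \<noteq> 0" using nz by (simp add: ndet_det M_def)
  from det_non_zero_imp_unit[OF M this, unfolded Units_def, of "()"]
  obtain X where X: "X \<in> carrier_mat n n" and MX: "M * X = 1\<^sub>m n"
    by (auto simp: ring_mat_def)
  define s where "s r c = A r c - (\<Sum>i<n. \<Sum>k<n. A r i * X $$ (i, k) * A k c)" for r c
  show ?thesis
  proof (rule that[of s])
    fix q \<rho> \<kappa>
    assume \<rho>: "\<And>i. i < n \<Longrightarrow> \<rho> i = i" and \<kappa>: "\<And>i. i < n \<Longrightarrow> \<kappa> i = (i::nat)"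
    define B where "B = mat n q (\<lambda>(i,j). A i (\<kappa> (n + j)))"
    define C where "C = mat q n (\<lambda>(i,j). A (\<rho> (n + i)) j)"
    define D where "D = mat q q (\<lambda>(i,j). A (\<rho> (n + i)) (\<kappa> (n + j)))"
    have BCD: "B \<in> carrier_mat n q" "C \<in> carrier_mat q n" "D \<in> carrier_mat q q"
      by (auto simp: B_def C_def D_def)
    have M4: "mat (n + q) (n + q) (\<lambda>(i,j). A (\<rho> i) (\<kappa> j)) = four_block_mat M B C D"
      by (intro eq_matI) (auto simp: M_def B_def C_def D_def \<rho> \<kappa>)
    \<comment> \<open>A unit triangular column operation of determinant 1 that clears the upper
      right block.\<close>
    define N where "N = four_block_mat (1\<^sub>m n) (- (X * B)) (0\<^sub>m q n) (1\<^sub>m q)"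
    have XB: "X * B \<in> carrier_mat n q" using X BCD by auto
    have detN: "Determinant.det N = 1" unfolding N_def
      by (subst det_four_block_mat_lower_left_zero[of _ n _ q]) (use XB in auto)
    have MXB: "M * (X * B) = B" using X BCD M MX by (simp flip: assoc_mult_mat[of M n n X n B q])
    have FN: "four_block_mat M B C D * N = four_block_mat M (0\<^sub>m n q) C (D - C * (X * B))"
      unfolding N_def
      apply (subst mult_four_block_mat[of _ n n _ q _ q _ _ n _ q])
      using M BCD XB MXB X apply auto
      done
    have CXB: "(C * (X * B)) $$ (i, j) = (\<Sum>l<n. A (\<rho> (n + i)) l * (\<Sum>k<n. X $$ (l, k) * A k (\<kappa> (n + j))))"
      if ij: "i < q" "j < q" for i j
    proof -
      have 1: "(X * B) $$ (l, j) = (\<Sum>k<n. X $$ (l, k) * A k (\<kappa> (n + j)))" if "l < n" for l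
      proof -
        have "(X * B) $$ (l, j) = row X l \<bullet> col B j"
          by (rule index_mult_mat(1)) (use that ij X BCD in auto)
        also have "\<dots> = (\<Sum>k<n. X $$ (l, k) * A k (\<kappa> (n + j)))"
          unfolding scalar_prod_def using that ij X
          by (intro sum.cong) (simp_all add: B_def atLeast0LessThan)
        finally show ?thesis .
      qed
      have "(C * (X * B)) $$ (i, j) = row C i \<bullet> col (X * B) j"
        by (rule index_mult_mat(1)) (use ij XB BCD in simp_all)
      also have "\<dots> = (\<Sum>l<n. C $$ (i, l) * (X * B) $$ (l, j))"
        unfolding scalar_prod_def using ij XB BCD
        by (intro sum.cong) (use X in \<open>simp_all add: atLeast0LessThan\<close>)
      also have "\<dots> = (\<Sum>l<n. A (\<rho> (n + i)) l * (\<Sum>k<n. X $$ (l, k) * A k (\<kappa> (n + j))))"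
        by (intro sum.cong refl) (simp add: 1 C_def ij)
      finally show ?thesis .
    qed
    have sm: "D - C * (X * B) = mat q q (\<lambda>(i,j). s (\<rho> (n + i)) (\<kappa> (n + j)))"
    proof (rule eq_matI)
      fix i j assume "i < dim_row (mat q q (\<lambda>(i,j). s (\<rho> (n + i)) (\<kappa> (n + j))))"
        "j < dim_col (mat q q (\<lambda>(i,j). s (\<rho> (n + i)) (\<kappa> (n + j))))"
      then have ij: "i < q" "j < q" by simp_all
      have "(D - C * (X * B)) $$ (i, j) = D $$ (i, j) - (C * (X * B)) $$ (i, j)"
        by (rule index_minus_mat(1)) (use ij BCD XB in simp_all)
      also have "\<dots> = s (\<rho> (n + i)) (\<kappa> (n + j))"
        unfolding CXB[OF ij] by (simp add: D_def s_def ij sum_distrib_left mult.assoc)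
      finally show "(D - C * (X * B)) $$ (i, j) = mat q q (\<lambda>(i,j). s (\<rho> (n + i)) (\<kappa> (n + j))) $$ (i, j)"
        using ij by simp
    qed (use BCD XB in simp_all)
    have "Determinant.det (four_block_mat M B C D) = Determinant.det (four_block_mat M B C D * N)"
    proof -
      have "four_block_mat M B C D \<in> carrier_mat (n + q) (n + q)"
        by (rule four_block_carrier_mat[OF M BCD(3)])
      moreover have "N \<in> carrier_mat (n + q) (n + q)"
        unfolding N_def by (rule four_block_carrier_mat) simp_all
      ultimately show ?thesis by (simp only: det_mult detN mult_1_right)
    qed
    also have "\<dots> = Determinant.det M * Determinant.det (D - C * (X * B))"
      unfolding FN
      by (rule det_four_block_mat_upper_right_zero[OF M refl BCD(2)])
         (rule minus_carrier_mat[OF mult_carrier_mat[OF BCD(2) XB]])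
    finally show "ndet (n + q) (\<lambda>i j. A (\<rho> i) (\<kappa> j)) = ndet n A * ndet q (\<lambda>i j. s (\<rho> (n + i)) (\<kappa> (n + j)))"
      by (simp only: ndet_det M4 sm M_def)
  qed
qed

text \<open>By the Schur complement each minor \<open>b r c\<close> is \<open>ndet n A\<close> times
  a single entry \<open>s r c\<close>, and the full determinant is \<open>ndet n A\<close> times a 2
  by 2 determinant of the same entries.\<close>

lemma desnanot_jacobi_corner:
  assumes nz: "ndet n A \<noteq> 0"
  defines "b \<equiv> \<lambda>r c. ndet (Suc n) (\<lambda>i j. A (if i = n then r else i) (if j = n then c else j))"
  shows "b n n * b (Suc n) (Suc n) - b n (Suc n) * b (Suc n) n = ndet n A * ndet (Suc (Suc n)) A"
proof -
  obtain s where
    s: "\<And>q \<rho> \<kappa>. (\<And>i. i < n \<Longrightarrow> \<rho> i = i) \<Longrightarrow> (\<And>i. i < n \<Longrightarrow> \<kappa> i = i) \<Longrightarrow>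
       ndet (n + q) (\<lambda>i j. A (\<rho> i) (\<kappa> j)) = ndet n A * ndet q (\<lambda>i j. s (\<rho> (n + i)) (\<kappa> (n + j)))"
    by (rule ndet_schur[OF nz]) blast
  have b: "b r c = ndet n A * s r c" for r c
    using s[of "\<lambda>i. if i = n then r else i" "\<lambda>j. if j = n then c else j" 1]
    by (simp add: b_def ndet_1[unfolded One_nat_def])
  have "ndet (Suc (Suc n)) A = ndet n A * (s n n * s (Suc n) (Suc n) - s n (Suc n) * s (Suc n) n)"
    using s[of "\<lambda>i. i" "\<lambda>i. i" 2] by (simp add: ndet_2)
  then show ?thesis unfolding b by (simp only:) (simp add: algebra_simps)
qed

lemma ndet_identical_columns:
  assumes "i < m" "j < m" "i \<noteq> j" "\<And>r. r < m \<Longrightarrow> A r i = A r j"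
  shows "ndet m A = 0"
  unfolding ndet_det
  by (rule det_identical_columns[of _ m i j]) (use assms in \<open>auto intro!: eq_vecI\<close>)

lemma ndet_identical_rows:
  assumes "i < m" "j < m" "i \<noteq> j" "\<And>r. r < m \<Longrightarrow> A i r = A j r"
  shows "ndet m A = 0"
  unfolding ndet_det
  by (rule det_identical_rows[of _ m i j]) (use assms in \<open>auto intro!: eq_vecI\<close>)

lemma ndet_permute_columns:
  assumes p: "p permutes {..<m}"
  shows "ndet m (\<lambda>i j. A i (p j)) = of_int (sign p) * ndet m A"
proof -
  have p': "p permutes {0..<m}" using p by (simp add: atLeast0LessThan)
  \<comment> \<open>\<open>det_permute_rows\<close> acts on rows, so the columns are turned into
    rows by transposing.\<close>
  have *: "ndet m B = Determinant.det (mat m m (\<lambda>(i,j). B j i))" for B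
    unfolding ndet_det
    by (subst det_transpose[symmetric, of _ m]) (auto intro!: arg_cong[where f=Determinant.det] eq_matI)
  have "mat m m (\<lambda>(i,j). mat m m (\<lambda>(i,j). A j i) $$ (p i, j)) = mat m m (\<lambda>(i,j). A j (p i))"
    using permutes_in_image[OF p'] by (intro eq_matI) auto
  then show ?thesis
    using det_permute_rows[OF _ p', of "mat m m (\<lambda>(i,j). A j i)"] by (simp add: *)
qed

lemma has_field_derivative_prod_within:
  fixes f f' :: "'a \<Rightarrow> 'b::real_normed_field \<Rightarrow> 'b"
  assumes "\<And>x. x \<in> A \<Longrightarrow> (f x has_field_derivative f' x z) (at z within S)"
  shows "((\<lambda>u. \<Prod>x\<in>A. f x u) has_field_derivative (\<Sum>x\<in>A. f' x z * (\<Prod>y\<in>A-{x}. f y z))) (at z within S)"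
  using assms
proof (induction A rule: infinite_finite_induct)
  case (insert x A)
  have eq: "insert x A - {y} = insert x (A - {y})" if "y \<in> A" for y
    using insert.hyps that by auto
  show ?case
    using insert.hyps
    by (auto intro!: derivative_eq_intros insert.prems insert.IH sum.cong
             simp: sum_distrib_left sum_distrib_right eq)
qed auto

text \<open>Row r + 1 is the derivative of row r. Differentiating any row but the last creates two
  equal rows, so a single term of the product rule survives.\<close>

lemma ndet_has_derivative:
  fixes A :: "nat \<Rightarrow> nat \<Rightarrow> real \<Rightarrow> real"
  assumes m: "0 < m"
    and der: "\<And>r c. r < m \<Longrightarrow> c < m \<Longrightarrow> (A r c has_field_derivative A (Suc r) c x) (at x within S)"
  shows "((\<lambda>y. ndet m (\<lambda>r c. A r c y)) has_field_derivative
           ndet m (\<lambda>r c. A (if r = m - 1 then m else r) c x)) (at x within S)"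
proof -
  define P where "P = {p. p permutes {..<m}}"
  have Pm: "p i < m" if "p \<in> P" "i < m" for p i
    using that permutes_in_image[of p "{..<m}" i] by (auto simp: P_def)
  have "((\<lambda>y. ndet m (\<lambda>r c. A r c y)) has_field_derivative
     (\<Sum>p\<in>P. of_int (sign p) * (\<Sum>k<m. A (Suc k) (p k) x * (\<Prod>i\<in>{..<m} - {k}. A i (p i) x)))) (at x within S)"
    unfolding ndet_def P_def[symmetric]
    using has_field_derivative_prod_within[where f="\<lambda>i. A i (p i)" and f'="\<lambda>i. A (Suc i) (p i)" and A="{..<m}" for p]
    by (intro DERIV_sum DERIV_cmult) (use der Pm in auto)
  also have "(\<Sum>p\<in>P. of_int (sign p) * (\<Sum>k<m. A (Suc k) (p k) x * (\<Prod>i\<in>{..<m} - {k}. A i (p i) x)))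
     = (\<Sum>p\<in>P. \<Sum>k<m. of_int (sign p) * (\<Prod>i<m. A (if i = k then Suc k else i) (p i) x))"
  proof -
    have "(\<Prod>i<m. A (if i = k then Suc k else i) (p i) x)
        = A (Suc k) (p k) x * (\<Prod>i\<in>{..<m} - {k}. A i (p i) x)" if "k < m" for k p
      using that by (subst prod.remove[of _ k]) (auto intro!: prod.cong)
    then show ?thesis by (simp add: sum_distrib_left)
  qed
  also have "\<dots> = (\<Sum>k<m. ndet m (\<lambda>r c. A (if r = k then Suc k else r) c x))"
    unfolding ndet_def P_def[symmetric] by (rule sum.swap)
  also have "\<dots> = (\<Sum>k\<in>{m - 1}. ndet m (\<lambda>r c. A (if r = k then Suc k else r) c x))"
  proof (rule sum.mono_neutral_right)
    show "\<forall>k\<in>{..<m} - {m - 1}. ndet m (\<lambda>r c. A (if r = k then Suc k else r) c x) = 0"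
      proof
      fix k assume k: "k \<in> {..<m} - {m - 1}"
      show "ndet m (\<lambda>r c. A (if r = k then Suc k else r) c x) = 0"
        by (rule ndet_identical_rows[of k m "Suc k"]) (use k in auto)
    qed
  qed (use m in auto)
  also have "\<dots> = ndet m (\<lambda>r c. A (if r = m - 1 then m else r) c x)"
    using m by (auto intro!: ndet_cong)
  finally show ?thesis .
qed

section \<open>Iterated derivatives on a half-open interval\<close>

lemma abs_cont_on_ndet:
  assumes "\<And>r c. r < m \<Longrightarrow> c < m \<Longrightarrow> abs_cont_on a b (A r c)"
  shows "abs_cont_on a b (\<lambda>x. ndet m (\<lambda>r c. A r c x))"
  unfolding ndet_def
proof (intro abs_cont_on_sum abs_cont_on_mult abs_cont_on_prod abs_cont_on_const)
  fix p i assume "p \<in> {p. p permutes {..<m}}" "i \<in> {..<m}"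
  then show "abs_cont_on a b (A i (p i))" using assms permutes_in_image[of p "{..<m}" i] by auto
qed

lemma continuous_on_ndet:
  assumes "\<And>r c. r < m \<Longrightarrow> c < m \<Longrightarrow> continuous_on X (A r c)"
  shows "continuous_on X (\<lambda>x. ndet m (\<lambda>r c. A r c x))"
  unfolding ndet_def
proof (intro continuous_intros)
  fix p i assume "p \<in> {p. p permutes {..<m}}" "i \<in> {..<m}"
  then show "continuous_on X (A i (p i))" using assms permutes_in_image[of p "{..<m}" i] by auto
qed

lemma has_field_derivative_transform_on:
  assumes "(f has_field_derivative d) (at x within S)" "x \<in> S" "\<And>y. y \<in> S \<Longrightarrow> g y = f y"
  shows "(g has_field_derivative d) (at x within S)"
  by (rule has_field_derivative_transform_within[OF assms(1) less_numeral_extra(1) assms(2)]) (use assms(3) in auto)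

lemma hderiv_0 [simp]: "hderiv S 0 f = f"
  by (simp add: hderiv_def)

lemma hderiv_Suc: "hderiv S (Suc k) f x = vector_derivative (hderiv S k f) (at x within S)"
  by (simp add: hderiv_def)

lemma Ck_on_deriv:
  "Ck_on S k f \<Longrightarrow> j < k \<Longrightarrow> x \<in> S \<Longrightarrow> (hderiv S j f has_real_derivative hderiv S (Suc j) f x) (at x within S)"
  by (simp add: Ck_on_def has_real_derivative_iff_has_vector_derivative)

lemma Ck_on_continuous:
  assumes "Ck_on S k f" "j \<le> k" shows "continuous_on S (hderiv S j f)"
proof (cases "j = k")
  case False
  then show ?thesis
    using Ck_on_deriv[OF assms(1), of j] assms(2)
    by (intro DERIV_continuous_on[where D="hderiv S (Suc j) f"]) auto
qed (use assms in \<open>simp add: Ck_on_def\<close>)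

lemma Ico_e_Icc: "x \<in> Ico_e T x0 \<Longrightarrow> y \<in> Ico_e T x0 \<Longrightarrow> {x..y} \<subseteq> Ico_e T x0"
  by (auto simp: Ico_e_def intro: le_less_trans[of "ereal _" "ereal y"])

lemma Ico_e_right:
  assumes "x \<in> Ico_e T x0" obtains y where "x < y" "y \<in> Ico_e T x0"
proof -
  obtain y where "ereal x < y" "y < x0" using assms dense[of "ereal x" x0] by (auto simp: Ico_e_def)
  then show ?thesis using assms that[of "real_of_ereal y"] by (cases y) (auto simp: Ico_e_def)
qed

lemma connected_Ico_e: "connected (Ico_e T x0)"
  unfolding connected_iff_interval using Ico_e_Icc by force

text \<open>Makes derivatives within the half-open interval unique, including the one-sided
  derivative at its left end point, so that \<open>vector_derivative\<close> can be
  evaluated.\<close>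

lemma Ico_e_within_nontrivial:
  assumes "x \<in> Ico_e T x0" shows "at x within Ico_e T x0 \<noteq> bot"
proof -
  obtain y where y: "x < y" "y \<in> Ico_e T x0" using Ico_e_right[OF assms] .
  have "at x within {x..y} \<noteq> bot" using y by (auto simp: trivial_limit_within islimpt_Icc)
  then show ?thesis using at_le[OF Ico_e_Icc[OF assms y(2)], of x] by (metis le_bot)
qed

locale half_open =
  fixes T :: real and x0 :: ereal
  assumes Tx0: "ereal T < x0"
begin

abbreviation S :: "real set" where "S \<equiv> Ico_e T x0"
abbreviation F :: "real filter" where "F \<equiv> left_at x0"

lemma vector_derivative_Ico_e:
  fixes g :: "real \<Rightarrow> real"
  assumes "x \<in> S" "(g has_real_derivative d) (at x within S)"
  shows "vector_derivative g (at x within S) = d"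
  using assms Ico_e_within_nontrivial
  by (intro vector_derivative_within) (auto simp: has_real_derivative_iff_has_vector_derivative)

lemma hderiv_lincomb:
  assumes f: "Ck_on S k f" and g: "Ck_on S k g"
  shows "j \<le> k \<Longrightarrow> x \<in> S \<Longrightarrow>
    hderiv S j (\<lambda>x. f x + c * g x) x = hderiv S j f x + c * hderiv S j g x"
proof (induction j arbitrary: x)
  case (Suc j)
  have "((\<lambda>x. hderiv S j f x + c * hderiv S j g x) has_real_derivative
      hderiv S (Suc j) f x + c * hderiv S (Suc j) g x) (at x within S)"
    using Suc.prems by (intro DERIV_add DERIV_cmult Ck_on_deriv[OF f] Ck_on_deriv[OF g]) auto
  then have "(hderiv S j (\<lambda>x. f x + c * g x) has_real_derivative
      hderiv S (Suc j) f x + c * hderiv S (Suc j) g x) (at x within S)"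
    by (rule has_field_derivative_transform_on) (use Suc in auto)
  then show ?case unfolding hderiv_Suc using Suc.prems by (intro vector_derivative_Ico_e)
qed simp

lemma Ck_on_lincomb:
  assumes f: "Ck_on S k f" and g: "Ck_on S k g"
  shows "Ck_on S k (\<lambda>x. f x + c * g x)"
  unfolding Ck_on_def
proof (intro conjI allI impI ballI)
  have "continuous_on S (\<lambda>x. hderiv S k f x + c * hderiv S k g x)"
    using Ck_on_continuous[OF f order_refl] Ck_on_continuous[OF g order_refl] by (intro continuous_intros)
  then show "continuous_on S (hderiv S k (\<lambda>x. f x + c * g x))"
    by (rule continuous_on_eq) (simp add: hderiv_lincomb[OF f g])
  fix j x assume j: "j < k" and x: "x \<in> S"
  have "((\<lambda>x. hderiv S j f x + c * hderiv S j g x) has_real_derivative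
      hderiv S (Suc j) f x + c * hderiv S (Suc j) g x) (at x within S)"
    using j x by (intro DERIV_add DERIV_cmult Ck_on_deriv[OF f] Ck_on_deriv[OF g]) auto
  then have "(hderiv S j (\<lambda>x. f x + c * g x) has_real_derivative
      hderiv S (Suc j) f x + c * hderiv S (Suc j) g x) (at x within S)"
    by (rule has_field_derivative_transform_on) (use j x in \<open>auto simp: hderiv_lincomb[OF f g]\<close>)
  then show "(hderiv S j (\<lambda>x. f x + c * g x) has_vector_derivative hderiv S (Suc j) (\<lambda>x. f x + c * g x) x) (at x within S)"
    using j x by (simp add: hderiv_lincomb[OF f g] has_real_derivative_iff_has_vector_derivative)
qed

text \<open>Continuity is local: near each point \<open>S\<close> agrees with a compact interval
  \<open>{T..y}\<close>, on which absolute continuity applies.\<close>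

lemma ACk_imp_Ck:
  assumes "ACk_on S k f" shows "Ck_on S k f"
proof -
  have "continuous (at x within S) (hderiv S k f)" if x: "x \<in> S" for x
  proof -
    obtain y where y: "x < y" "y \<in> S" using Ico_e_right[OF x] .
    have TS: "T \<in> S" using x by (auto simp: Ico_e_def intro: le_less_trans[of "ereal T" "ereal x"])
    have "continuous_on {T..y} (hderiv S k f)"
      using assms Ico_e_Icc[OF TS y(2)] y(2)
      by (intro abs_cont_on_imp_continuous_on) (auto simp: ACk_on_def Ico_e_def)
    then have "continuous (at x within {T..y}) (hderiv S k f)"
      using x y by (auto simp: continuous_on_eq_continuous_within Ico_e_def)
    moreover have "at x within S = at x within {T..y}"
      by (rule at_within_nhd[of _ "{..<y}"]) (use y x Ico_e_Icc[OF TS y(2)] in \<open>auto simp: Ico_e_def\<close>)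
    ultimately show ?thesis by simp
  qed
  then show ?thesis using assms by (simp add: Ck_on_def ACk_on_def continuous_on_eq_continuous_within)
qed

text \<open>Below the top order the next derivative is continuous, hence bounded on the compact
  interval, and the mean value inequality gives a Lipschitz bound.\<close>

lemma ACk_on_abs_cont:
  assumes f: "ACk_on S k f" and j: "j \<le> k" and xy: "x \<in> S" "y \<in> S" "x \<le> y"
  shows "abs_cont_on x y (hderiv S j f)"
proof (cases "j = k")
  case True
  then show ?thesis using f xy Ico_e_Icc[OF xy(1,2)] by (auto simp: ACk_on_def)
next
  case False
  have sub: "{x..y} \<subseteq> S" using Ico_e_Icc[OF xy(1,2)] .
  have "continuous_on {x..y} (hderiv S (Suc j) f)"
    using Ck_on_continuous[OF ACk_imp_Ck[OF f], of "Suc j"] False j continuous_on_subset[OF _ sub] by auto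
  then obtain B where "B \<ge> 0" and B: "\<And>z. x \<le> z \<Longrightarrow> z \<le> y \<Longrightarrow> \<bar>hderiv S (Suc j) f z\<bar> \<le> B"
    by (rule continuous_on_Icc_bounded) blast
  show ?thesis
  proof (rule abs_cont_on_lipschitz[OF \<open>B \<ge> 0\<close>])
    fix u v assume uv: "x \<le> u" "u \<le> v" "v \<le> y"
    have "norm (hderiv S j f v - hderiv S j f u) \<le> B * norm (v - u)"
    proof (rule field_differentiable_bound[of "{x..y}"])
      show "(hderiv S j f has_field_derivative hderiv S (Suc j) f z) (at z within {x..y})" if "z \<in> {x..y}" for z
        by (rule has_field_derivative_subset[OF Ck_on_deriv[OF ACk_imp_Ck[OF f], of j z] sub])
          (use that sub j False in auto)
      show "norm (hderiv S (Suc j) f z) \<le> B" if "z \<in> {x..y}" for z using B that by simp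
    qed (use uv in auto)
    then show "\<bar>hderiv S j f v - hderiv S j f u\<bar> \<le> B * \<bar>v - u\<bar>" by simp
  qed
qed

end

section \<open>Comparison of functions near the right end point\<close>

context half_open
begin

lemma T_S: "T \<in> S"
  using Tx0 by (simp add: Ico_e_def)

lemma S_down: "y \<in> S \<Longrightarrow> T \<le> x \<Longrightarrow> x \<le> y \<Longrightarrow> x \<in> S"
  using Ico_e_Icc[OF T_S] by fastforce

text \<open>Puts finite and infinite \<open>x0\<close> on the same footing, so that later limit
  arguments only see tails of \<open>S\<close>.\<close>

lemma eventually_F: "eventually P F \<longleftrightarrow> (\<exists>t\<in>S. \<forall>x\<in>S. t \<le> x \<longrightarrow> P x)"
proof (cases x0)
  case (real r)
  have r: "T < r" using Tx0 real by simp
  have S: "S = {T..<r}" by (auto simp: Ico_e_def real)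
  have F: "F = at_left r" by (simp add: left_at_def real)
  show ?thesis
    unfolding S F eventually_at_left_field
  proof
    assume "\<exists>b<r. \<forall>y>b. y < r \<longrightarrow> P y"
    then obtain b where b: "b < r" "\<And>y. b < y \<Longrightarrow> y < r \<Longrightarrow> P y" by blast
    show "\<exists>t\<in>{T..<r}. \<forall>x\<in>{T..<r}. t \<le> x \<longrightarrow> P x"
      by (rule bexI[of _ "max T ((b + r) / 2)"]) (use b r in \<open>auto simp: max_def field_simps\<close>)
  next
    assume "\<exists>t\<in>{T..<r}. \<forall>x\<in>{T..<r}. t \<le> x \<longrightarrow> P x"
    then show "\<exists>b<r. \<forall>y>b. y < r \<longrightarrow> P y" by force
  qed
next
  case PInf
  then have "S = {T..}" "F = at_top" by (auto simp: Ico_e_def left_at_def)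
  moreover have "(\<exists>N. \<forall>x\<ge>N. P x) \<longleftrightarrow> (\<exists>t\<in>{T..}. \<forall>x\<in>{T..}. t \<le> x \<longrightarrow> P x)"
  proof
    assume "\<exists>N. \<forall>x\<ge>N. P x"
    then obtain N where "\<And>x. x \<ge> N \<Longrightarrow> P x" by blast
    then show "\<exists>t\<in>{T..}. \<forall>x\<in>{T..}. t \<le> x \<longrightarrow> P x" by (intro bexI[of _ "max T N"]) auto
  next
    assume "\<exists>t\<in>{T..}. \<forall>x\<in>{T..}. t \<le> x \<longrightarrow> P x"
    then obtain t where "t \<ge> T" "\<And>x. x \<ge> T \<Longrightarrow> t \<le> x \<Longrightarrow> P x" by auto
    then show "\<exists>N. \<forall>x\<ge>N. P x" by (intro exI[of _ t]) auto
  qed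
  ultimately show ?thesis by (simp add: eventually_at_top_linorder)
next
  case MInf
  then show ?thesis using Tx0 by simp
qed

lemma eventually_S: "\<forall>\<^sub>F x in F. x \<in> S"
  using T_S by (auto simp: eventually_F)

lemma F_nontrivial [simp]: "F \<noteq> bot"
proof
  assume "F = bot"
  then have "eventually (\<lambda>_. False) F" by simp
  then show False unfolding eventually_F by auto
qed

text \<open>Turns an improper integral into a limit of integrals over \<open>{s..y k}\<close>, to
  which monotone convergence applies.\<close>

lemma cofinal_seq:
  assumes "s \<in> S"
  obtains y where "\<And>k::nat. y k \<in> S" "\<And>k. s \<le> y k" "incseq y" "\<And>x. x \<in> S \<Longrightarrow> \<exists>k. x \<le> y k"
proof (cases x0)
  case (real r)
  have S: "S = {T..<r}" by (auto simp: Ico_e_def real)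
  have s: "T \<le> s" "s < r" using assms by (auto simp: S)
  define y where "y k = r - (r - s) / real (Suc k)" for k
  have le: "(r - s) / real (Suc k) \<le> r - s" for k 
  proof -
    have "(r - s) / real (Suc k) \<le> (r - s) / 1" using s by (intro divide_left_mono) auto
    then show ?thesis by simp
  qed
  show ?thesis
  proof (rule that[of y])
    show "y k \<in> S" for k using s le[of k] by (simp add: S y_def)
    show "s \<le> y k" for k using le[of k] by (simp add: y_def)
    show "incseq y"
      unfolding incseq_def y_def
    proof (intro allI impI)
      fix i j :: nat assume "i \<le> j"
      then have "(r - s) / real (Suc j) \<le> (r - s) / real (Suc i)"
        using s by (intro divide_left_mono) auto
      then show "r - (r - s) / real (Suc i) \<le> r - (r - s) / real (Suc j)" by simp
    qed
    show "\<exists>k. x \<le> y k" if "x \<in> S" for x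
    proof -
      have "r - x > 0" using that by (simp add: S)
      then obtain k where "(r - s) / (r - x) < real k" using reals_Archimedean2 by blast
      then have "(r - s) / (r - x) \<le> real (Suc k)" by simp
      then have "(r - s) / real (Suc k) \<le> r - x" using \<open>r - x > 0\<close> by (simp add: field_simps del: of_nat_Suc)
      then show ?thesis by (intro exI[of _ k]) (simp add: y_def)
    qed
  qed
next
  case PInf
  then have S: "S = {T..}" by (auto simp: Ico_e_def)
  show ?thesis
  proof (rule that[of "\<lambda>k. s + real k"])
    show "\<exists>k. x \<le> s + real k" for x using real_arch_simple[of "x - s"] by (auto simp: algebra_simps)
  qed (use assms in \<open>auto simp: S incseq_def\<close>)
next
  case MInf
  then show ?thesis using Tx0 by simp
qed

lemma at_within_S: assumes "x \<in> S" "T < x" shows "at x within S = at x"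
proof -
  obtain y where y: "x < y" "y \<in> S" using Ico_e_right[OF assms(1)] .
  have "{T<..<y} \<subseteq> S" using S_down[OF y(2)] by auto
  then have "x \<in> interior S" using assms y by (intro interiorI[of "{T<..<y}"]) auto
  then show ?thesis by (rule at_within_interior)
qed

definition evd :: "(real \<Rightarrow> real) \<Rightarrow> (real \<Rightarrow> real) \<Rightarrow> bool" where
  "evd G G' \<longleftrightarrow> (\<forall>x\<in>S. (G has_real_derivative G' x) (at x within S))"

definition one_signed :: "(real \<Rightarrow> real) \<Rightarrow> bool" where
  "one_signed G \<longleftrightarrow> (\<forall>\<^sub>F x in F. G x \<ge> 0) \<or> (\<forall>\<^sub>F x in F. G x \<le> 0)"

definition ev_incr :: "(real \<Rightarrow> real) \<Rightarrow> bool" where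
  "ev_incr G \<longleftrightarrow> (\<exists>t\<in>S. \<forall>x\<in>S. \<forall>y\<in>S. t \<le> x \<longrightarrow> x \<le> y \<longrightarrow> G x \<le> G y)"

definition ev_mono :: "(real \<Rightarrow> real) \<Rightarrow> bool" where
  "ev_mono G \<longleftrightarrow> ev_incr G \<or> ev_incr (\<lambda>x. - G x)"

lemma evd_minus: "evd G G' \<Longrightarrow> evd (\<lambda>x. - G x) (\<lambda>x. - G' x)"
  unfolding evd_def by (auto intro: DERIV_minus)

lemma evd_add: "evd G G' \<Longrightarrow> evd H H' \<Longrightarrow> evd (\<lambda>x. G x + H x) (\<lambda>x. G' x + H' x)"
  unfolding evd_def by (auto intro: DERIV_add)

lemma evd_cmult: "evd G G' \<Longrightarrow> evd (\<lambda>x. c * G x) (\<lambda>x. c * G' x)"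
  unfolding evd_def by (auto intro: DERIV_cmult)

lemma evd_mono:
  assumes d: "evd G G'" and xy: "x \<in> S" "y \<in> S" "x \<le> y" and nn: "\<And>z. x \<le> z \<Longrightarrow> z \<le> y \<Longrightarrow> G' z \<ge> 0"
  shows "G x \<le> G y"
proof (cases "x = y")
  case False
  have sub: "{x..y} \<subseteq> S" using Ico_e_Icc xy by blast
  show ?thesis
  proof (rule DERIV_nonneg_imp_increasing_open[of x y G])
    show "\<exists>l. DERIV G z :> l \<and> l \<ge> 0" if z: "x < z" "z < y" for z
    proof -
      have "z \<in> S" using sub z by auto
      moreover have "T < z" using z(1) xy(1) by (simp add: Ico_e_def)
      ultimately show ?thesis using d nn[of z] z unfolding evd_def by (metis at_within_S less_imp_le)
    qed
    show "continuous_on {x..y} G"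
      using d sub unfolding evd_def
      by (intro DERIV_continuous_on[of _ _ G']) (meson has_field_derivative_subset subsetD)
  qed (use xy in auto)
qed simp

lemma evd_ev_incr: assumes "evd G G'" "\<forall>\<^sub>F x in F. G' x \<ge> 0" shows "ev_incr G"
proof -
  obtain t where t: "t \<in> S" "\<And>x. x \<in> S \<Longrightarrow> t \<le> x \<Longrightarrow> G' x \<ge> 0" using assms(2) unfolding eventually_F by blast
  have "G x \<le> G y" if "x \<in> S" "y \<in> S" "t \<le> x" "x \<le> y" for x y
  proof (rule evd_mono[OF assms(1) that(1,2,4)])
    show "G' z \<ge> 0" if z: "x \<le> z" "z \<le> y" for z
      using t(2)[of z] Ico_e_Icc[OF \<open>x \<in> S\<close> \<open>y \<in> S\<close>] z \<open>t \<le> x\<close> by auto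
  qed
  then show ?thesis using t(1) unfolding ev_incr_def by blast
qed

lemma evd_ev_mono: assumes "evd G G'" "one_signed G'" shows "ev_mono G"
  using assms(2) evd_ev_incr[OF assms(1)] evd_ev_incr[OF evd_minus[OF assms(1)]]
  unfolding one_signed_def ev_mono_def by auto

lemma one_signed_minus: "one_signed (\<lambda>x. - G x) \<longleftrightarrow> one_signed G"
  unfolding one_signed_def by auto

lemma ev_incr_one_signed: assumes "ev_incr G" shows "one_signed G"
proof -
  obtain t where t: "t \<in> S" "\<And>x y. x \<in> S \<Longrightarrow> y \<in> S \<Longrightarrow> t \<le> x \<Longrightarrow> x \<le> y \<Longrightarrow> G x \<le> G y"
    using assms unfolding ev_incr_def by blast
  show ?thesis
  proof (cases "\<exists>x\<in>S. t \<le> x \<and> G x \<ge> 0")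
    case True
    then obtain x where x: "x \<in> S" "t \<le> x" "G x \<ge> 0" by blast
    have "\<forall>y\<in>S. x \<le> y \<longrightarrow> G y \<ge> 0" using t(2)[OF x(1) _ x(2)] x(3) by (meson order_trans)
    then show ?thesis using x(1) unfolding one_signed_def eventually_F by blast
  next
    case False
    then show ?thesis using t(1) unfolding one_signed_def eventually_F by (meson linear)
  qed
qed

lemma ev_mono_one_signed: "ev_mono G \<Longrightarrow> one_signed G"
  unfolding ev_mono_def using ev_incr_one_signed one_signed_minus by blast

lemma ev_incr_cases:
  assumes "ev_incr G"
  obtains c where "(G \<longlongrightarrow> c) F" | "filterlim G at_top F"
proof -
  obtain t where t: "t \<in> S" "\<And>x y. x \<in> S \<Longrightarrow> y \<in> S \<Longrightarrow> t \<le> x \<Longrightarrow> x \<le> y \<Longrightarrow> G x \<le> G y"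
    using assms unfolding ev_incr_def by blast
  define X where "X = G ` {x\<in>S. t \<le> x}"
  have ne: "X \<noteq> {}" using t(1) by (auto simp: X_def)
  show ?thesis
  proof (cases "bdd_above X")
    case True
    have "(G \<longlongrightarrow> Sup X) F"
    proof (rule order_tendstoI)
      fix a assume "a < Sup X"
      then obtain x where x: "x \<in> S" "t \<le> x" "a < G x" using less_cSup_iff[OF ne True] by (auto simp: X_def)
      have "\<forall>y\<in>S. x \<le> y \<longrightarrow> a < G y" using t(2)[OF x(1) _ x(2)] x(3) by (meson less_le_trans)
      then show "\<forall>\<^sub>F x in F. a < G x" using x(1) unfolding eventually_F by blast
    next
      fix a assume a: "Sup X < a"
      have "G y < a" if "y \<in> S" "t \<le> y" for y
        using cSup_upper[OF _ True, of "G y"] that a by (auto simp: X_def)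
      then show "\<forall>\<^sub>F x in F. G x < a" using t(1) unfolding eventually_F by blast
    qed
    then show ?thesis by (rule that)
  next
    case False
    have "filterlim G at_top F"
      unfolding filterlim_at_top
    proof
      fix Z
      obtain x where x: "x \<in> S" "t \<le> x" "Z \<le> G x"
        using False by (auto simp: bdd_above_def X_def) (meson linear)
      have "\<forall>y\<in>S. x \<le> y \<longrightarrow> Z \<le> G y" using t(2)[OF x(1) _ x(2)] x(3) by (meson order_trans)
      then show "\<forall>\<^sub>F x in F. Z \<le> G x" using x(1) unfolding eventually_F by blast
    qed
    then show ?thesis by (rule that)
  qed
qed

lemma ev_mono_cases:
  assumes "ev_mono G"
  obtains c where "(G \<longlongrightarrow> c) F" | "filterlim (\<lambda>x. \<bar>G x\<bar>) at_top F"
proof -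
  have abs: "filterlim (\<lambda>x. \<bar>H x\<bar>) at_top F" if "filterlim H at_top F" for H :: "real \<Rightarrow> real"
    using that by (rule filterlim_at_top_mono) (rule eventually_mono[OF eventually_S], simp)
  consider "ev_incr G" | "ev_incr (\<lambda>x. - G x)" using assms ev_mono_def by blast
  then show ?thesis
  proof cases
    case 1
    then show ?thesis by (rule ev_incr_cases) (use that abs in blast)+
  next
    case 2
    then show ?thesis
    proof (rule ev_incr_cases)
      fix c assume "((\<lambda>x. - G x) \<longlongrightarrow> c) F"
      from tendsto_minus[OF this] show ?thesis by (intro that(1)[of "- c"]) simp
    next
      assume "filterlim (\<lambda>x. - G x) at_top F"
      from abs[OF this] show ?thesis by (intro that(2)) simp
    qed
  qed
qed

text \<open>An eventually monotone function has a finite limit or its modulus diverges; in both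
  cases, failing to tend to 0 means staying away from 0. The later proofs by contradiction start
  here.\<close>

lemma ev_mono_not_0:
  assumes "ev_mono G" "\<not> (G \<longlongrightarrow> 0) F"
  obtains c where "c > 0" "\<forall>\<^sub>F x in F. c \<le> \<bar>G x\<bar>"
  using assms(1)
proof (rule ev_mono_cases)
  fix c assume c: "(G \<longlongrightarrow> c) F"
  then have "c \<noteq> 0" using assms(2) by auto
  have "((\<lambda>x. \<bar>G x\<bar>) \<longlongrightarrow> \<bar>c\<bar>) F" using c by (rule tendsto_rabs)
  then have "\<forall>\<^sub>F x in F. \<bar>c\<bar> / 2 < \<bar>G x\<bar>" by (rule order_tendstoD) (use \<open>c \<noteq> 0\<close> in auto)
  then show thesis using \<open>c \<noteq> 0\<close> by (intro that[of "\<bar>c\<bar> / 2"]) (auto elim: eventually_mono)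
next
  assume "filterlim (\<lambda>x. \<bar>G x\<bar>) at_top F"
  then show thesis by (intro that[of 1]) (auto simp: filterlim_at_top)
qed

lemma ev_incr_lim_upper:
  assumes "ev_incr G" "(G \<longlongrightarrow> c) F" shows "\<forall>\<^sub>F x in F. G x \<le> c"
proof -
  obtain t where t: "t \<in> S" "\<And>x y. x \<in> S \<Longrightarrow> y \<in> S \<Longrightarrow> t \<le> x \<Longrightarrow> x \<le> y \<Longrightarrow> G x \<le> G y"
    using assms(1) unfolding ev_incr_def by blast
  have "G x \<le> c" if "x \<in> S" "t \<le> x" for x
    by (rule tendsto_lowerbound[OF assms(2) _ F_nontrivial]) (use t(2)[OF that(1) _ that(2)] that(1) in \<open>auto simp: eventually_F\<close>)
  then show ?thesis using t(1) unfolding eventually_F by blast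
qed

text \<open>The next two lemmas replace l'Hospital's rule in the cases 0/0 and \<infinity>/\<infinity>.\<close>

lemma compare_vanishing:
  assumes G: "evd G G'" "(G \<longlongrightarrow> 0) F" "one_signed G'"
    and H: "evd H H'" "(H \<longlongrightarrow> 0) F"
    and le: "\<forall>\<^sub>F x in F. \<bar>H' x\<bar> \<le> C * \<bar>G' x\<bar>"
  shows "\<forall>\<^sub>F x in F. \<bar>H x\<bar> \<le> C * \<bar>G x\<bar>"
proof -
  have main: "\<forall>\<^sub>F x in F. \<bar>H x\<bar> \<le> C * \<bar>G x\<bar>"
    if G: "evd G G'" "(G \<longlongrightarrow> 0) F" "\<forall>\<^sub>F x in F. G' x \<ge> 0" and le: "\<forall>\<^sub>F x in F. \<bar>H' x\<bar> \<le> C * \<bar>G' x\<bar>" for G G'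
  proof -
    have C: "evd (\<lambda>x. C * G x) (\<lambda>x. C * G' x)" by (rule evd_cmult[OF G(1)])
    have le': "\<forall>\<^sub>F x in F. \<bar>H' x\<bar> \<le> C * G' x"
      using le G(3) by eventually_elim simp
    \<comment> \<open>\<open>C * G + H\<close> and \<open>C * G - H\<close> both increase to 0, so
      both are nonpositive; with G <= 0 this is the claim.\<close>
    have "\<forall>\<^sub>F x in F. C * G x + H x \<le> 0"
    proof (rule ev_incr_lim_upper)
      show "ev_incr (\<lambda>x. C * G x + H x)"
        by (rule evd_ev_incr[OF evd_add[OF C H(1)]]) (use le' in eventually_elim, linarith)
      show "((\<lambda>x. C * G x + H x) \<longlongrightarrow> 0) F"
        using tendsto_add[OF tendsto_mult_right_zero[OF G(2)] H(2)] by simp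
    qed
    moreover have "\<forall>\<^sub>F x in F. C * G x + - H x \<le> 0"
    proof (rule ev_incr_lim_upper)
      show "ev_incr (\<lambda>x. C * G x + - H x)"
        by (rule evd_ev_incr[OF evd_add[OF C evd_minus[OF H(1)]]]) (use le' in eventually_elim, linarith)
      show "((\<lambda>x. C * G x + - H x) \<longlongrightarrow> 0) F"
        using tendsto_add[OF tendsto_mult_right_zero[OF G(2)] tendsto_minus[OF H(2)]] by simp
    qed
    moreover have "\<forall>\<^sub>F x in F. G x \<le> 0"
      by (rule ev_incr_lim_upper[OF evd_ev_incr[OF G(1,3)] G(2)])
    ultimately show ?thesis by eventually_elim auto
  qed
  consider "\<forall>\<^sub>F x in F. G' x \<ge> 0" | "\<forall>\<^sub>F x in F. G' x \<le> 0" using G(3) one_signed_def by blast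
  then show ?thesis
  proof cases
    case 1
    then show ?thesis using main G le by blast
  next
    case 2
    then show ?thesis
      using main[of "\<lambda>x. - G x" "\<lambda>x. - G' x"] evd_minus[OF G(1)] tendsto_minus[OF G(2)] le by simp
  qed
qed

lemma compare_diverging:
  assumes C: "C \<ge> 0" and G: "evd G G'" "one_signed G'"
    and H: "evd H H'" "filterlim (\<lambda>x. \<bar>H x\<bar>) at_top F"
    and le: "\<forall>\<^sub>F x in F. \<bar>H' x\<bar> \<le> C * \<bar>G' x\<bar>"
  shows "\<forall>\<^sub>F x in F. \<bar>H x\<bar> \<le> 2 * C * \<bar>G x\<bar>"
proof -
  have main: "\<forall>\<^sub>F x in F. \<bar>H x\<bar> \<le> 2 * C * \<bar>G x\<bar>"
    if G: "evd G G'" "\<forall>\<^sub>F x in F. G' x \<ge> 0" and le: "\<forall>\<^sub>F x in F. \<bar>H' x\<bar> \<le> C * \<bar>G' x\<bar>" for G G'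
  proof -
    have CG: "evd (\<lambda>x. C * G x) (\<lambda>x. C * G' x)" by (rule evd_cmult[OF G(1)])
    have le': "\<forall>\<^sub>F x in F. \<bar>H' x\<bar> \<le> C * G' x"
      using le G(2) by eventually_elim simp
    have "ev_incr (\<lambda>x. C * G x + H x)"
      by (rule evd_ev_incr[OF evd_add[OF CG H(1)]]) (use le' in eventually_elim, linarith)
    then obtain t1 where t1: "t1 \<in> S" "\<And>x y. x \<in> S \<Longrightarrow> y \<in> S \<Longrightarrow> t1 \<le> x \<Longrightarrow> x \<le> y \<Longrightarrow> C * G x + H x \<le> C * G y + H y"
      unfolding ev_incr_def by blast
    have "ev_incr (\<lambda>x. C * G x + - H x)"
      by (rule evd_ev_incr[OF evd_add[OF CG evd_minus[OF H(1)]]]) (use le' in eventually_elim, linarith)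
    then obtain t2 where t2: "t2 \<in> S" "\<And>x y. x \<in> S \<Longrightarrow> y \<in> S \<Longrightarrow> t2 \<le> x \<Longrightarrow> x \<le> y \<Longrightarrow> C * G x + - H x \<le> C * G y + - H y"
      unfolding ev_incr_def by blast
    \<comment> \<open>The values at the starting points act as constants of integration. Divergence
      of \<open>H\<close> lets half of its modulus absorb them, which costs the factor 2.\<close>
    define K where "K = \<bar>C * G t1 + H t1\<bar> + \<bar>C * G t2 + - H t2\<bar>"
    have "- K \<le> C * G x + H x" if "x \<in> S" "t1 \<le> x" for x
      using t1(2)[OF t1(1) that(1) order_refl that(2)] unfolding K_def by linarith
    then have "\<forall>\<^sub>F x in F. - K \<le> C * G x + H x"
      unfolding eventually_F using t1(1) by blast
    moreover have "- K \<le> C * G x + - H x" if "x \<in> S" "t2 \<le> x" for x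
      using t2(2)[OF t2(1) that(1) order_refl that(2)] unfolding K_def by linarith
    then have "\<forall>\<^sub>F x in F. - K \<le> C * G x + - H x"
      unfolding eventually_F using t2(1) by blast
    moreover have "\<forall>\<^sub>F x in F. 2 * K \<le> \<bar>H x\<bar>" using H(2) unfolding filterlim_at_top by blast
    ultimately show ?thesis
    proof eventually_elim
      case (elim x)
      have "2 * (C * G x) \<le> 2 * (C * \<bar>G x\<bar>)" using C by (intro mult_left_mono) auto
      with elim show ?case by linarith
    qed
  qed
  consider "\<forall>\<^sub>F x in F. G' x \<ge> 0" | "\<forall>\<^sub>F x in F. G' x \<le> 0" using G(2) one_signed_def by blast
  then show ?thesis
  proof cases
    case 1
    then show ?thesis using main G(1) le by blast
  next
    case 2
    then show ?thesis using main[OF evd_minus[OF G(1)]] le by simp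
  qed
qed

end

section \<open>Wronskians and canonical factorizations\<close>

text \<open>The asymptotic order of the functions is left open on purpose: for the given scale the
  operators \<open>D k\<close> are the M_k, for the reversed scale they are the L_k.\<close>

locale wronski_system = half_open T x0 for T :: real and x0 :: ereal +
  fixes n :: nat and \<psi> :: "nat \<Rightarrow> real \<Rightarrow> real"
  assumes n2: "2 \<le> n"
    and AC: "\<And>i. i \<in> {1..n} \<Longrightarrow> ACk_on (Ico_e T x0) (n - 1) (\<psi> i)"
    and W_nz: "\<And>i x. i \<in> {1..n} \<Longrightarrow> x \<in> Ico_e T x0 \<Longrightarrow> Wf (Ico_e T x0) \<psi> i x \<noteq> 0"
begin

abbreviation W :: "nat \<Rightarrow> real \<Rightarrow> real" where "W \<equiv> Wf S \<psi>"
abbreviation w :: "nat \<Rightarrow> real \<Rightarrow> real" where "w \<equiv> qw S \<psi> n"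
abbreviation D :: "nat \<Rightarrow> (real \<Rightarrow> real) \<Rightarrow> real \<Rightarrow> real" where "D \<equiv> Dop S w"

abbreviation R :: "(real \<Rightarrow> real) \<Rightarrow> (nat \<Rightarrow> real) \<Rightarrow> real \<Rightarrow> real" where
  "R f a \<equiv> \<lambda>x. f x - (\<Sum>j\<in>{1..n}. a j * \<psi> j x)"

text \<open>The Wronskian W(psi_1, ..., psi_k, u); for k = n it is the numerator of
  \<open>Lop\<close>.\<close>

definition V :: "nat \<Rightarrow> (real \<Rightarrow> real) \<Rightarrow> real \<Rightarrow> real" where
  "V k u x = ndet (Suc k) (\<lambda>r c. hderiv S r (if c < k then \<psi> (Suc c) else u) x)"

lemma W_ndet: "W i x = ndet i (\<lambda>r c. hderiv S r (\<psi> (Suc c)) x)"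
  by (simp add: Wf_def wronskian_def)

lemma Lop_V: "Lop S \<psi> n u x = V n u x / W n x"
  by (simp add: Lop_def V_def wronskian_def)

lemma W_0 [simp]: "W 0 x = 1"
  by (simp add: W_ndet)

lemma W_1: "W 1 x = \<psi> 1 x"
  by (simp add: W_ndet ndet_1[unfolded One_nat_def])

lemma W_nz': "i \<le> n \<Longrightarrow> x \<in> S \<Longrightarrow> W i x \<noteq> 0"
  using W_nz[of i x] by (cases i) auto

lemma Ck: "i \<in> {1..n} \<Longrightarrow> Ck_on S (n - 1) (\<psi> i)"
  by (rule ACk_imp_Ck[OF AC])

lemma V_eq_0: "1 \<le> j \<Longrightarrow> j \<le> k \<Longrightarrow> V k (\<psi> j) x = 0"
  unfolding V_def by (rule ndet_identical_columns[of "j - 1" _ k]) auto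

lemma V_eq_W: "V k (\<psi> (Suc k)) x = W (Suc k) x"
  unfolding V_def W_ndet by (rule ndet_cong) (auto simp: less_Suc_eq)

lemma continuous_on_W: "i \<le> n \<Longrightarrow> continuous_on S (W i)"
  unfolding W_ndet by (rule continuous_on_ndet) (auto intro!: Ck_on_continuous[OF Ck])

text \<open>The constant sign of \<open>W i\<close> on \<open>S\<close>. The absolute values in the
  weights contribute only such signs, which can be moved out of derivatives.\<close>

definition \<sigma> :: "nat \<Rightarrow> real" where "\<sigma> i = sgn (W i T)"

lemma \<sigma>_sq: "i \<le> n \<Longrightarrow> \<sigma> i * \<sigma> i = 1"
  using W_nz'[OF _ T_S] by (auto simp: \<sigma>_def sgn_if)

lemma \<sigma>_0 [simp]: "\<sigma> 0 = 1"
  by (simp add: \<sigma>_def)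

text \<open>A continuous function without zeros keeps its sign on the connected set
  \<open>S\<close>.\<close>

lemma abs_W: assumes i: "i \<le> n" and x: "x \<in> S" shows "\<bar>W i x\<bar> = \<sigma> i * W i x"
proof -
  have "sgn (W i x) = sgn (W i T)"
  proof (rule ccontr)
    assume "sgn (W i x) \<noteq> sgn (W i T)"
    then have *: "W i x < 0 \<and> W i T > 0 \<or> W i x > 0 \<and> W i T < 0"
      using W_nz'[OF i x] W_nz'[OF i T_S] by (auto simp: sgn_if split: if_splits)
    have "connected (W i ` S)"
      by (rule connected_continuous_image[OF continuous_on_W[OF i] connected_Ico_e])
    moreover have "W i x \<in> W i ` S" "W i T \<in> W i ` S" using x T_S by auto
    ultimately have "0 \<in> W i ` S" using * unfolding connected_iff_interval by (meson less_imp_le)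
    then show False using W_nz'[OF i] by auto
  qed
  then show ?thesis by (simp add: \<sigma>_def mult.commute abs_sgn)
qed

text \<open>The numerator in the quotient rule is made of four bordered minors of the Wronskian
  matrix of psi_1, ..., psi_(k+1), u, and the Desnanot-Jacobi identity evaluates it.
  Differentiability is asked for at the single point x, so that k = n - 1 can be treated almost
  everywhere.\<close>

lemma V_quotient_deriv:
  assumes k: "k < n" and x: "x \<in> S"
    and \<psi>: "\<And>r j. r \<le> k \<Longrightarrow> j \<in> {1..Suc k} \<Longrightarrow>
      (hderiv S r (\<psi> j) has_real_derivative hderiv S (Suc r) (\<psi> j) x) (at x within S)"
    and u: "\<And>r. r \<le> k \<Longrightarrow> (hderiv S r u has_real_derivative hderiv S (Suc r) u x) (at x within S)"
  shows "((\<lambda>x. V k u x / W (Suc k) x) has_real_derivative W k x * V (Suc k) u x / (W (Suc k) x)\<^sup>2) (at x within S)"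
proof -
  define A where "A r c = hderiv S r (if c < Suc k then \<psi> (Suc c) else u)" for r c
  have dA: "(A r c has_real_derivative A (Suc r) c x) (at x within S)" if "r \<le> k" for r c
    using \<psi>[OF that, of "Suc c"] u[OF that] by (auto simp: A_def)
  \<comment> \<open>Column c = k gives \<open>W (Suc k)\<close> and c = k + 1 gives
    \<open>V k u\<close>; replacing the last row r = k by r = k + 1 differentiates the
    minor.\<close>
  define b where "b r c = ndet (Suc k) (\<lambda>i j. A (if i = k then r else i) (if j = k then c else j) x)" for r c
  have Wk: "ndet k (\<lambda>r c. A r c x) = W k x" unfolding W_ndet A_def by (rule ndet_cong) auto
  have "b k k * b (Suc k) (Suc k) - b k (Suc k) * b (Suc k) k = W k x * V (Suc k) u x"
    using desnanot_jacobi_corner[of k "\<lambda>r c. A r c x"] W_nz'[of k x] k x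
    unfolding Wk b_def V_def by (simp add: A_def)
  moreover have bkk: "b k k = W (Suc k) x"
    unfolding b_def W_ndet A_def by (rule ndet_cong) auto
  moreover have bkk1: "b k (Suc k) = V k u x"
    unfolding b_def V_def A_def by (rule ndet_cong) auto
  moreover have "(W (Suc k) has_real_derivative b (Suc k) k) (at x within S)"
  proof -
    have "((\<lambda>y. ndet (Suc k) (\<lambda>r c. A r c y)) has_real_derivative
        ndet (Suc k) (\<lambda>r c. A (if r = Suc k - 1 then Suc k else r) c x)) (at x within S)"
      by (rule ndet_has_derivative) (use dA in auto)
    moreover have "(\<lambda>y. ndet (Suc k) (\<lambda>r c. A r c y)) = W (Suc k)"
      unfolding W_ndet A_def by (rule ext, rule ndet_cong) auto
    moreover have "ndet (Suc k) (\<lambda>r c. A (if r = Suc k - 1 then Suc k else r) c x) = b (Suc k) k"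
      unfolding b_def by (rule ndet_cong) auto
    ultimately show ?thesis by simp
  qed
  moreover have "(V k u has_real_derivative b (Suc k) (Suc k)) (at x within S)"
  proof -
    define A' where "A' r c = A r (if c = k then Suc k else c)" for r c
    have "((\<lambda>y. ndet (Suc k) (\<lambda>r c. A' r c y)) has_real_derivative
        ndet (Suc k) (\<lambda>r c. A' (if r = Suc k - 1 then Suc k else r) c x)) (at x within S)"
      by (rule ndet_has_derivative) (use dA in \<open>auto simp: A'_def\<close>)
    moreover have "(\<lambda>y. ndet (Suc k) (\<lambda>r c. A' r c y)) = V k u"
      unfolding V_def A_def A'_def by (rule ext, rule ndet_cong) auto
    moreover have "ndet (Suc k) (\<lambda>r c. A' (if r = Suc k - 1 then Suc k else r) c x) = b (Suc k) (Suc k)"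
      unfolding b_def A'_def by (rule ndet_cong) auto
    ultimately show ?thesis by simp
  qed
  ultimately show ?thesis
    using DERIV_divide[of "V k u" "b (Suc k) (Suc k)" x S "W (Suc k)" "b (Suc k) k"] W_nz'[of "Suc k" x] k x
    by (simp add: power2_eq_square algebra_simps)
qed

lemma w_pos: "k \<le> n \<Longrightarrow> x \<in> S \<Longrightarrow> w k x > 0"
  using W_nz'[of k x] W_nz'[of "k - 1" x] W_nz'[of "Suc k" x] W_nz'[of 1 x] n2 W_1
  unfolding qw_def by (auto simp: zero_less_divide_iff)

lemma w_mid: "1 \<le> k \<Longrightarrow> k < n \<Longrightarrow> w k x = (W k x)\<^sup>2 / (\<bar>W (k - 1) x\<bar> * \<bar>W (Suc k) x\<bar>)"
  by (simp add: qw_def abs_mult)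

text \<open>The sign left over from the absolute values in the weights; it is the constant value of
  \<open>D k (\<psi> (Suc k))\<close>.\<close>

definition \<kappa> :: "nat \<Rightarrow> real" where "\<kappa> k = \<sigma> k * \<sigma> (Suc k)"

lemma abs_\<kappa>: "k < n \<Longrightarrow> \<bar>\<kappa> k\<bar> = 1"
  using W_nz'[OF _ T_S, of k] W_nz'[OF _ T_S, of "Suc k"] by (auto simp: \<kappa>_def \<sigma>_def sgn_if)

lemma V_quotient_deriv_Ck:
  assumes u: "Ck_on S (n - 1) u" and k: "Suc k < n" and x: "x \<in> S"
  shows "((\<lambda>x. V k u x / W (Suc k) x) has_real_derivative W k x * V (Suc k) u x / (W (Suc k) x)\<^sup>2) (at x within S)"
  by (rule V_quotient_deriv) (use k x in \<open>auto intro!: Ck_on_deriv[OF u] Ck_on_deriv[OF Ck]\<close>)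

text \<open>The derivative of the quotient at level k is W_k V_(k+1) / W_(k+1)^2. The weight
  \<open>w (Suc k)\<close> cancels W_k and the square up to sign and supplies the denominator
  W_(k+2), which is the same formula at level k + 1.\<close>

lemma D_eq_V:
  assumes u: "Ck_on S (n - 1) u"
  shows "k < n \<Longrightarrow> x \<in> S \<Longrightarrow> D k u x = \<kappa> k * (V k u x / W (Suc k) x)"
proof (induction k arbitrary: x)
  case 0
  have "V 0 u x = u x" by (simp add: V_def ndet_1[unfolded One_nat_def])
  moreover have p: "\<bar>\<psi> 1 x\<bar> = \<sigma> 1 * \<psi> 1 x" using abs_W[of 1 x] 0 n2 by (simp only: W_1)
  moreover have "1 / \<sigma> 1 = \<sigma> 1"
    using \<sigma>_sq[of 1] n2 by (simp add: divide_eq_eq)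
  moreover have "D 0 u x = (1 / \<sigma> 1) * (u x / \<psi> 1 x)"
    using p by (simp add: qw_def)
  ultimately show ?case by (simp add: \<kappa>_def W_1[unfolded One_nat_def])
next
  case (Suc k)
  have "((\<lambda>x. \<kappa> k * (V k u x / W (Suc k) x)) has_real_derivative
      \<kappa> k * (W k x * V (Suc k) u x / (W (Suc k) x)\<^sup>2)) (at x within S)"
    by (rule DERIV_cmult[OF V_quotient_deriv_Ck[OF u Suc.prems]])
  then have "(D k u has_real_derivative \<kappa> k * (W k x * V (Suc k) u x / (W (Suc k) x)\<^sup>2)) (at x within S)"
    by (rule has_field_derivative_transform_on) (use Suc in auto)
  then have "vector_derivative (D k u) (at x within S) = \<kappa> k * (W k x * V (Suc k) u x / (W (Suc k) x)\<^sup>2)"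
    by (rule vector_derivative_Ico_e[OF Suc.prems(2)])
  then have "D (Suc k) u x = w (Suc k) x * (\<kappa> k * (W k x * V (Suc k) u x / (W (Suc k) x)\<^sup>2))"
    by simp
  also have "\<dots> = \<kappa> k * W k x * V (Suc k) u x / (\<bar>W k x\<bar> * \<bar>W (Suc (Suc k)) x\<bar>)"
    using Suc.prems W_nz'[of "Suc k" x] by (simp add: w_mid)
  also have "\<dots> = \<kappa> (Suc k) * (V (Suc k) u x / W (Suc (Suc k)) x)"
  proof -
    have e: "\<bar>W k x\<bar> = \<sigma> k * W k x" "\<bar>W (Suc (Suc k)) x\<bar> = \<sigma> (Suc (Suc k)) * W (Suc (Suc k)) x"
      using Suc.prems by (simp_all add: abs_W)
    have s: "\<sigma> k * \<sigma> k = 1" "\<sigma> (Suc (Suc k)) * \<sigma> (Suc (Suc k)) = 1" "W k x \<noteq> 0" "W (Suc (Suc k)) x \<noteq> 0"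
      using Suc.prems by (simp_all add: \<sigma>_sq W_nz')
    then have "\<sigma> k \<noteq> 0" "\<sigma> (Suc (Suc k)) \<noteq> 0" by auto
    then show ?thesis unfolding e \<kappa>_def using s by (simp add: field_simps)
  qed
  finally show ?case .
qed

lemma D_deriv:
  assumes u: "Ck_on S (n - 1) u" and k: "Suc k < n" and x: "x \<in> S"
  shows "(D k u has_real_derivative D (Suc k) u x / w (Suc k) x) (at x within S)"
proof -
  have "((\<lambda>x. \<kappa> k * (V k u x / W (Suc k) x)) has_real_derivative
      \<kappa> k * (W k x * V (Suc k) u x / (W (Suc k) x)\<^sup>2)) (at x within S)" (is "(_ has_real_derivative ?d) _")
    by (rule DERIV_cmult[OF V_quotient_deriv_Ck[OF u k x]])
  then have d: "(D k u has_real_derivative ?d) (at x within S)"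
    by (rule has_field_derivative_transform_on) (use D_eq_V[OF u] k x in auto)
  moreover have "D (Suc k) u x = w (Suc k) x * ?d"
    using vector_derivative_Ico_e[OF x d] by simp
  ultimately show ?thesis using w_pos[of "Suc k" x] k x by simp
qed

lemma D_cong_lincomb:
  assumes f: "Ck_on S (n - 1) f" and g: "Ck_on S (n - 1) g"
  shows "k < n \<Longrightarrow> x \<in> S \<Longrightarrow> D k (\<lambda>x. f x + c * g x) x = D k f x + c * D k g x"
proof (induction k arbitrary: x)
  case (Suc k)
  have "((\<lambda>x. D k f x + c * D k g x) has_real_derivative
      D (Suc k) f x / w (Suc k) x + c * (D (Suc k) g x / w (Suc k) x)) (at x within S)"
    using Suc.prems by (intro DERIV_add DERIV_cmult D_deriv f g)
  then have "(D k (\<lambda>x. f x + c * g x) has_real_derivative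
      D (Suc k) f x / w (Suc k) x + c * (D (Suc k) g x / w (Suc k) x)) (at x within S)"
    by (rule has_field_derivative_transform_on) (use Suc in auto)
  from vector_derivative_Ico_e[OF Suc.prems(2) this] show ?case
    using w_pos[of "Suc k" x] Suc.prems by (simp add: field_simps)
qed (simp add: algebra_simps)

lemma D_\<psi>_0: "1 \<le> j \<Longrightarrow> j \<le> k \<Longrightarrow> k < n \<Longrightarrow> x \<in> S \<Longrightarrow> D k (\<psi> j) x = 0"
  by (simp add: D_eq_V[OF Ck] V_eq_0)

lemma D_\<psi>_Suc: "k < n \<Longrightarrow> x \<in> S \<Longrightarrow> D k (\<psi> (Suc k)) x = \<kappa> k"
  by (simp add: D_eq_V[OF Ck] V_eq_W W_nz')

lemma Ck_on_sum_\<psi>: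
  assumes "Ck_on S (n - 1) f" "J \<subseteq> {1..n}"
  shows "Ck_on S (n - 1) (\<lambda>x. f x - (\<Sum>j\<in>J. a j * \<psi> j x))"
proof -
  have "finite J" using assms(2) finite_subset by blast
  then show ?thesis using assms(2)
  proof (induction J)
    case (insert j J)
    then have "Ck_on S (n - 1) (\<lambda>x. (f x - (\<Sum>j\<in>J. a j * \<psi> j x)) + (- a j) * \<psi> j x)"
      by (intro Ck_on_lincomb Ck) auto
    then show ?case using insert by (simp add: algebra_simps)
  qed (use assms in simp)
qed

lemma D_sum_\<psi>:
  assumes "Ck_on S (n - 1) f" "J \<subseteq> {1..n}" "k < n" "x \<in> S"
  shows "D k (\<lambda>x. f x - (\<Sum>j\<in>J. a j * \<psi> j x)) x = D k f x - (\<Sum>j\<in>J. a j * D k (\<psi> j) x)"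
proof -
  have "finite J" using assms(2) finite_subset by blast
  then show ?thesis using assms(2)
  proof (induction J)
    case (insert j J)
    then have "D k (\<lambda>x. (f x - (\<Sum>j\<in>J. a j * \<psi> j x)) + (- a j) * \<psi> j x) x
        = (D k f x - (\<Sum>j\<in>J. a j * D k (\<psi> j) x)) + (- a j) * D k (\<psi> j) x"
      using assms by (subst D_cong_lincomb[OF Ck_on_sum_\<psi> Ck]) auto
    then show ?case using insert by (simp add: algebra_simps)
  qed simp
qed

text \<open>\<open>D (n - 1) u\<close> arises from derivatives of order at most n - 1 by sums,
  products and division by the nonvanishing \<open>W n\<close>, all of which preserve absolute
  continuity.\<close>

lemma abs_cont_on_D_last:
  assumes u: "ACk_on S (n - 1) u" and xy: "x \<in> S" "y \<in> S" "x \<le> y"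
  shows "abs_cont_on x y (D (n - 1) u)"
proof (rule abs_cont_on_cong)
  have sub: "z \<in> S" if "x \<le> z" "z \<le> y" for z using Ico_e_Icc[OF xy(1,2)] that by auto
  have V: "abs_cont_on x y (V (n - 1) u)"
    unfolding V_def using n2 xy
    by (intro abs_cont_on_ndet) (auto intro!: ACk_on_abs_cont[OF u] ACk_on_abs_cont[OF AC])
  have W: "abs_cont_on x y (W n)"
    unfolding W_ndet using n2 xy
    by (intro abs_cont_on_ndet) (auto intro!: ACk_on_abs_cont[OF AC])
  show "abs_cont_on x y (\<lambda>z. \<kappa> (n - 1) * (V (n - 1) u z * inverse (W n z)))"
    by (intro abs_cont_on_mult abs_cont_on_const V abs_cont_on_inverse W W_nz') (auto intro: sub)
  show "\<kappa> (n - 1) * (V (n - 1) u z * inverse (W n z)) = D (n - 1) u z" if "x \<le> z" "z \<le> y" for z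
    using D_eq_V[OF ACk_imp_Ck[OF u], of "n - 1" z] sub[OF that] n2
    by (simp add: divide_inverse)
qed

text \<open>The last step of the factorization holds where the derivatives of order n - 1 are
  differentiable. Absolute continuity makes the exceptional set null and allows integrating across
  it.\<close>

lemma D_last_has_integral:
  assumes u: "ACk_on S (n - 1) u" and xy: "x \<in> S" "y \<in> S" "x \<le> y"
  shows "((\<lambda>t. Lop S \<psi> n u t / w n t) has_integral D (n - 1) u y - D (n - 1) u x) {x..y}"
proof -
  have sub: "{x..y} \<subseteq> S" using Ico_e_Icc[OF xy(1,2)] .
  define nd where "nd g = {z \<in> {x<..<y}. \<not> (\<exists>l. (g has_real_derivative l) (at z))}" for g :: "real \<Rightarrow> real"
  \<comment> \<open>Two-sided differentiability is considered in the open interval only, so the end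
    points join the exceptional set.\<close>
  define N where "N = {x, y} \<union> (nd (hderiv S (n - 1) u) \<union> (\<Union>j\<in>{1..n}. nd (hderiv S (n - 1) (\<psi> j))))"
  have nd: "negligible (nd (hderiv S (n - 1) g))" if "ACk_on S (n - 1) g" for g
    unfolding nd_def using that xy by (intro abs_cont_on_differentiable_ae ACk_on_abs_cont) auto
  have "negligible N"
    unfolding N_def by (intro negligible_Un negligible_Union) (auto intro!: nd[unfolded One_nat_def] u[unfolded One_nat_def] AC[unfolded One_nat_def])
  have good: "(hderiv S r g has_real_derivative hderiv S (Suc r) g z) (at z within S)"
    if z: "z \<in> {x..y} - N" and g: "ACk_on S (n - 1) g" "nd (hderiv S (n - 1) g) \<subseteq> N" and r: "r \<le> n - 1" for g z r
  proof (cases "r = n - 1")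
    case True
    have "z \<in> {x<..<y}" using z by (auto simp: N_def less_le)
    then obtain l where "(hderiv S (n - 1) g has_real_derivative l) (at z)"
      using z g(2) by (auto simp: nd_def)
    then have l: "(hderiv S r g has_real_derivative l) (at z within S)"
      using True has_field_derivative_at_within by blast
    moreover have "z \<in> S" using z sub by auto
    ultimately have "hderiv S (Suc r) g z = l" unfolding hderiv_Suc by (intro vector_derivative_Ico_e)
    with l show ?thesis by simp
  next
    case False
    then show ?thesis using Ck_on_deriv[OF ACk_imp_Ck[OF g(1)], of r z] z sub r by auto
  qed
  show ?thesis
  proof (rule abs_cont_on_FTC[OF xy(3) abs_cont_on_D_last[OF u xy] \<open>negligible N\<close>])
    fix z assume z: "z \<in> {x..y} - N"
    then have zS: "z \<in> S" using sub by auto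
    have q: "((\<lambda>x. V (n - 1) u x / W (Suc (n - 1)) x) has_real_derivative
        W (n - 1) z * V (Suc (n - 1)) u z / (W (Suc (n - 1)) z)\<^sup>2) (at z within S)"
    proof (rule V_quotient_deriv)
      show "(hderiv S r (\<psi> j) has_real_derivative hderiv S (Suc r) (\<psi> j) z) (at z within S)"
        if "r \<le> n - 1" "j \<in> {1..Suc (n - 1)}" for r j
        by (rule good[OF z AC]) (use that n2 in \<open>auto simp: N_def\<close>)
      show "(hderiv S r u has_real_derivative hderiv S (Suc r) u z) (at z within S)"
        if "r \<le> n - 1" for r
        by (rule good[OF z u]) (use that in \<open>auto simp: N_def\<close>)
    qed (use n2 zS in auto)
    have "((\<lambda>x. \<kappa> (n - 1) * (V (n - 1) u x / W (Suc (n - 1)) x)) has_real_derivative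
        \<kappa> (n - 1) * (W (n - 1) z * V (Suc (n - 1)) u z / (W (Suc (n - 1)) z)\<^sup>2)) (at z within S)"
      by (rule DERIV_cmult[OF q])
    then have "(D (n - 1) u has_real_derivative
        \<kappa> (n - 1) * (W (n - 1) z * V (Suc (n - 1)) u z / (W (Suc (n - 1)) z)\<^sup>2)) (at z within S)"
      by (rule has_field_derivative_transform_on) (use D_eq_V[OF ACk_imp_Ck[OF u]] n2 zS in auto)
    moreover have "\<kappa> (n - 1) * (W (n - 1) z * V (Suc (n - 1)) u z / (W (Suc (n - 1)) z)\<^sup>2) = Lop S \<psi> n u z / w n z"
    proof -
      have w: "w n z = (\<sigma> n * W n z) / (\<sigma> (n - 1) * W (n - 1) z)"
        using zS n2 abs_W[of n z] abs_W[of "n - 1" z] by (simp add: qw_def)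
      have s: "\<sigma> n * \<sigma> n = 1" "\<sigma> (n - 1) * \<sigma> (n - 1) = 1" "W n z \<noteq> 0" "W (n - 1) z \<noteq> 0"
        using zS by (simp_all add: \<sigma>_sq W_nz')
      then have s0: "\<sigma> n \<noteq> 0" "\<sigma> (n - 1) \<noteq> 0" by auto
      have n': "Suc (n - 1) = n" using n2 by simp
      show ?thesis unfolding Lop_V w \<kappa>_def n' using s s0 by (simp add: field_simps power2_eq_square)
    qed
    ultimately show "(D (n - 1) u has_real_derivative Lop S \<psi> n u z / w n z) (at z within {x..y})"
      using has_field_derivative_subset[OF _ sub] by simp
  qed
qed

text \<open>\<open>Lop\<close> is nonnegative only almost everywhere. The truncated integrand is
  nonnegative everywhere and matches the truncation that \<open>ennreal\<close> performs inside
  \<open>nint\<close>.\<close>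

lemma D_last_has_integral_max:
  assumes u: "ACk_on S (n - 1) u" and xy: "x \<in> S" "y \<in> S" "x \<le> y"
    and nn: "AE t in lborel. t \<in> S \<longrightarrow> Lop S \<psi> n u t \<ge> 0"
  shows "((\<lambda>t. max 0 (Lop S \<psi> n u t / w n t)) has_integral D (n - 1) u y - D (n - 1) u x) {x..y}"
proof -
  have sub: "{x..y} \<subseteq> S" using Ico_e_Icc[OF xy(1,2)] .
  obtain N where N: "{t. \<not> (t \<in> S \<longrightarrow> Lop S \<psi> n u t \<ge> 0)} \<subseteq> N" "N \<in> null_sets lborel"
    using nn by (auto simp: eventually_ae_filter)
  have "negligible N"
    using N(2) by (simp add: negligible_iff_null_sets null_sets_completionI)
  then show ?thesis
  proof (rule has_integral_spike[OF _ _ D_last_has_integral[OF u xy]])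
    fix t assume t: "t \<in> {x..y} - N"
    then have "Lop S \<psi> n u t \<ge> 0" "t \<in> S" using N sub by auto
    moreover have "w n t > 0" using w_pos \<open>t \<in> S\<close> by simp
    ultimately show "max 0 (Lop S \<psi> n u t / w n t) = Lop S \<psi> n u t / w n t" by simp
  qed
qed

end

section \<open>Nested integrals and asymptotic expansions\<close>

context half_open
begin

text \<open>An integral identity in place of a derivative: it covers the top operator, which is
  differentiable only almost everywhere, together with the lower ones.\<close>

definition accumulates :: "(real \<Rightarrow> real) \<Rightarrow> (real \<Rightarrow> real) \<Rightarrow> bool" where
  "accumulates h G \<longleftrightarrow> (\<forall>t\<in>S. h t \<ge> 0) \<and>
     (\<forall>x\<in>S. \<forall>y\<in>S. x \<le> y \<longrightarrow> (h has_integral G y - G x) {x..y})"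

lemma accum_props:
  assumes hG: "accumulates h G"
    and xy: "x \<in> S" "y \<in> S" "x \<le> y"
  shows "(\<integral>\<^sup>+ t. indicator {x..y} t * ennreal (h t) \<partial>lborel) = ennreal (G y - G x)"
    and "(\<lambda>t. indicator {x..y} t * ennreal (h t)) \<in> borel_measurable lebesgue"
    and "G x \<le> G y"
proof -
  have sub: "{x..y} \<subseteq> S" using Ico_e_Icc[OF xy(1,2)] .
  then have nn: "\<And>t. t \<in> {x..y} \<Longrightarrow> h t \<ge> 0" using hG unfolding accumulates_def by blast
  have I: "(h has_integral G y - G x) {x..y}" using hG xy by (simp add: accumulates_def)
  show "(\<integral>\<^sup>+ t. indicator {x..y} t * ennreal (h t) \<partial>lborel) = ennreal (G y - G x)"
    using nn_integral_has_integral_lebesgue'[OF nn I] by (simp add: mult.commute)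
  have "(\<lambda>t. indicator {x..y} t *\<^sub>R h t) \<in> lebesgue \<rightarrow>\<^sub>M borel"
    by (rule has_integral_implies_lebesgue_measurable[OF I])
  then have "(\<lambda>t. ennreal (indicator {x..y} t *\<^sub>R h t)) \<in> lebesgue \<rightarrow>\<^sub>M borel" by measurable
  also have "(\<lambda>t. ennreal (indicator {x..y} t *\<^sub>R h t)) = (\<lambda>t. indicator {x..y} t * ennreal (h t))"
    by (auto simp: indicator_def)
  finally show "(\<lambda>t. indicator {x..y} t * ennreal (h t)) \<in> borel_measurable lebesgue" .
  show "G x \<le> G y" using has_integral_nonneg[OF I nn] by simp
qed

abbreviation tail_integral :: "(real \<Rightarrow> real) \<Rightarrow> real \<Rightarrow> ennreal" where
  "tail_integral h s \<equiv> \<integral>\<^sup>+ t. indicator (Ico_e s x0) t * ennreal (h t) \<partial>lborel"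

text \<open>Monotone convergence along a cofinal sequence. \<open>h\<close> is known to be
  measurable only in the Lebesgue sense, so the limit is taken in \<open>lebesgue\<close> and
  carried to \<open>lborel\<close> by \<open>nn_integral_completion\<close>.\<close>

lemma accum_limit:
  assumes hG: "accumulates h G"
    and s: "s \<in> S" and lim: "(G \<longlongrightarrow> c) F"
  shows "tail_integral h s = ennreal (c - G s)"
    and "G s \<le> c"
proof -
  note A = accum_props[OF hG]
  obtain y where y: "\<And>k::nat. y k \<in> S" "\<And>k. s \<le> y k" "incseq y" "\<And>x. x \<in> S \<Longrightarrow> \<exists>k. x \<le> y k"
    using cofinal_seq[OF s] by blast
  define f where "f k t = indicator {s..y k} t * ennreal (h t)" for k t
  have "filterlim y F sequentially"
    unfolding filterlim_iff
  proof (intro allI impI)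
    fix P assume "eventually P F"
    then obtain t where t: "t \<in> S" "\<And>x. x \<in> S \<Longrightarrow> t \<le> x \<Longrightarrow> P x" unfolding eventually_F by blast
    obtain k where k: "t \<le> y k" using y(4)[OF t(1)] by blast
    have "P (y j)" if "k \<le> j" for j
      using t(2)[OF y(1)[of j]] k incseqD[OF y(3) that] by auto
    then show "\<forall>\<^sub>F j in sequentially. P (y j)" unfolding eventually_sequentially by blast
  qed
  then have "(\<lambda>k. G (y k)) \<longlonglongrightarrow> c" by (rule filterlim_compose[OF lim])
  then have l1: "(\<lambda>k. ennreal (G (y k) - G s)) \<longlonglongrightarrow> ennreal (c - G s)"
    by (intro tendsto_ennrealI tendsto_intros)
  have "(\<lambda>k. integral\<^sup>N lebesgue (f k)) \<longlonglongrightarrow> integral\<^sup>N lebesgue (\<lambda>t. indicator (Ico_e s x0) t * ennreal (h t))"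
  proof (rule nn_integral_LIMSEQ)
    show "incseq f" using y(3) by (auto simp: incseq_def le_fun_def f_def indicator_def intro: order_trans)
    show "f k \<in> borel_measurable lebesgue" for k
      unfolding f_def by (rule A(2)[OF s y(1) y(2)])
    show "(\<lambda>k. f k t) \<longlonglongrightarrow> indicator (Ico_e s x0) t * ennreal (h t)" for t
    proof (cases "t \<in> Ico_e s x0")
      case True
      then have "t \<in> S" "s \<le> t" using s by (auto simp: Ico_e_def)
      then obtain k where k: "t \<le> y k" using y(4) by blast
      have "f j t = ennreal (h t)" if "k \<le> j" for j
        using k incseqD[OF y(3) that] \<open>s \<le> t\<close> by (simp add: f_def)
      then show ?thesis using True
        by (intro tendsto_eventually) (auto simp: eventually_sequentially)
    next
      case False
      have "t \<notin> {s..y k}" for k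
      proof
        assume t: "t \<in> {s..y k}"
        have "ereal t \<le> ereal (y k)" using t by simp
        also have "ereal (y k) < x0" using y(1)[of k] by (simp add: Ico_e_def)
        finally show False using False t by (simp add: Ico_e_def)
      qed
      then show ?thesis using False by (simp add: f_def)
    qed
  qed
  moreover have "integral\<^sup>N lebesgue (f k) = ennreal (G (y k) - G s)" for k
    using A(1)[OF s y(1) y(2)] by (simp add: nn_integral_completion f_def[abs_def])
  ultimately show "tail_integral h s = ennreal (c - G s)"
    using LIMSEQ_unique[OF l1] by (simp add: nn_integral_completion)
  have "\<forall>\<^sub>F x in F. G s \<le> G x"
    unfolding eventually_F using A(3)[OF s] s by blast
  then show "G s \<le> c" using tendsto_lowerbound[OF lim _ F_nontrivial] by blast
qed

text \<open>\<open>G\<close> increases and, from s on, is bounded by \<open>G s\<close> plus the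
  finite integral.\<close>

lemma accum_finite:
  assumes hG: "accumulates h G"
    and s: "s \<in> S" and fin: "tail_integral h s < \<infinity>"
  shows "\<exists>c. (G \<longlongrightarrow> c) F"
proof -
  note A = accum_props[OF hG]
  obtain B where B: "tail_integral h s = ennreal B" "B \<ge> 0"
    using fin by (cases "tail_integral h s") auto
  have ub: "G y \<le> G s + B" if y: "y \<in> S" "s \<le> y" for y
  proof -
    have "ennreal (G y - G s) = (\<integral>\<^sup>+ t. indicator {s..y} t * ennreal (h t) \<partial>lborel)"
      using A(1)[OF s y] by simp
    also have "\<dots> \<le> ennreal B"
      unfolding B(1)[symmetric] using Ico_e_Icc[OF s y(1)]
      by (intro nn_integral_mono) (auto simp: indicator_def Ico_e_def)
    finally show ?thesis using B(2) by (simp add: ennreal_le_iff)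
  qed
  have "ev_incr G" unfolding ev_incr_def using T_S A(3) by blast
  then show ?thesis
  proof (rule ev_incr_cases)
    assume "filterlim G at_top F"
    then have "\<forall>\<^sub>F x in F. G s + B < G x" by (simp add: filterlim_at_top_dense)
    moreover have "\<forall>\<^sub>F x in F. G x \<le> G s + B" unfolding eventually_F using ub s by blast
    ultimately have "\<forall>\<^sub>F x in F. False" by eventually_elim simp
    then show ?thesis by simp
  qed blast
qed

end

section \<open>Sign, monotonicity and comparison along the chain of operators\<close>

context wronski_system
begin

declare Dop.simps [simp del]

lemma evd_D: "Ck_on S (n - 1) u \<Longrightarrow> Suc k < n \<Longrightarrow> evd (D k u) (\<lambda>x. D (Suc k) u x / w (Suc k) x)"
  unfolding evd_def using D_deriv by blast

lemma eventually_w_pos: "k \<le> n \<Longrightarrow> \<forall>\<^sub>F x in F. w k x > 0"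
  using eventually_S by (rule eventually_mono) (rule w_pos)

lemma one_signed_div_w:
  assumes "one_signed G" "k \<le> n" shows "one_signed (\<lambda>x. G x / w k x)"
proof -
  consider "\<forall>\<^sub>F x in F. G x \<ge> 0" | "\<forall>\<^sub>F x in F. G x \<le> 0" using assms(1) one_signed_def by blast
  then show ?thesis
  proof cases
    case 1
    have "\<forall>\<^sub>F x in F. G x / w k x \<ge> 0"
      using 1 eventually_w_pos[OF assms(2)] by eventually_elim simp
    then show ?thesis by (simp add: one_signed_def)
  next
    case 2
    have "\<forall>\<^sub>F x in F. G x / w k x \<le> 0"
      using 2 eventually_w_pos[OF assms(2)] by eventually_elim (simp add: divide_nonpos_pos)
    then show ?thesis by (simp add: one_signed_def)
  qed
qed

text \<open>One sign of \<open>D (Suc k) u\<close> means monotonicity of \<open>D k u\<close>, and a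
  monotone function is eventually of one sign; the argument repeats downwards from m.\<close>

lemma ev_mono_D:
  assumes u: "Ck_on S (n - 1) u" and m: "m < n" and os: "one_signed (D m u)"
  shows "k < m \<Longrightarrow> ev_mono (D k u)"
proof (induction "m - Suc k" arbitrary: k)
  case 0
  then have "m = Suc k" by simp
  then show ?case using evd_ev_mono[OF evd_D[OF u]] os one_signed_div_w[of "D m u" m] m by simp
next
  case (Suc d)
  then have "ev_mono (D (Suc k) u)" by (intro Suc.hyps(1)) auto
  from one_signed_div_w[OF ev_mono_one_signed[OF this], of "Suc k"] show ?case
    using evd_ev_mono[OF evd_D[OF u]] Suc.prems m by simp
qed

lemma one_signed_D:
  assumes "Ck_on S (n - 1) u" "m < n" "one_signed (D m u)" "k \<le> m"
  shows "one_signed (D k u)"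
  using assms ev_mono_one_signed[OF ev_mono_D[OF assms(1-3)]] by (cases "k = m") auto

lemma one_signed_eventually_eq:
  assumes "\<forall>\<^sub>F x in F. G x = c" shows "one_signed G"
proof (cases "c \<ge> 0")
  case True
  have "\<forall>\<^sub>F x in F. G x \<ge> 0" using assms by eventually_elim (use True in simp)
  then show ?thesis by (simp add: one_signed_def)
next
  case False
  have "\<forall>\<^sub>F x in F. G x \<le> 0" using assms by eventually_elim (use False in simp)
  then show ?thesis by (simp add: one_signed_def)
qed

lemma eventually_D_\<psi>: "k < n \<Longrightarrow> \<forall>\<^sub>F x in F. D k (\<psi> (Suc k)) x = \<kappa> k"
  using eventually_S by (rule eventually_mono) (rule D_\<psi>_Suc)

lemma eventually_abs_D_\<psi>: "k < n \<Longrightarrow> \<forall>\<^sub>F x in F. \<bar>D k (\<psi> (Suc k)) x\<bar> = 1"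
  using eventually_D_\<psi> by (rule eventually_mono) (auto simp: abs_\<kappa>)

lemma one_signed_D_\<psi>:
  assumes "j < n" "k \<le> j" shows "one_signed (D k (\<psi> (Suc j)))"
  using one_signed_D[OF Ck _ one_signed_eventually_eq[OF eventually_D_\<psi>]] assms by simp

lemma ev_mono_D_\<psi>:
  assumes "j < n" "k < j" shows "ev_mono (D k (\<psi> (Suc j)))"
  using ev_mono_D[OF Ck _ one_signed_eventually_eq[OF eventually_D_\<psi>]] assms by simp

lemma D_0_le:
  assumes "\<forall>\<^sub>F x in F. \<bar>D 0 v x\<bar> \<le> C * \<bar>D 0 u x\<bar>"
  shows "\<forall>\<^sub>F x in F. \<bar>v x\<bar> \<le> C * \<bar>u x\<bar>"
  using assms eventually_w_pos[of 0, simplified]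
proof eventually_elim
  case (elim x)
  then have "w 0 x * \<bar>v x\<bar> \<le> w 0 x * (C * \<bar>u x\<bar>)" by (simp add: Dop.simps abs_mult algebra_simps)
  then show ?case using elim by simp
qed

lemma le_div_w:
  assumes "\<forall>\<^sub>F x in F. \<bar>G x\<bar> \<le> C * \<bar>H x\<bar>" "k \<le> n"
  shows "\<forall>\<^sub>F x in F. \<bar>G x / w k x\<bar> \<le> C * \<bar>H x / w k x\<bar>"
  using assms(1) eventually_w_pos[OF assms(2)]
  by eventually_elim (simp add: abs_divide divide_right_mono)

text \<open>Iterated \<open>compare_vanishing\<close>. The constant is the same at every level, so
  an arbitrarily small C at the top becomes a little-o relation at the bottom.\<close>

lemma descend_vanishing:
  assumes u: "Ck_on S (n - 1) u" and v: "Ck_on S (n - 1) v" and m: "m < n"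
    and os: "one_signed (D m u)" and le: "\<forall>\<^sub>F x in F. \<bar>D m v x\<bar> \<le> C * \<bar>D m u x\<bar>"
    and u0: "\<And>i. i < m \<Longrightarrow> (D i u \<longlongrightarrow> 0) F" and v0: "\<And>i. i < m \<Longrightarrow> (D i v \<longlongrightarrow> 0) F"
  shows "k \<le> m \<Longrightarrow> \<forall>\<^sub>F x in F. \<bar>D k v x\<bar> \<le> C * \<bar>D k u x\<bar>"
proof (induction "m - k" arbitrary: k)
  case 0
  then show ?case using le by simp
next
  case (Suc d)
  have IH: "\<forall>\<^sub>F x in F. \<bar>D (Suc k) v x\<bar> \<le> C * \<bar>D (Suc k) u x\<bar>"
    using Suc.hyps(2) by (intro Suc.hyps(1)) auto
  have k: "k < m" "Suc k \<le> n" "Suc k < n" using Suc.hyps(2) m by auto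
  show ?case
    by (rule compare_vanishing[OF evd_D[OF u k(3)] u0[OF k(1)] _ evd_D[OF v k(3)] v0[OF k(1)] le_div_w[OF IH k(2)]])
       (use one_signed_div_w[OF one_signed_D[OF u m os], of "Suc k"] k in auto)
qed

text \<open>Iterated \<open>compare_diverging\<close>. Each level doubles the constant, so only the
  existence of a bound survives the descent; the divergence of the images of \<open>v\<close>
  absorbs the constants of integration.\<close>

lemma descend_diverging:
  assumes u: "Ck_on S (n - 1) u" and v: "Ck_on S (n - 1) v" and m: "m < n"
    and os: "one_signed (D m u)" and le: "\<forall>\<^sub>F x in F. \<bar>D m v x\<bar> \<le> C * \<bar>D m u x\<bar>" "C \<ge> 0"
    and v0: "\<And>i. i < m \<Longrightarrow> filterlim (\<lambda>x. \<bar>D i v x\<bar>) at_top F"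
  shows "k \<le> m \<Longrightarrow> \<exists>C\<ge>0. \<forall>\<^sub>F x in F. \<bar>D k v x\<bar> \<le> C * \<bar>D k u x\<bar>"
proof (induction "m - k" arbitrary: k)
  case 0
  then show ?case using le by auto
next
  case (Suc d)
  have "\<exists>C\<ge>0. \<forall>\<^sub>F x in F. \<bar>D (Suc k) v x\<bar> \<le> C * \<bar>D (Suc k) u x\<bar>"
    using Suc.hyps(2) by (intro Suc.hyps(1)) auto
  then obtain C where C: "C \<ge> 0" "\<forall>\<^sub>F x in F. \<bar>D (Suc k) v x\<bar> \<le> C * \<bar>D (Suc k) u x\<bar>" by blast
  have k: "k < m" "Suc k \<le> n" "Suc k < n" using Suc.hyps(2) m by auto
  have "\<forall>\<^sub>F x in F. \<bar>D k v x\<bar> \<le> 2 * C * \<bar>D k u x\<bar>"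
    by (rule compare_diverging[OF C(1) evd_D[OF u k(3)] _ evd_D[OF v k(3)] v0[OF k(1)] le_div_w[OF C(2) k(2)]])
       (use one_signed_div_w[OF one_signed_D[OF u m os], of "Suc k"] k in auto)
  then show ?case using C(1) by (intro exI[of _ "2 * C"]) auto
qed

lemma smallo_contradiction:
  fixes u v :: "real \<Rightarrow> real" and C :: real
  assumes o: "u \<in> o[F](v)" and nz: "\<forall>\<^sub>F x in F. v x \<noteq> 0" and C: "C \<ge> 0" and le: "\<forall>\<^sub>F x in F. \<bar>v x\<bar> \<le> C * \<bar>u x\<bar>"
  shows False
proof -
  \<comment> \<open>With this little-o constant the two bounds combine to |v| <= |v| / 2, also when
    C = 0.\<close>
  have "1 / (2 * (C + 1)) > 0" using C by simp
  from landau_o.smallD[OF o this] have "\<forall>\<^sub>F x in F. norm (u x) \<le> 1 / (2 * (C + 1)) * norm (v x)" .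
  with le nz have "\<forall>\<^sub>F x in F. False"
  proof eventually_elim
    case (elim x)
    have "\<bar>v x\<bar> \<le> C * (1 / (2 * (C + 1)) * \<bar>v x\<bar>)"
      using elim C by (intro order_trans[OF elim(1)] mult_left_mono) auto
    also have "\<dots> = C / (2 * (C + 1)) * \<bar>v x\<bar>" by simp
    also have "\<dots> \<le> 1 / 2 * \<bar>v x\<bar>" using C by (intro mult_right_mono) (auto simp: field_simps)
    finally show False using elim(2) by simp
  qed
  then show False by simp
qed

lemma shift_coefficient:
  assumes "k \<in> {1..n}"
  shows "R f (a(k := a k + c)) = (\<lambda>x. R f a x + (- c) * \<psi> k x)"
proof
  fix x
  have "(\<Sum>j\<in>{1..n}. (a(k := a k + c)) j * \<psi> j x) = (\<Sum>j\<in>{1..n}. a j * \<psi> j x + (if j = k then c * \<psi> k x else 0))"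
    by (intro sum.cong) (auto simp: algebra_simps)
  also have "\<dots> = (\<Sum>j\<in>{1..n}. a j * \<psi> j x) + c * \<psi> k x"
    using assms by (simp add: sum.distrib)
  finally show "R f (a(k := a k + c)) x = R f a x + (- c) * \<psi> k x"
    by simp
qed

text \<open>Multiples of \<^term>\<open>\<psi> n\<close>, \dots, \<^term>\<open>\<psi> 1\<close> are subtracted in this order; a later step does not
  disturb the earlier ones, since \<^term>\<open>D i\<close> annihilates \<^term>\<open>\<psi> k\<close> for \<^term>\<open>i \<ge> k\<close>.\<close>

lemma subtract_to_vanish:
  assumes f: "Ck_on S (n - 1) f"
    and step: "\<And>k a. k < n \<Longrightarrow> (\<And>i. k < i \<Longrightarrow> i < n \<Longrightarrow> (D i (R f a) \<longlongrightarrow> 0) F)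
       \<Longrightarrow> \<exists>c. (D k (R f a) \<longlongrightarrow> c) F"
  shows "\<exists>a. \<forall>i<n. (D i (R f a) \<longlongrightarrow> 0) F"
proof -
  have "\<exists>a. \<forall>i. n - d \<le> i \<longrightarrow> i < n \<longrightarrow> (D i (R f a) \<longlongrightarrow> 0) F" for d
  proof (induction d)
    case (Suc d)
    then obtain a where a: "\<And>i. n - d \<le> i \<Longrightarrow> i < n \<Longrightarrow> (D i (R f a) \<longlongrightarrow> 0) F" by blast
    show ?case
    proof (cases "d < n")
      case False
      then show ?thesis using a by (intro exI[of _ a]) auto
    next
      case True
      define k where "k = n - Suc d"
      have k: "k < n" "Suc k = n - d" using True by (auto simp: k_def)
      define u where "u = R f a"
      have u: "Ck_on S (n - 1) u" unfolding u_def by (rule Ck_on_sum_\<psi>[OF f order_refl])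
      obtain c where c: "(D k u \<longlongrightarrow> c) F"
      proof -
        have "\<exists>c. (D k u \<longlongrightarrow> c) F"
          unfolding u_def by (rule step[OF k(1)], rule a) (use k in auto)
        then show ?thesis using that by blast
      qed
      \<comment> \<open>\<open>D k\<close> maps psi_(k+1) to the constant kappa_k, whose square is
        1, so this multiple moves the limit c to 0.\<close>
      define v where "v = (\<lambda>x. u x + (- (c * \<kappa> k)) * \<psi> (Suc k) x)"
      have Dv: "\<forall>\<^sub>F x in F. D i u x + (- (c * \<kappa> k)) * D i (\<psi> (Suc k)) x = D i v x" if "i < n" for i
        using eventually_S by (rule eventually_mono)
          (unfold v_def, rule D_cong_lincomb[OF u Ck, symmetric], use that k in auto)
      have "(D i v \<longlongrightarrow> 0) F" if i: "k \<le> i" "i < n" for i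
      proof (cases "i = k")
        case True
        have kk: "\<kappa> k * \<kappa> k = 1" using abs_\<kappa>[OF k(1)] by (auto simp: abs_if split: if_splits)
        have "(D k (\<psi> (Suc k)) \<longlongrightarrow> \<kappa> k) F"
          by (rule tendsto_eventually[OF eventually_D_\<psi>[OF k(1)]])
        then have "((\<lambda>x. D k u x + (- (c * \<kappa> k)) * D k (\<psi> (Suc k)) x) \<longlongrightarrow> c + (- (c * \<kappa> k)) * \<kappa> k) F"
          by (intro tendsto_intros c)
        moreover have e: "c + (- (c * \<kappa> k)) * \<kappa> k = 0" using kk by (simp add: mult.assoc)
        ultimately have "((\<lambda>x. D k u x + (- (c * \<kappa> k)) * D k (\<psi> (Suc k)) x) \<longlongrightarrow> 0) F" by (simp only:)
        then show ?thesis using Lim_transform_eventually[OF _ Dv[OF k(1)]] True by blast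
      next
        case False
        then have ki: "n - d \<le> i" "Suc k \<le> i" using i k by auto
        have "\<forall>\<^sub>F x in F. D i (\<psi> (Suc k)) x = 0"
          using eventually_S by (rule eventually_mono) (use D_\<psi>_0[of "Suc k" i] ki i in auto)
        then have "\<forall>\<^sub>F x in F. D i u x = D i v x"
          using Dv[OF i(2)] by eventually_elim simp
        with a[OF ki(1) i(2)] show ?thesis unfolding u_def[symmetric] by (rule Lim_transform_eventually)
      qed
      moreover have "v = R f (a(Suc k := a (Suc k) + c * \<kappa> k))"
        using shift_coefficient[of "Suc k" f a "c * \<kappa> k"] k by (simp add: v_def u_def)
      ultimately show ?thesis unfolding k_def[symmetric] by blast
    qed
  qed auto
  from this[of n] show ?thesis by simp
qed

text \<open>Every scale function has a constant image under the top operator, so integrals of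
  \<open>L f\<close> cannot distinguish \<open>f\<close> from its remainders.\<close>

lemma increment_shift:
  assumes f: "Ck_on S (n - 1) f" and xy: "x \<in> S" "y \<in> S"
  shows "D (n - 1) (R f a) y - D (n - 1) (R f a) x
    = D (n - 1) f y - D (n - 1) f x"
proof -
  have "D (n - 1) (\<psi> j) y = D (n - 1) (\<psi> j) x" if j: "j \<in> {1..n}" for j
  proof (cases "j = n")
    case True
    then show ?thesis using D_\<psi>_Suc[of "n - 1" x] D_\<psi>_Suc[of "n - 1" y] n2 xy by simp
  next
    case False
    then have "j \<le> n - 1" "1 \<le> j" using j by auto
    then show ?thesis using D_\<psi>_0[of j "n - 1" x] D_\<psi>_0[of j "n - 1" y] n2 xy by simp
  qed
  then have "(\<Sum>j\<in>{1..n}. a j * D (n - 1) (\<psi> j) y) = (\<Sum>j\<in>{1..n}. a j * D (n - 1) (\<psi> j) x)"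
    by (intro sum.cong) auto
  then show ?thesis using D_sum_\<psi>[OF f order_refl, of "n - 1" _ a] n2 xy by simp
qed

end

section \<open>Nested integrals of \<open>L f\<close> and remainders whose images vanish at the
  right end point\<close>

locale nonneg_L = wronski_system +
  fixes f :: "real \<Rightarrow> real"
  assumes fAC: "ACk_on S (n - 1) f"
    and Lf: "AE t in lborel. t \<in> S \<longrightarrow> Lop S \<psi> n f t \<ge> 0"
begin

lemma fCk: "Ck_on S (n - 1) f"
  by (rule ACk_imp_Ck[OF fAC])

lemma R_Ck: "Ck_on S (n - 1) (R f a)"
  by (rule Ck_on_sum_\<psi>[OF fCk order_refl])

lemma R_accumulates:
  "accumulates (\<lambda>t. max 0 (Lop S \<psi> n f t / w n t)) (D (n - 1) (R f a))"
  unfolding accumulates_def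
  using D_last_has_integral_max[OF fAC _ _ _ Lf] by (simp add: increment_shift[OF fCk, unfolded One_nat_def])

lemma R_ev_mono_last: "ev_mono (D (n - 1) (R f a))"
proof -
  have "ev_incr (D (n - 1) (R f a))"
    unfolding ev_incr_def using T_S accum_props(3)[OF R_accumulates] by blast
  then show ?thesis by (simp add: ev_mono_def)
qed

lemma R_ev_mono: "k < n \<Longrightarrow> ev_mono (D k (R f a))"
  using ev_mono_D[OF R_Ck _ ev_mono_one_signed[OF R_ev_mono_last]] R_ev_mono_last n2
  by (cases "k = n - 1") auto

text \<open>The factor \<open>c\<close> will be the power of -1 that makes the image at this level
  nonnegative.\<close>

lemma R_accumulates_lower:
  assumes k: "Suc k < n" and nn: "\<And>t. t \<in> S \<Longrightarrow> 0 \<le> c * D (Suc k) (R f a) t"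
  shows "accumulates (\<lambda>t. c * D (Suc k) (R f a) t / w (Suc k) t) (\<lambda>x. c * D k (R f a) x)"
  unfolding accumulates_def
proof (intro conjI ballI impI)
  show "0 \<le> c * D (Suc k) (R f a) t / w (Suc k) t" if "t \<in> S" for t
    using nn[OF that] w_pos[of "Suc k" t] that k by auto
next
  fix x y assume xy: "x \<in> S" "y \<in> S" "x \<le> y"
  show "((\<lambda>t. c * D (Suc k) (R f a) t / w (Suc k) t) has_integral c * D k (R f a) y - c * D k (R f a) x) {x..y}"
  proof (rule fundamental_theorem_of_calculus[OF xy(3)])
    fix t assume t: "t \<in> {x..y}"
    have sub: "{x..y} \<subseteq> S" using Ico_e_Icc[OF xy(1,2)] .
    have "((\<lambda>t. c * D k (R f a) t) has_real_derivative c * (D (Suc k) (R f a) t / w (Suc k) t)) (at t within S)"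
      using D_deriv[OF R_Ck k] t sub by (intro DERIV_cmult) auto
    from has_field_derivative_subset[OF this sub]
    show "((\<lambda>t. c * D k (R f a) t) has_vector_derivative c * D (Suc k) (R f a) t / w (Suc k) t) (at t within {x..y})"
      by (simp add: has_real_derivative_iff_has_vector_derivative)
  qed
qed

abbreviation N :: "nat \<Rightarrow> real \<Rightarrow> ennreal" where
  "N m \<equiv> nint x0 w (Lop S \<psi> n f) n m"

lemma N_0: "N 0 s = tail_integral (\<lambda>t. max 0 (Lop S \<psi> n f t / w n t)) s"
  by (simp add: ennreal_max_0)

lemma N_Suc:
  assumes "s \<in> S" "Suc m < n"
    and v: "\<And>t. t \<in> S \<Longrightarrow> 0 \<le> G t \<and> N m t = ennreal (G t)"
  shows "N (Suc m) s = tail_integral (\<lambda>t. G t / w (n - Suc m) t) s"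
  unfolding nint.simps
proof (rule nn_integral_cong)
  fix t
  show "indicator (Ico_e s x0) t * ennreal (1 / w (n - Suc m) t) * N m t = indicator (Ico_e s x0) t * ennreal (G t / w (n - Suc m) t)"
  proof (cases "t \<in> Ico_e s x0")
    case True
    then have "t \<in> S" using assms(1) by (auto simp: Ico_e_def)
    then show ?thesis using v[of t] w_pos[of "n - Suc m" t] True by (simp flip: ennreal_mult)
  qed simp
qed

text \<open>An integral up to \<open>x0\<close> of the derivative of a function with limit 0 there
  is minus its value at the lower limit. Hence each level of nesting goes down one operator and
  changes the sign once.\<close>

lemma N_value:
  assumes "\<And>k. n - Suc m \<le> k \<Longrightarrow> k < n \<Longrightarrow> (D k (R f a) \<longlongrightarrow> 0) F"
  shows "m < n \<Longrightarrow> s \<in> S \<Longrightarrow> 0 \<le> (-1) ^ Suc m * D (n - Suc m) (R f a) s \<and>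
    N m s = ennreal ((-1) ^ Suc m * D (n - Suc m) (R f a) s)"
  using assms
proof (induction m arbitrary: s)
  case 0
  have "(D (n - 1) (R f a) \<longlongrightarrow> 0) F" using 0 by simp
  from accum_limit[OF R_accumulates \<open>s \<in> S\<close> this]
  show ?case unfolding N_0 by simp
next
  case (Suc m)
  define k where "k = n - Suc (Suc m)"
  have k: "Suc k < n" "n - Suc m = Suc k" using Suc.prems(1) by (auto simp: k_def)
  have IH: "0 \<le> (-1) ^ Suc m * D (Suc k) (R f a) t \<and> N m t = ennreal ((-1) ^ Suc m * D (Suc k) (R f a) t)"
    if "t \<in> S" for t
    using Suc.IH[OF _ that] Suc.prems k by auto
  have lim: "((\<lambda>x. (-1) ^ Suc m * D k (R f a) x) \<longlongrightarrow> 0) F"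
    using Suc.prems(3)[of k] k unfolding k_def[symmetric] by (intro tendsto_mult_right_zero) auto
  have "N (Suc m) s = tail_integral (\<lambda>t. (-1) ^ Suc m * D (Suc k) (R f a) t / w (Suc k) t) s"
    using N_Suc[OF Suc.prems(2,1) IH] unfolding k(2) by simp
  with accum_limit[OF R_accumulates_lower[OF k(1)] Suc.prems(2) lim] IH
  show ?case unfolding k_def[symmetric] by simp
qed

text \<open>An inner integral that is infinite throughout an interval, multiplied by a positive
  weight, makes the outer integral infinite. One good starting point is enough to decide convergence
  near \<open>x0\<close>.\<close>

lemma N_finite_lower:
  assumes "N (Suc m) s < \<infinity>" "s \<in> S" "Suc m < n"
  shows "\<exists>t\<in>S. N m t < \<infinity>"
proof (rule ccontr)
  assume "\<not> ?thesis"
  then have inf: "N m t = \<infinity>" if "t \<in> S" for t using that by (auto simp: less_top[symmetric])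
  obtain y where y: "s < y" "y \<in> S" using Ico_e_right[OF assms(2)] .
  have "\<infinity> = (\<infinity>::ennreal) * emeasure lborel {s..y}" using y by (simp add: ennreal_top_mult)
  also have "\<dots> = (\<integral>\<^sup>+ t. \<infinity> * indicator {s..y} t \<partial>lborel)" by (simp add: nn_integral_cmult_indicator)
  also have "\<dots> \<le> N (Suc m) s"
    unfolding nint.simps
  proof (rule nn_integral_mono)
    fix t
    show "\<infinity> * indicator {s..y} t \<le> indicator (Ico_e s x0) t * ennreal (1 / w (n - Suc m) t) * N m t"
    proof (cases "t \<in> {s..y}")
      case True
      then have t: "t \<in> S" "t \<in> Ico_e s x0" using Ico_e_Icc[OF assms(2) y(2)] by (auto simp: Ico_e_def)
      then have "w (n - Suc m) t > 0" by (intro w_pos) auto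
      then show ?thesis using inf[OF t(1)] t(2) by (simp add: ennreal_mult_top)
    qed simp
  qed
  finally show False using assms(1) by simp
qed

lemma N_finite_all:
  assumes "N (n - 1) T < \<infinity>" shows "m < n \<Longrightarrow> \<exists>t\<in>S. N m t < \<infinity>"
proof (induction "n - 1 - m" arbitrary: m)
  case 0
  then have "m = n - 1" by simp
  then show ?case using assms T_S by auto
next
  case (Suc d)
  then have "\<exists>t\<in>S. N (Suc m) t < \<infinity>" by (intro Suc.hyps(1)) auto
  then obtain t where "t \<in> S" "N (Suc m) t < \<infinity>" by blast
  then show ?case using Suc.hyps(2) by (intro N_finite_lower[of m t]) auto
qed

text \<open>From the innermost integral outwards, finiteness forces \<open>D k\<close> of the
  current remainder to converge, and subtracting a multiple of psi_(k+1) makes its limit 0.\<close>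

lemma N_finite_imp_vanish:
  assumes fin: "N (n - 1) T < \<infinity>"
  shows "\<exists>a. \<forall>i<n. (D i (R f a) \<longlongrightarrow> 0) F"
proof (rule subtract_to_vanish[OF fCk])
  fix k a assume k: "k < n" and lim: "\<And>i. k < i \<Longrightarrow> i < n \<Longrightarrow> (D i (R f a) \<longlongrightarrow> 0) F"
  show "\<exists>c. (D k (R f a) \<longlongrightarrow> c) F"
  proof (cases "Suc k < n")
    case False
    then have k': "k = n - 1" using k by simp
    obtain t where "t \<in> S" "N 0 t < \<infinity>" using N_finite_all[OF fin, of 0] n2 by auto
    then show ?thesis using accum_finite[OF R_accumulates, of t a] unfolding k' N_0 by simp
  next
    case True
    \<comment> \<open>\<open>N m\<close> consists of m + 1 integrals and belongs to operator n - (m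
      + 1) = k + 1.\<close>
    define m where "m = n - Suc (Suc k)"
    have m: "Suc m < n \<or> Suc m = n" "n - Suc m = Suc k" "Suc m \<le> n - 1" using True by (auto simp: m_def)
    have v: "0 \<le> (-1) ^ Suc m * D (Suc k) (R f a) t \<and> N m t = ennreal ((-1) ^ Suc m * D (Suc k) (R f a) t)"
      if "t \<in> S" for t
      using N_value[of m a t] lim m that unfolding m(2) by auto
    obtain s where s: "s \<in> S" "N (Suc m) s < \<infinity>" using N_finite_all[OF fin, of "Suc m"] m n2 by auto
    have "\<exists>c. ((\<lambda>x. (-1) ^ Suc m * D k (R f a) x) \<longlongrightarrow> c) F"
    proof (rule accum_finite[OF R_accumulates_lower[OF True] s(1)])
      show "0 \<le> (-1) ^ Suc m * D (Suc k) (R f a) t" if "t \<in> S" for t using v[OF that] by simp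
      show "tail_integral (\<lambda>t. (-1) ^ Suc m * D (Suc k) (R f a) t / w (Suc k) t) s < \<infinity>"
        using s(2) N_Suc[OF s(1) _ v] m n2 unfolding m(2) by simp
    qed
    then obtain c where "((\<lambda>x. (-1) ^ Suc m * D k (R f a) x) \<longlongrightarrow> c) F" by blast
    from tendsto_mult_left[OF this, of "(-1) ^ Suc m"]
    have "(D k (R f a) \<longlongrightarrow> (-1) ^ Suc m * c) F" by (simp add: mult.assoc[symmetric] flip: power_mult_distrib)
    then show ?thesis by blast
  qed
qed

end

context nonneg_L
begin

lemma nint_antimono: "s \<le> t \<Longrightarrow> nint x0 v g n m t \<le> nint x0 v g n m s"
  by (cases m) (auto intro!: nn_integral_mono simp: indicator_def Ico_e_def)

definition vanishing :: "(nat \<Rightarrow> real) \<Rightarrow> bool" where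
  "vanishing a \<longleftrightarrow> (\<forall>i<n. (D i (R f a) \<longlongrightarrow> 0) F)"

lemma vanishingD: "vanishing a \<Longrightarrow> i < n \<Longrightarrow> (D i (R f a) \<longlongrightarrow> 0) F"
  by (simp add: vanishing_def)

lemma vanish_imp_N:
  assumes van: "vanishing a" and x: "x \<in> S"
  shows "0 \<le> (-1) ^ n * R f a x * w 0 x" "N (n - 1) x = ennreal ((-1) ^ n * R f a x * w 0 x)"
  using N_value[of "n - 1" a x] vanishingD[OF van] x n2 by (auto simp: Dop.simps mult_ac)

lemma vanish_imp_representation:
  assumes van: "vanishing a" and x: "x \<in> S"
  shows "N (n - 1) x < \<infinity>" "R f a x = (-1) ^ n / w 0 x * enn2real (N (n - 1) x)" "0 \<le> (-1) ^ n * R f a x"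
proof -
  note V = vanish_imp_N[OF van x]
  show "N (n - 1) x < \<infinity>" unfolding V(2) by simp
  have w: "w 0 x > 0" by (rule w_pos[OF _ x]) simp
  have "enn2real (N (n - 1) x) = (-1) ^ n * R f a x * w 0 x" unfolding V(2) using V(1) by simp
  moreover have "(-1) ^ n * ((-1) ^ n * r) = r" for r :: real
    by (simp add: mult.assoc[symmetric] flip: power_mult_distrib)
  ultimately show "R f a x = (-1) ^ n / w 0 x * enn2real (N (n - 1) x)"
    using w by (simp add: mult.assoc)
  show "0 \<le> (-1) ^ n * R f a x" using V(1) w by (simp add: zero_le_mult_iff)
qed

text \<open>The product equals the nested integral started at x, whose domain shrinks as x moves
  right.\<close>

lemma vanish_imp_antimono:
  assumes van: "vanishing a"
  shows "antimono_on S (\<lambda>x. (-1) ^ n * R f a x * w 0 x)"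
proof (rule monotone_onI)
  fix x y assume xy: "x \<in> S" "y \<in> S" "x \<le> y"
  have "ennreal ((-1) ^ n * R f a y * w 0 y) \<le> ennreal ((-1) ^ n * R f a x * w 0 x)"
    using nint_antimono[OF xy(3)] vanish_imp_N(2)[OF van xy(1)] vanish_imp_N(2)[OF van xy(2)] by metis
  then show "(-1) ^ n * R f a x * w 0 x \<ge> (-1) ^ n * R f a y * w 0 y"
    using vanish_imp_N(1)[OF van xy(1)] by (simp add: ennreal_le_iff)
qed

lemma vanish_imp_N_0_finite:
  assumes van: "vanishing a"
  shows "N 0 T < \<infinity>"
proof -
  have "N 0 T = ennreal ((-1) ^ Suc 0 * D (n - Suc 0) (R f a) T)"
    using N_value[of 0 a T] vanishingD[OF van] T_S n2 by simp
  then show ?thesis by (simp only:) simp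
qed

end

section \<open>From little-o relations to vanishing images\<close>

context wronski_system
begin

lemma not_vanish_imp_dominated:
  assumes k: "k < n" and mono: "ev_mono (D k u)" and n0: "\<not> (D k u \<longlongrightarrow> 0) F"
  obtains C where "C \<ge> 0" "\<forall>\<^sub>F x in F. \<bar>D k (\<psi> (Suc k)) x\<bar> \<le> C * \<bar>D k u x\<bar>"
proof -
  obtain c where c: "c > 0" "\<forall>\<^sub>F x in F. c \<le> \<bar>D k u x\<bar>" by (rule ev_mono_not_0[OF mono n0])
  have "\<forall>\<^sub>F x in F. \<bar>D k (\<psi> (Suc k)) x\<bar> \<le> 1 / c * \<bar>D k u x\<bar>"
    using c(2) eventually_abs_D_\<psi>[OF k] by eventually_elim (use c(1) in \<open>simp add: field_simps\<close>)
  then show ?thesis using c(1) by (intro that[of "1 / c"]) auto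
qed

text \<open>If \<open>D k u\<close> stayed away from 0, it would dominate the constant image of
  psi_(k+1). Descending along vanishing images would give psi_(k+1) = O(u), which contradicts the
  little-o assumption because psi_(k+1) is eventually nonzero.\<close>

lemma vanish_if_smallo_vanishing:
  assumes u: "Ck_on S (n - 1) u" and k: "k < n" and mono: "ev_mono (D k u)"
    and o: "u \<in> o[F](\<psi> (Suc k))" and nz: "\<forall>\<^sub>F x in F. \<psi> (Suc k) x \<noteq> 0"
    and u0: "\<And>i. i < k \<Longrightarrow> (D i u \<longlongrightarrow> 0) F" and \<psi>0: "\<And>i. i < k \<Longrightarrow> (D i (\<psi> (Suc k)) \<longlongrightarrow> 0) F"
  shows "(D k u \<longlongrightarrow> 0) F"
proof (rule ccontr)
  assume "\<not> ?thesis"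
  then obtain C where C: "C \<ge> 0" "\<forall>\<^sub>F x in F. \<bar>D k (\<psi> (Suc k)) x\<bar> \<le> C * \<bar>D k u x\<bar>"
    using not_vanish_imp_dominated[OF k mono] by blast
  have "\<forall>\<^sub>F x in F. \<bar>D 0 (\<psi> (Suc k)) x\<bar> \<le> C * \<bar>D 0 u x\<bar>"
    by (rule descend_vanishing[OF u Ck k ev_mono_one_signed[OF mono] C(2) u0 \<psi>0]) (use k in auto)
  from smallo_contradiction[OF o nz C(1) D_0_le[OF this]] show False .
qed

text \<open>Here the descent is driven by the divergent images of psi_(k+1) instead of vanishing
  images of \<open>u\<close>, so each level k can be treated by itself.\<close>

lemma vanish_if_smallo_diverging:
  assumes u: "Ck_on S (n - 1) u" and k: "k < n" and mono: "ev_mono (D k u)"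
    and o: "u \<in> o[F](\<psi> (Suc k))" and nz: "\<forall>\<^sub>F x in F. \<psi> (Suc k) x \<noteq> 0"
    and \<psi>inf: "\<And>i. i < k \<Longrightarrow> filterlim (\<lambda>x. \<bar>D i (\<psi> (Suc k)) x\<bar>) at_top F"
  shows "(D k u \<longlongrightarrow> 0) F"
proof (rule ccontr)
  assume "\<not> ?thesis"
  then obtain C where C: "C \<ge> 0" "\<forall>\<^sub>F x in F. \<bar>D k (\<psi> (Suc k)) x\<bar> \<le> C * \<bar>D k u x\<bar>"
    using not_vanish_imp_dominated[OF k mono] by blast
  have "\<exists>C\<ge>0. \<forall>\<^sub>F x in F. \<bar>D 0 (\<psi> (Suc k)) x\<bar> \<le> C * \<bar>D 0 u x\<bar>"
    by (rule descend_diverging[OF u Ck k ev_mono_one_signed[OF mono] C(2,1) \<psi>inf]) (use k in auto)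
  then obtain C' where "C' \<ge> 0" "\<forall>\<^sub>F x in F. \<bar>D 0 (\<psi> (Suc k)) x\<bar> \<le> C' * \<bar>D 0 u x\<bar>" by blast
  from smallo_contradiction[OF o nz this(1) D_0_le[OF this(2)]] show False .
qed

end

section \<open>The scale in decreasing order: the operators M_k\<close>

locale decaying = nonneg_L +
  assumes nz: "\<And>i. i \<in> {1..n} \<Longrightarrow> \<forall>\<^sub>F x in F. \<psi> i x \<noteq> 0"
    and dec: "\<And>i. i \<in> {1..<n} \<Longrightarrow> ((\<lambda>x. \<psi> (Suc i) x / \<psi> i x) \<longlongrightarrow> 0) F"
begin

lemma smallo_\<psi>: "1 \<le> i \<Longrightarrow> i < j \<Longrightarrow> j \<le> n \<Longrightarrow> \<psi> j \<in> o[F](\<psi> i)"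
proof (induction j)
  case (Suc j)
  have s: "\<psi> (Suc j) \<in> o[F](\<psi> j)"
    by (rule smalloI_tendsto) (use dec[of j] nz[of j] Suc.prems in auto)
  then show ?case
    using Suc landau_o.small_trans[OF s] by (cases "i = j") auto
qed simp

text \<open>psi_j = o(psi_(i+1)), so the vanishing criterion applies with u = psi_j; the lower
  images of both functions vanish by induction.\<close>

lemma D_\<psi>_vanish: "Suc i < j \<Longrightarrow> j \<le> n \<Longrightarrow> (D i (\<psi> j) \<longlongrightarrow> 0) F"
proof (induction i arbitrary: j rule: less_induct)
  case (less i)
  show ?case
  proof (rule vanish_if_smallo_vanishing)
    show "ev_mono (D i (\<psi> j))" using ev_mono_D_\<psi>[of "j - 1" i] less.prems by simp
    show "\<psi> j \<in> o[F](\<psi> (Suc i))" by (rule smallo_\<psi>) (use less.prems in auto)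
    show "(D i' (\<psi> j) \<longlongrightarrow> 0) F" if "i' < i" for i' using less that by auto
    show "(D i' (\<psi> (Suc i)) \<longlongrightarrow> 0) F" if "i' < i" for i' using less that by auto
  qed (use less.prems in \<open>auto intro!: Ck[unfolded One_nat_def] nz\<close>)
qed

text \<open>Below the last level, O(psi_n) is already o(psi_(i+1)). This makes condition (i) usable
  although it leaves the coefficient of psi_n open.\<close>

lemma R_vanish_below:
  assumes O: "R f a \<in> O[F](\<psi> n)"
  shows "i < n - 1 \<Longrightarrow> (D i (R f a) \<longlongrightarrow> 0) F"
proof (induction i rule: less_induct)
  case (less i)
  have "\<psi> n \<in> o[F](\<psi> (Suc i))" by (rule smallo_\<psi>) (use less.prems in auto)
  then have o: "R f a \<in> o[F](\<psi> (Suc i))" by (rule landau_o.big_small_trans[OF O])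
  show ?case
    by (rule vanish_if_smallo_vanishing[OF R_Ck _ R_ev_mono o])
       (use less in \<open>auto intro!: nz D_\<psi>_vanish\<close>)
qed

lemma smallo_imp_vanishing:
  assumes o: "R f a \<in> o[F](\<psi> n)"
  shows "vanishing a"
  unfolding vanishing_def
proof (intro allI impI)
  fix i assume i: "i < n"
  show "(D i (R f a) \<longlongrightarrow> 0) F"
  proof (cases "i = n - 1")
    case True
    have n': "Suc (n - 1) = n" using n2 by simp
    show ?thesis unfolding True
    proof (rule vanish_if_smallo_vanishing[OF R_Ck _ R_ev_mono])
      show "(D i (R f a) \<longlongrightarrow> 0) F" if "i < n - 1" for i
        by (rule R_vanish_below[OF landau_o.small_imp_big[OF o] that])
      show "(D i (\<psi> (Suc (n - 1))) \<longlongrightarrow> 0) F" if "i < n - 1" for i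
        unfolding n' by (rule D_\<psi>_vanish) (use that in auto)
    qed (unfold n', use o nz n2 in auto)
  next
    case False
    then show ?thesis using R_vanish_below[OF landau_o.small_imp_big[OF o]] i by auto
  qed
qed

text \<open>At the top the image of psi_n has modulus 1 and that of the remainder tends to 0, so
  every c > 0 is admissible there, and the descent preserves it.\<close>

lemma vanish_imp_smallo_D:
  assumes van: "vanishing a" and k: "k < n"
  shows "D k (R f a) \<in> o[F](D k (\<psi> n))"
proof (rule landau_o.smallI)
  fix c :: real assume c: "c > 0"
  have n': "Suc (n - 1) = n" "n - 1 < n" using n2 by simp_all
  have 1: "\<forall>\<^sub>F x in F. \<bar>D (n - 1) (\<psi> n) x\<bar> = 1" using eventually_abs_D_\<psi>[OF n'(2)] unfolding n' .
  have "\<forall>\<^sub>F x in F. \<bar>D (n - 1) (R f a) x\<bar> < c"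
    using order_tendstoD(2)[OF tendsto_rabs[OF vanishingD[OF van n'(2)]], of c] c by simp
  with 1 have le: "\<forall>\<^sub>F x in F. \<bar>D (n - 1) (R f a) x\<bar> \<le> c * \<bar>D (n - 1) (\<psi> n) x\<bar>"
    by eventually_elim simp
  have "\<forall>\<^sub>F x in F. \<bar>D k (R f a) x\<bar> \<le> c * \<bar>D k (\<psi> n) x\<bar>"
  proof (rule descend_vanishing[OF Ck R_Ck n'(2) _ le])
    show "one_signed (D (n - 1) (\<psi> n))" using one_signed_D_\<psi>[OF n'(2) order_refl] unfolding n' .
  qed (use vanishingD[OF van] k n2 in \<open>auto intro: D_\<psi>_vanish\<close>)
  then show "\<forall>\<^sub>F x in F. norm (D k (R f a) x) \<le> c * norm (D k (\<psi> n) x)" by simp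
qed

lemma vanish_imp_smallo:
  assumes van: "vanishing a"
  shows "R f a \<in> o[F](\<psi> n)"
proof (rule landau_o.smallI)
  fix c :: real assume c: "c > 0"
  have "D 0 (R f a) \<in> o[F](D 0 (\<psi> n))" by (rule vanish_imp_smallo_D[OF van]) (use n2 in auto)
  from landau_o.smallD[OF this c]
  have "\<forall>\<^sub>F x in F. \<bar>D 0 (R f a) x\<bar> \<le> c * \<bar>D 0 (\<psi> n) x\<bar>" by simp
  from D_0_le[OF this] show "\<forall>\<^sub>F x in F. norm (R f a x) \<le> c * norm (\<psi> n x)" by simp
qed

text \<open>By monotonicity the alternative is divergence of the top image, and then descent gives
  psi_n = o(R). Together with R = O(psi_n) this makes R, and hence psi_n, eventually 0.\<close>

lemma bigo_imp_last_convergent: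
  assumes O: "R f a \<in> O[F](\<psi> n)"
  shows "\<exists>c. (D (n - 1) (R f a) \<longlongrightarrow> c) F"
  using R_ev_mono_last[of a]
proof (rule ev_mono_cases)
  assume inf: "filterlim (\<lambda>x. \<bar>D (n - 1) (R f a) x\<bar>) at_top F"
  have n': "Suc (n - 1) = n" "n - 1 < n" using n2 by simp_all
  have small: "\<psi> n \<in> o[F](R f a)"
  proof (rule landau_o.smallI)
    fix c :: real assume c: "c > 0"
    have "\<forall>\<^sub>F x in F. 1 / c \<le> \<bar>D (n - 1) (R f a) x\<bar>" using inf by (simp add: filterlim_at_top)
    with eventually_abs_D_\<psi>[OF n'(2)]
    have le: "\<forall>\<^sub>F x in F. \<bar>D (n - 1) (\<psi> n) x\<bar> \<le> c * \<bar>D (n - 1) (R f a) x\<bar>"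
      unfolding n' by eventually_elim (use c in \<open>simp add: field_simps\<close>)
    have "\<forall>\<^sub>F x in F. \<bar>D 0 (\<psi> n) x\<bar> \<le> c * \<bar>D 0 (R f a) x\<bar>"
      by (rule descend_vanishing[OF R_Ck Ck n'(2) ev_mono_one_signed[OF R_ev_mono_last] le])
         (use R_vanish_below[OF O] n2 in \<open>auto intro: D_\<psi>_vanish\<close>)
    from D_0_le[OF this] show "\<forall>\<^sub>F x in F. norm (\<psi> n x) \<le> c * norm (R f a x)" by simp
  qed
  then have "R f a \<in> o[F](R f a)" by (rule landau_o.big_small_trans[OF O])
  then have "\<forall>\<^sub>F x in F. R f a x = 0" by (simp add: landau_o.small_refl_iff)
  moreover have "\<forall>\<^sub>F x in F. norm (\<psi> n x) \<le> 1 * norm (R f a x)"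
    by (rule landau_o.smallD[OF small]) simp
  moreover have "\<forall>\<^sub>F x in F. \<psi> n x \<noteq> 0" by (rule nz) (use n2 in auto)
  ultimately have "\<forall>\<^sub>F x in F. False" by eventually_elim simp
  then show ?thesis by simp
qed blast

text \<open>In this order convergence at the top is enough: if \<open>D k\<close> of a remainder
  diverged while level k + 1 vanishes, comparison with psi_(k+2) would bound it by twice the modulus
  of \<open>D k (\<psi> (Suc (Suc k)))\<close>, which tends to 0. This is why (vi) consists of one
  integral.\<close>

lemma last_convergent_imp_vanish:
  assumes "(D (n - 1) (R f b) \<longlongrightarrow> c) F"
  shows "\<exists>a. vanishing a"
  unfolding vanishing_def
proof (rule subtract_to_vanish[OF fCk])
  fix k a assume k: "k < n" and lim: "\<And>i. k < i \<Longrightarrow> i < n \<Longrightarrow> (D i (R f a) \<longlongrightarrow> 0) F"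
  show "\<exists>c. (D k (R f a) \<longlongrightarrow> c) F"
  proof (cases "k = n - 1")
    case True
    \<comment> \<open>A change of coefficients shifts the top image by a constant, so the one
      convergent choice \<open>b\<close> serves every \<open>a\<close>.\<close>
    have "\<forall>\<^sub>F x in F. D (n - 1) (R f b) x + (D (n - 1) (R f a) T - D (n - 1) (R f b) T) = D (n - 1) (R f a) x"
      using eventually_S
    proof eventually_elim
      case (elim x)
      then show ?case using increment_shift[OF fCk T_S elim, of a] increment_shift[OF fCk T_S elim, of b] by linarith
    qed
    moreover have "((\<lambda>x. D (n - 1) (R f b) x + (D (n - 1) (R f a) T - D (n - 1) (R f b) T)) \<longlongrightarrow>
        c + (D (n - 1) (R f a) T - D (n - 1) (R f b) T)) F"
      by (intro tendsto_intros assms)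
    ultimately show ?thesis unfolding True using Lim_transform_eventually by blast
  next
    case False
    then have k': "Suc k < n" using k by simp
    show ?thesis using R_ev_mono[OF k]
    proof (rule ev_mono_cases)
      assume inf: "filterlim (\<lambda>x. \<bar>D k (R f a) x\<bar>) at_top F"
      have "\<forall>\<^sub>F x in F. \<bar>D (Suc k) (R f a) x\<bar> < 1"
        using order_tendstoD(2)[OF tendsto_rabs[OF lim[of "Suc k"]], of 1] k' by simp
      with eventually_abs_D_\<psi>[OF k']
      have "\<forall>\<^sub>F x in F. \<bar>D (Suc k) (R f a) x\<bar> \<le> 1 * \<bar>D (Suc k) (\<psi> (Suc (Suc k))) x\<bar>"
        by eventually_elim simp
      from le_div_w[OF this, of "Suc k"] k'
      have "\<forall>\<^sub>F x in F. \<bar>D k (R f a) x\<bar> \<le> 2 * 1 * \<bar>D k (\<psi> (Suc (Suc k))) x\<bar>"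
        by (intro compare_diverging[OF _ evd_D _ evd_D[OF R_Ck k'] inf])
           (auto intro!: Ck[unfolded One_nat_def] one_signed_div_w one_signed_D_\<psi>)
      moreover have "\<forall>\<^sub>F x in F. \<bar>D k (\<psi> (Suc (Suc k))) x\<bar> < 1"
        using order_tendstoD(2)[OF tendsto_rabs[OF D_\<psi>_vanish[of k "Suc (Suc k)"]], of 1] k' by simp
      moreover have "\<forall>\<^sub>F x in F. 2 \<le> \<bar>D k (R f a) x\<bar>" using inf by (simp add: filterlim_at_top)
      ultimately have "\<forall>\<^sub>F x in F. False" by eventually_elim simp
      then show ?thesis by simp
    qed blast
  qed
qed

lemma N_0_finite_imp_vanish:
  assumes "N 0 T < \<infinity>" shows "\<exists>a. vanishing a"
proof -
  have "\<exists>c. (D (n - 1) (R f (\<lambda>_. 0)) \<longlongrightarrow> c) F"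
    by (rule accum_finite[OF R_accumulates T_S]) (use assms[unfolded N_0] in simp)
  then obtain c where "(D (n - 1) (R f (\<lambda>_. 0)) \<longlongrightarrow> c) F" ..
  then show ?thesis by (rule last_convergent_imp_vanish)
qed

end

section \<open>The scale in increasing order: the operators L_k\<close>

locale growing = nonneg_L +
  assumes nz: "\<And>i. i \<in> {1..n} \<Longrightarrow> \<forall>\<^sub>F x in F. \<psi> i x \<noteq> 0"
    and gro: "\<And>i. i \<in> {1..<n} \<Longrightarrow> ((\<lambda>x. \<psi> i x / \<psi> (Suc i) x) \<longlongrightarrow> 0) F"
begin

lemma smallo_\<psi>: "1 \<le> i \<Longrightarrow> i < j \<Longrightarrow> j \<le> n \<Longrightarrow> \<psi> i \<in> o[F](\<psi> j)"
proof (induction j)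
  case (Suc j)
  have s: "\<psi> j \<in> o[F](\<psi> (Suc j))"
    by (rule smalloI_tendsto) (use gro[of j] nz[of "Suc j"] Suc.prems in auto)
  then show ?case
    using Suc landau_o.small_trans[OF _ s] by (cases "i = j") auto
qed simp

text \<open>If \<open>D i (\<psi> j)\<close> converged, it would be bounded by a multiple of the
  constant image of psi_(i+1). Descending along the divergent lower images of psi_j would give psi_j
  = O(psi_(i+1)), against the order of the scale.\<close>

lemma D_\<psi>_diverges: "Suc i < j \<Longrightarrow> j \<le> n \<Longrightarrow> filterlim (\<lambda>x. \<bar>D i (\<psi> j) x\<bar>) at_top F"
proof (induction i arbitrary: j rule: less_induct)
  case (less i)
  have "ev_mono (D i (\<psi> j))" using ev_mono_D_\<psi>[of "j - 1" i] less.prems by simp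
  then show ?case
  proof (rule ev_mono_cases)
    fix c assume c: "(D i (\<psi> j) \<longlongrightarrow> c) F"
    have i: "i < n" using less.prems by simp
    have "\<forall>\<^sub>F x in F. \<bar>D i (\<psi> j) x\<bar> < \<bar>c\<bar> + 1"
      using order_tendstoD(2)[OF tendsto_rabs[OF c], of "\<bar>c\<bar> + 1"] by simp
    with eventually_abs_D_\<psi>[OF i]
    have le: "\<forall>\<^sub>F x in F. \<bar>D i (\<psi> j) x\<bar> \<le> (\<bar>c\<bar> + 1) * \<bar>D i (\<psi> (Suc i)) x\<bar>"
      by eventually_elim simp
    have "\<exists>C\<ge>0. \<forall>\<^sub>F x in F. \<bar>D 0 (\<psi> j) x\<bar> \<le> C * \<bar>D 0 (\<psi> (Suc i)) x\<bar>"
      by (rule descend_diverging[OF Ck Ck i one_signed_D_\<psi> le])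
         (use less i in auto)
    then obtain C where C: "C \<ge> 0" "\<forall>\<^sub>F x in F. \<bar>D 0 (\<psi> j) x\<bar> \<le> C * \<bar>D 0 (\<psi> (Suc i)) x\<bar>" by blast
    have False
      by (rule smallo_contradiction[OF smallo_\<psi>[of "Suc i" j] nz C(1) D_0_le[OF C(2)]])
         (use less.prems in auto)
    then show ?thesis ..
  qed
qed

text \<open>psi_1 is now the smallest function of the scale, so the remainder is little-o of every
  psi_(k+1).\<close>

lemma smallo_imp_vanishing:
  assumes o: "R f a \<in> o[F](\<psi> 1)"
  shows "vanishing a"
  unfolding vanishing_def
proof (intro allI impI)
  fix k assume k: "k < n"
  show "(D k (R f a) \<longlongrightarrow> 0) F"
  proof (rule vanish_if_smallo_diverging[OF R_Ck k R_ev_mono[OF k]])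
    show "R f a \<in> o[F](\<psi> (Suc k))"
      using o landau_o.small_trans[OF o smallo_\<psi>[of 1 "Suc k"]] k by (cases "k = 0") auto
  qed (use k in \<open>auto intro!: nz D_\<psi>_diverges\<close>)
qed

text \<open>\<open>D 0\<close> divides by the modulus of psi_1, so vanishing at level 0 is already
  the claim.\<close>

lemma vanish_imp_smallo:
  assumes "vanishing a" shows "R f a \<in> o[F](\<psi> 1)"
proof (rule smalloI_tendsto)
  have "((\<lambda>x. \<bar>D 0 (R f a) x\<bar>) \<longlongrightarrow> 0) F"
    by (rule tendsto_rabs_zero[OF vanishingD[OF assms]]) (use n2 in simp)
  then have "((\<lambda>x. \<bar>R f a x / \<psi> 1 x\<bar>) \<longlongrightarrow> 0) F" by (simp add: Dop.simps qw_def abs_mult)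
  then show "((\<lambda>x. R f a x / \<psi> 1 x) \<longlongrightarrow> 0) F" by (rule tendsto_rabs_zero_cancel)
qed (use nz n2 in auto)

end

section \<open>Reversing the scale\<close>

lemma ndet_reverse_columns:
  assumes "n \<le> m"
  shows "ndet m (\<lambda>r c. A r (if c < n then n - Suc c else c))
    = of_int (sign (\<lambda>c. if c < n then n - Suc c else c)) * ndet m A"
proof (rule ndet_permute_columns)
  have "bij_betw (\<lambda>c. if c < n then n - Suc c else c) {..<m} {..<m}"
    by (rule bij_betw_byWitness[of _ "\<lambda>c. if c < n then n - Suc c else c"]) (use assms in auto)
  then show "(\<lambda>c. if c < n then n - Suc c else c) permutes {..<m}"
    using assms by (intro bij_imp_permutes) auto
qed

lemma Wr_eq_Wf_reverse: "Wr S \<phi> n = Wf S (\<lambda>j. \<phi> (n + 1 - j))"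
  by (simp add: Wr_def[abs_def] Wf_def[abs_def])

lemma pw_eq_qw_reverse: "pw S \<phi> n = qw S (\<lambda>j. \<phi> (n + 1 - j)) n"
  by (intro ext) (simp add: pw_def qw_def Wr_eq_Wf_reverse)

text \<open>The column of u keeps its place, so numerator and denominator both change by the sign of
  the same reversing permutation.\<close>

lemma Lop_reverse: "Lop S (\<lambda>j. \<phi> (n + 1 - j)) n u = Lop S \<phi> n u"
proof
  fix x
  define p where "p c = (if c < n then n - Suc c else c)" for c
  define A where "A r c = hderiv S r (if c < n then \<phi> (Suc c) else u) x" for r c
  have "wronskian S (\<lambda>c. if c < n then \<phi> (n + 1 - Suc c) else u) (Suc n) x = ndet (Suc n) (\<lambda>r c. A r (p c))"
    by (auto simp: wronskian_def A_def p_def Suc_diff_Suc intro!: ndet_cong)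
  also have "\<dots> = of_int (sign p) * ndet (Suc n) A"
    unfolding p_def by (rule ndet_reverse_columns) simp
  also have "ndet (Suc n) A = wronskian S (\<lambda>c. if c < n then \<phi> (Suc c) else u) (Suc n) x"
    by (simp add: wronskian_def A_def[abs_def])
  finally have 1: "wronskian S (\<lambda>c. if c < n then \<phi> (n + 1 - Suc c) else u) (Suc n) x
    = of_int (sign p) * wronskian S (\<lambda>c. if c < n then \<phi> (Suc c) else u) (Suc n) x" .
  have "Wf S (\<lambda>j. \<phi> (n + 1 - j)) n x = ndet n (\<lambda>r c. A r (p c))"
    by (auto simp: Wf_def wronskian_def A_def p_def Suc_diff_Suc intro!: ndet_cong)
  also have "\<dots> = of_int (sign p) * ndet n A"
    unfolding p_def by (rule ndet_reverse_columns) simp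
  also have "ndet n A = Wf S \<phi> n x"
    by (auto simp: Wf_def wronskian_def A_def intro!: ndet_cong)
  finally have 2: "Wf S (\<lambda>j. \<phi> (n + 1 - j)) n x = of_int (sign p) * Wf S \<phi> n x" .
  have "of_int (sign p) \<noteq> (0::real)" by (simp add: sign_def)
  then show "Lop S (\<lambda>j. \<phi> (n + 1 - j)) n u x = Lop S \<phi> n u x"
    unfolding Lop_def 1 2 by simp
qed


text \<open>\<open>Wr_nz\<close> expresses that the reversed Wronskians have no zeros, as the
  weights p_i presuppose. The integrals take values in \<open>ennreal\<close>, so convergence is
  finiteness. The final conjunct holds for every coefficient vector that realizes (ii).\<close>

theorem theorem6p1:
  fixes T :: real and x0 :: ereal and n :: nat
    and \<phi> :: "nat \<Rightarrow> real \<Rightarrow> real" and f :: "real \<Rightarrow> real"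
  defines "S \<equiv> Ico_e T x0"
  defines "F \<equiv> left_at x0"
  assumes Tx0: "ereal T < x0"
    and n2: "2 \<le> n"
    and scale: "cheb_asymp_scale T x0 n \<phi>"
    and phiAC: "\<forall>i\<in>{1..n}. ACk_on S (n - 1) (\<phi> i)"
    and Wpos: "\<forall>i\<in>{1..n}. \<forall>x\<in>S. Wf S \<phi> i x > 0"
    and Wr_nz: "\<forall>i\<in>{1..n}. \<forall>x\<in>S. Wr S \<phi> n i x \<noteq> 0"
    and fAC: "ACk_on S (n - 1) f"
    and Lf_nonneg: "AE x in lborel. x \<in> S \<longrightarrow> Lop S \<phi> n f x \<ge> 0"
  shows
    "((\<exists>a::nat \<Rightarrow> real. (\<lambda>x. f x - (\<Sum>j=1..n-1. a j * \<phi> j x)) \<in> O[F](\<phi> n))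
      \<longleftrightarrow> (\<exists>a::nat \<Rightarrow> real. (\<lambda>x. f x - (\<Sum>j=1..n. a j * \<phi> j x)) \<in> o[F](\<phi> n)))
     \<and> ((\<exists>a::nat \<Rightarrow> real. (\<lambda>x. f x - (\<Sum>j=1..n. a j * \<phi> j x)) \<in> o[F](\<phi> n))
      \<longleftrightarrow> (\<exists>a::nat \<Rightarrow> real.
             (\<forall>k\<in>{1..n-1}. (\<lambda>x. Lkop S \<phi> n k f x - (\<Sum>j=1..n-k. a j * Lkop S \<phi> n k (\<phi> j) x))
                              \<in> o[F](\<lambda>_. 1))
             \<and> (\<lambda>x. f x - (\<Sum>j=1..n. a j * \<phi> j x)) \<in> o[F](\<phi> n)))
     \<and> ((\<exists>a::nat \<Rightarrow> real.
             (\<forall>k\<in>{1..n-1}. (\<lambda>x. Lkop S \<phi> n k f x - (\<Sum>j=1..n-k. a j * Lkop S \<phi> n k (\<phi> j) x))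
                              \<in> o[F](\<lambda>_. 1))
             \<and> (\<lambda>x. f x - (\<Sum>j=1..n. a j * \<phi> j x)) \<in> o[F](\<phi> n))
      \<longleftrightarrow> (\<exists>a::nat \<Rightarrow> real.
             (\<lambda>x. f x - (\<Sum>j=1..n. a j * \<phi> j x)) \<in> o[F](\<phi> n)
             \<and> (\<forall>k\<in>{1..n-1}. (\<lambda>x. Mop S \<phi> n k f x - (\<Sum>j=k+1..n. a j * Mop S \<phi> n k (\<phi> j) x))
                              \<in> o[F](Mop S \<phi> n k (\<phi> n)))))
     \<and> ((\<exists>a::nat \<Rightarrow> real.
             (\<lambda>x. f x - (\<Sum>j=1..n. a j * \<phi> j x)) \<in> o[F](\<phi> n)
             \<and> (\<forall>k\<in>{1..n-1}. (\<lambda>x. Mop S \<phi> n k f x - (\<Sum>j=k+1..n. a j * Mop S \<phi> n k (\<phi> j) x))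
                              \<in> o[F](Mop S \<phi> n k (\<phi> n))))
      \<longleftrightarrow> nint x0 (pw S \<phi> n) (Lop S \<phi> n f) n (n - 1) T < \<infinity>)
     \<and> (nint x0 (pw S \<phi> n) (Lop S \<phi> n f) n (n - 1) T < \<infinity>
      \<longleftrightarrow> (\<integral>\<^sup>+ t. indicator S t * ennreal (Lop S \<phi> n f t / qw S \<phi> n n t) \<partial>lborel) < \<infinity>)
     \<and> (\<forall>a::nat \<Rightarrow> real.
          (\<lambda>x. f x - (\<Sum>j=1..n. a j * \<phi> j x)) \<in> o[F](\<phi> n) \<longrightarrow>
          (let R0 = (\<lambda>x. f x - (\<Sum>j=1..n. a j * \<phi> j x)) in
            (\<forall>x\<in>S.
               nint x0 (pw S \<phi> n) (Lop S \<phi> n f) n (n - 1) x < \<infinity>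
               \<and> nint x0 (qw S \<phi> n) (Lop S \<phi> n f) n (n - 1) x < \<infinity>
               \<and> R0 x = (-1) ^ n / pw S \<phi> n 0 x
                          * enn2real (nint x0 (pw S \<phi> n) (Lop S \<phi> n f) n (n - 1) x)
               \<and> R0 x = (-1) ^ n / qw S \<phi> n 0 x
                          * enn2real (nint x0 (qw S \<phi> n) (Lop S \<phi> n f) n (n - 1) x)
               \<and> (-1) ^ n * R0 x \<ge> 0)
            \<and> antimono_on S (\<lambda>x. (-1) ^ n * R0 x * pw S \<phi> n 0 x)
            \<and> antimono_on S (\<lambda>x. (-1) ^ n * R0 x * qw S \<phi> n 0 x)))"
proof -
  \<comment> \<open>The reversed scale; its index range is again 1 to n.\<close>
  define \<psi> where "\<psi> j = \<phi> (n + 1 - j)" for j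
  have \<psi>_eq: "\<psi> = (\<lambda>j. \<phi> (n + 1 - j))" by (auto simp: \<psi>_def)
  interpret M: decaying T x0 n \<phi> f
  proof
    show "ereal T < x0" "2 \<le> n" by fact+
    show "ACk_on (Ico_e T x0) (n - 1) (\<phi> i)" if "i \<in> {1..n}" for i using phiAC that by (simp add: S_def)
    show "Wf (Ico_e T x0) \<phi> i x \<noteq> 0" if "i \<in> {1..n}" "x \<in> Ico_e T x0" for i x
      using Wpos that by (force simp: S_def)
    show "ACk_on (Ico_e T x0) (n - 1) f" using fAC by (simp add: S_def)
    show "AE t in lborel. t \<in> Ico_e T x0 \<longrightarrow> 0 \<le> Lop (Ico_e T x0) \<phi> n f t" using Lf_nonneg by (simp add: S_def)
    show "\<forall>\<^sub>F x in left_at x0. \<phi> i x \<noteq> 0" if "i \<in> {1..n}" for i using scale that by (simp add: cheb_asymp_scale_def)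
    show "((\<lambda>x. \<phi> (Suc i) x / \<phi> i x) \<longlongrightarrow> 0) (left_at x0)" if "i \<in> {1..<n}" for i
      using scale that by (simp add: cheb_asymp_scale_def)
  qed
  interpret L: growing T x0 n \<psi> f
  proof
    show "ACk_on (Ico_e T x0) (n - 1) (\<psi> i)" if "i \<in> {1..n}" for i
      unfolding \<psi>_def by (rule M.AC) (use that in auto)
    show "Wf (Ico_e T x0) \<psi> i x \<noteq> 0" if "i \<in> {1..n}" "x \<in> Ico_e T x0" for i x
      using Wr_nz that unfolding Wr_eq_Wf_reverse \<psi>_eq S_def by blast
    show "AE t in lborel. t \<in> Ico_e T x0 \<longrightarrow> 0 \<le> Lop (Ico_e T x0) \<psi> n f t"
      using M.Lf unfolding \<psi>_eq Lop_reverse .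
    show "\<forall>\<^sub>F x in left_at x0. \<psi> i x \<noteq> 0" if "i \<in> {1..n}" for i
      unfolding \<psi>_def by (rule M.nz) (use that in auto)
    show "((\<lambda>x. \<psi> i x / \<psi> (Suc i) x) \<longlongrightarrow> 0) (left_at x0)" if "i \<in> {1..<n}" for i
      using M.dec[of "n - i"] that by (auto simp: \<psi>_def Suc_diff_le)
  qed (use M.fAC in \<open>auto simp: n2\<close>)
  have pw: "pw S \<phi> n = qw S \<psi> n" unfolding \<psi>_eq by (rule pw_eq_qw_reverse)
  have LopL: "Lop S \<psi> n f = Lop S \<phi> n f" unfolding \<psi>_eq by (rule Lop_reverse)
  \<comment> \<open>Coefficients are reversed along with the scale, so both locales speak of the
    same remainder.\<close>
  have sum_rev: "(\<Sum>j=1..n. a (n + 1 - j) * g (\<psi> j)) = (\<Sum>j=1..n. a j * g (\<phi> j))" for a :: "nat \<Rightarrow> real" and g :: "(real \<Rightarrow> real) \<Rightarrow> real"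
  proof -
    have "(\<Sum>j=1..n. a j * g (\<phi> j)) = (\<Sum>j=1..n. a (n + 1 - j) * g (\<phi> (n + 1 - j)))"
      by (rule sum.atLeastAtMost_rev)
    then show ?thesis by (simp add: \<psi>_def)
  qed
  have Rs: "(\<Sum>j=1..n. a (n + 1 - j) * \<psi> j x) = (\<Sum>j=1..n. a j * \<phi> j x)" for a x
    by (rule sum_rev[of a "\<lambda>g. g x"])
  have R: "L.R f (\<lambda>j. a (n + 1 - j)) = M.R f a" for a
    unfolding Rs ..
  have \<psi>1: "\<psi> 1 = \<phi> n" by (simp add: \<psi>_def)
  have vanL: "L.vanishing (\<lambda>j. a (n + 1 - j))" if "M.R f a \<in> o[F](\<phi> n)" for a
    by (rule L.smallo_imp_vanishing) (use that in \<open>unfold R \<psi>1 F_def\<close>)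
  have vanM: "M.vanishing a" if "M.R f a \<in> o[F](\<phi> n)" for a
    using M.smallo_imp_vanishing that by (simp add: F_def)
  have unvanL: "\<exists>a. M.R f a \<in> o[F](\<phi> n)" if "L.vanishing b" for b
  proof -
    define a where "a j = b (n + 1 - j)" for j
    have "L.R f (\<lambda>j. a (n + 1 - j)) = L.R f b" by (auto simp: a_def intro!: ext sum.cong)
    then show ?thesis using L.vanish_imp_smallo[OF that] unfolding R \<psi>1 F_def by metis
  qed
  have unvanM: "\<exists>a. M.R f a \<in> o[F](\<phi> n)" if "M.vanishing a" for a
    using M.vanish_imp_smallo[OF that] unfolding F_def by blast
  have N0: "(\<integral>\<^sup>+ t. indicator S t * ennreal (Lop S \<phi> n f t / qw S \<phi> n n t) \<partial>lborel) = M.N 0 T"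
    by (simp add: S_def)
  have NL: "nint x0 (pw S \<phi> n) (Lop S \<phi> n f) n (n - 1) x = L.N (n - 1) x" for x
    unfolding pw LopL[symmetric] by (simp add: S_def)
  show ?thesis (is "(?P1 \<longleftrightarrow> ?P2) \<and> (_ \<longleftrightarrow> ?P3) \<and> (_ \<longleftrightarrow> ?P4) \<and> (_ \<longleftrightarrow> ?P5) \<and> (_ \<longleftrightarrow> ?P6) \<and> (\<forall>a. ?A a \<longrightarrow> ?B a)")
  proof -
    \<comment> \<open>Each condition is compared with (ii) alone; the stated chain of equivalences
      then follows propositionally.\<close>
    have ?P2 if h: ?P1
    proof -
      obtain a where a: "(\<lambda>x. f x - (\<Sum>j=1..n-1. a j * \<phi> j x)) \<in> O[F](\<phi> n)" using h by blast
      have "{1..n} = insert n {1..n-1}" using n2 by auto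
      \<comment> \<open>Condition (i) says nothing about a_n, so 0 is taken provisionally;
        \<open>last_convergent_imp_vanish\<close> later supplies suitable coefficients.\<close>
      then have "M.R f (a(n := 0)) = (\<lambda>x. f x - (\<Sum>j=1..n-1. a j * \<phi> j x))"
        using n2 by (auto intro!: ext sum.cong)
      then obtain c where "(M.D (n - 1) (M.R f (a(n := 0))) \<longlongrightarrow> c) F"
        using M.bigo_imp_last_convergent[of "a(n := 0)"] a unfolding F_def by auto
      then show ?P2 using M.last_convergent_imp_vanish unvanM unfolding F_def by blast
    qed
    moreover have ?P1 if h: ?P2
    proof -
      obtain a where a: "M.R f a \<in> o[F](\<phi> n)" using h by blast
      have "{1..n} = insert n {1..n-1}" using n2 by auto
      then have e: "(\<lambda>x. f x - (\<Sum>j=1..n-1. a j * \<phi> j x)) = (\<lambda>x. M.R f a x + a n * \<phi> n x)"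
        using n2 by (auto intro!: ext)
      have "(\<lambda>x. M.R f a x + a n * \<phi> n x) \<in> O[F](\<phi> n)"
        by (rule sum_in_bigo(1)[OF landau_o.small_imp_big[OF a]]) simp
      then show ?P1 unfolding e[symmetric] by blast
    qed
    moreover have ?P3 if h: ?P2
    proof -
      obtain a where a: "M.R f a \<in> o[F](\<phi> n)" using h by blast
      have "(\<lambda>x. Lkop S \<phi> n k f x - (\<Sum>j=1..n-k. a j * Lkop S \<phi> n k (\<phi> j) x)) \<in> o[F](\<lambda>_. 1)"
        if k: "k \<in> {1..n-1}" for k
      proof -
        have "(L.D k (M.R f a) \<longlongrightarrow> 0) F"
          using L.vanishingD[OF vanL[OF a], of k] k n2 unfolding R F_def by auto
        moreover have "\<forall>\<^sub>F x in F. L.D k (M.R f a) x = Lkop S \<phi> n k f x - (\<Sum>j=1..n-k. a j * Lkop S \<phi> n k (\<phi> j) x)"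
          using M.eventually_S unfolding F_def
        proof (rule eventually_mono)
          fix x assume x: "x \<in> Ico_e T x0"
          have "L.D k (M.R f a) x = L.D k f x - (\<Sum>j=1..n. a (n + 1 - j) * L.D k (\<psi> j) x)"
            unfolding R[symmetric] by (rule L.D_sum_\<psi>[OF L.fCk order_refl]) (use k n2 x in auto)
          also have "(\<Sum>j=1..n. a (n + 1 - j) * L.D k (\<psi> j) x) = (\<Sum>j=1..n. a j * L.D k (\<phi> j) x)"
            by (rule sum_rev)
          \<comment> \<open>\<open>L.D k\<close> annihilates psi_1, ..., psi_k, that is phi_n, ...,
            phi_(n-k+1).\<close>
          also have "\<dots> = (\<Sum>j=1..n-k. a j * L.D k (\<phi> j) x)"
          proof (rule sum.mono_neutral_right)
            show "\<forall>j\<in>{1..n} - {1..n-k}. a j * L.D k (\<phi> j) x = 0"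
            proof
              fix j assume j: "j \<in> {1..n} - {1..n-k}"
              then have "L.D k (\<psi> (n + 1 - j)) x = 0" by (intro L.D_\<psi>_0) (use k n2 x in auto)
              moreover have "\<psi> (n + 1 - j) = \<phi> j" using j by (simp add: \<psi>_def)
              ultimately show "a j * L.D k (\<phi> j) x = 0" by simp
            qed
          qed auto
          finally show "L.D k (M.R f a) x = Lkop S \<phi> n k f x - (\<Sum>j=1..n-k. a j * Lkop S \<phi> n k (\<phi> j) x)"
            unfolding Lkop_def pw by (simp add: S_def)
        qed
        ultimately have "((\<lambda>x. Lkop S \<phi> n k f x - (\<Sum>j=1..n-k. a j * Lkop S \<phi> n k (\<phi> j) x)) \<longlongrightarrow> 0) F"
          by (rule Lim_transform_eventually)
        then show ?thesis by (intro smalloI_tendsto) auto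
      qed
      with a show ?P3 by blast
    qed
    moreover have ?P4 if h: ?P2
    proof -
      obtain a where a: "M.R f a \<in> o[F](\<phi> n)" using h by blast
      have "(\<lambda>x. Mop S \<phi> n k f x - (\<Sum>j=k+1..n. a j * Mop S \<phi> n k (\<phi> j) x)) \<in> o[F](Mop S \<phi> n k (\<phi> n))"
        if k: "k \<in> {1..n-1}" for k
      proof -
        have kn: "k < n" using k n2 by auto
        have o: "M.D k (M.R f a) \<in> o[F](M.D k (\<phi> n))"
          using M.vanish_imp_smallo_D[OF vanM[OF a] kn] unfolding F_def .
        have ev: "\<forall>\<^sub>F x in F. M.D k (M.R f a) x = Mop S \<phi> n k f x - (\<Sum>j=k+1..n. a j * Mop S \<phi> n k (\<phi> j) x)"
          using M.eventually_S unfolding F_def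
        proof (rule eventually_mono)
          fix x assume x: "x \<in> Ico_e T x0"
          have "M.D k (M.R f a) x = M.D k f x - (\<Sum>j=1..n. a j * M.D k (\<phi> j) x)"
            by (rule M.D_sum_\<psi>[OF M.fCk order_refl kn x])
          also have "(\<Sum>j=1..n. a j * M.D k (\<phi> j) x) = (\<Sum>j=k+1..n. a j * M.D k (\<phi> j) x)"
            by (rule sum.mono_neutral_right) (use kn x in \<open>auto intro!: M.D_\<psi>_0\<close>)
          finally show "M.D k (M.R f a) x = Mop S \<phi> n k f x - (\<Sum>j=k+1..n. a j * Mop S \<phi> n k (\<phi> j) x)"
            by (simp add: Mop_def S_def)
        qed
        have "(\<lambda>x. Mop S \<phi> n k f x - (\<Sum>j=k+1..n. a j * Mop S \<phi> n k (\<phi> j) x)) \<in> o[F](M.D k (\<phi> n))"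
          using o unfolding landau_o.small.in_cong[OF ev] .
        then show ?thesis by (simp add: Mop_def S_def)
      qed
      with a show ?P4 by blast
    qed
    moreover have ?P2 if ?P3 using that by blast
    moreover have ?P2 if ?P4 using that by blast
    moreover have ?P5 if h: ?P2
    proof -
      obtain a where "M.R f a \<in> o[F](\<phi> n)" using h by blast
      from L.vanish_imp_representation(1)[OF vanL[OF this] M.T_S] show ?P5 unfolding NL .
    qed
    moreover have ?P2 if h: ?P5
      using L.N_finite_imp_vanish h unvanL unfolding NL L.vanishing_def by blast
    moreover have ?P6 if h: ?P2
    proof -
      obtain a where "M.R f a \<in> o[F](\<phi> n)" using h by blast
      from M.vanish_imp_N_0_finite[OF vanM[OF this]] show ?P6 unfolding N0 .
    qed
    moreover have ?P2 if h: ?P6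
      using M.N_0_finite_imp_vanish h unvanM unfolding N0 by blast
    moreover have "?B a" if a: "?A a" for a
      unfolding Let_def
    proof (intro conjI ballI)
      note vL = vanL[OF a] and vM = vanM[OF a]
      fix x assume "x \<in> S"
      then have x: "x \<in> Ico_e T x0" by (simp add: S_def)
      note rL = L.vanish_imp_representation[OF vL x, unfolded Rs] and rM = M.vanish_imp_representation[OF vM x]
      show "nint x0 (pw S \<phi> n) (Lop S \<phi> n f) n (n - 1) x < \<infinity>" unfolding NL by (rule rL(1))
      show "nint x0 (qw S \<phi> n) (Lop S \<phi> n f) n (n - 1) x < \<infinity>" unfolding S_def by (rule rM(1))
      show "f x - (\<Sum>j=1..n. a j * \<phi> j x) = (-1) ^ n / pw S \<phi> n 0 x
          * enn2real (nint x0 (pw S \<phi> n) (Lop S \<phi> n f) n (n - 1) x)"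
        unfolding pw LopL[symmetric] unfolding S_def by (rule rL(2))
      show "f x - (\<Sum>j=1..n. a j * \<phi> j x) = (-1) ^ n / qw S \<phi> n 0 x
          * enn2real (nint x0 (qw S \<phi> n) (Lop S \<phi> n f) n (n - 1) x)"
        unfolding S_def by (rule rM(2))
      show "(-1) ^ n * (f x - (\<Sum>j=1..n. a j * \<phi> j x)) \<ge> 0" by (rule rM(3))
    next
      show "antimono_on S (\<lambda>x. (-1) ^ n * (f x - (\<Sum>j=1..n. a j * \<phi> j x)) * pw S \<phi> n 0 x)"
        using L.vanish_imp_antimono[OF vanL[OF a]] unfolding Rs pw unfolding S_def .
      show "antimono_on S (\<lambda>x. (-1) ^ n * (f x - (\<Sum>j=1..n. a j * \<phi> j x)) * qw S \<phi> n 0 x)"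
        using M.vanish_imp_antimono[OF vanM[OF a]] unfolding S_def .
    qed
    ultimately show ?thesis by blast
  qed
qed

end
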